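(* Let $n\ge2$, let $\bm{m}=(m_1,\dots,m_n)$ be a tuple of integers $m_j\ge1$, and let $\mathcal{Q}$ be a quotient module of $A^2_{\bm{m}}$. Then the following conditions are equivalent: (i) $\mathcal{Q}$ is doubly commuting. (ii) There exist $M_z^*$-invariant closed subspaces $\mathcal{Q}_i$ of $A^2_{m_i}$, $i=1,\dots,n$, such that $\mathcal{Q}\cong\mathcal{Q}_1\otimes\cdots\otimes\mathcal{Q}_n$. (iii) There exist Hilbert spaces $\mathcal{E}_i$ and partially isometric multipliers $\theta_i\in\mathcal{M}(A^2_1(\mathcal{E}_i),A^2_{m_i})$, $i=1,\dots,n$, such that $\mathcal{Q}\cong\mathcal{Q}_{\theta_1}\otimes\cdots\otimes\mathcal{Q}_{\theta_n}$, where $\mathcal{Q}_{\theta_j}=A^2_{m_j}/\theta_jA^2_1(\mathcal{E}_j)$, $j=1,\dots,n$.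
   Context: For an integer $m\ge1$, $A^2_m$ is the reproducing kernel Hilbert space on the unit disc $\mathbb{D}$ with kernel $B_m(z,w)=(1-z\bar w)^{-m}$, and $M_z$ is multiplication by $z$ on it. $A^2_1(\mathcal{E})=H^2(\mathcal{E})$ is the $\mathcal{E}$-valued Hardy space. $A^2_{\bm{m}}\cong A^2_{m_1}\otimes\cdots\otimes A^2_{m_n}$ is the reproducing kernel Hilbert space on the polydisc $\mathbb{D}^n$ with kernel $\prod_{i=1}^n(1-z_i\bar w_i)^{-m_i}$, and $M_{z_i}$ is multiplication by $z_i$ on it. A quotient module of $A^2_{\bm{m}}$ is a closed subspace $\mathcal{Q}\subseteq A^2_{\bm{m}}$ invariant under $M_{z_1}^*,\dots,M_{z_n}^*$. Put $C_{z_i}=P_{\mathcal{Q}}M_{z_i}|_{\mathcal{Q}}$. $\mathcal{Q}$ is doubly commuting if $C_{z_i}^*C_{z_j}=C_{z_j}C_{z_i}^*$ for all $1\le i<j\le n$. If $\mathcal{Q}_i\subseteq A^2_{m_i}$ are $M_z^*$-invariant closed subspaces, then $\mathcal{Q}_1\otimes\cdots\otimes\mathcal{Q}_n$ is regarded as a closed subspace of $A^2_{\bm{m}}=A^2_{m_1}\otimes\cdots\otimes A^2_{m_n}$, and it is a quotient module. For quotient modules $\mathcal{Q},\mathcal{Q}'$ of $A^2_{\bm{m}}$, $\mathcal{Q}\cong\mathcal{Q}'$ means that the compressed tuples are jointly unitarily equivalent: there is a unitary $U:\mathcal{Q}\to\mathcal{Q}'$ with $U\,P_{\mathcal{Q}}M_{z_i}|_{\mathcal{Q}}=P_{\mathcal{Q}'}M_{z_i}|_{\mathcal{Q}'}\,U$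 for $i=1,\dots,n$. $\mathcal{M}(A^2_1(\mathcal{E}),A^2_m)$ is the set of holomorphic $\theta:\mathbb{D}\to\mathcal{B}(\mathcal{E},\mathbb{C})$ with $\theta f\in A^2_m$ for all $f\in A^2_1(\mathcal{E})$; $\theta$ is partially isometric if $M_\theta:f\mapsto\theta f$ is a partial isometry. The quotient $A^2_m/\theta A^2_1(\mathcal{E})$ is identified with the orthogonal complement of $\theta A^2_1(\mathcal{E})$ in $A^2_m$. *)

theory Defs
  imports "HOL-Analysis.Analysis"
begin

section \<open>Complex Hilbert spaces on explicit carriers\<close>

text \<open>Carriers are sets rather than types, because the statement quantifies existentially over
  Hilbert spaces.  The operations are only meaningful on the carrier.\<close>

record 'a hspace =
  vecs :: "'a set"
  vadd :: "'a \<Rightarrow> 'a \<Rightarrow> 'a"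
  vzero :: 'a
  vscale :: "complex \<Rightarrow> 'a \<Rightarrow> 'a"
  vinner :: "'a \<Rightarrow> 'a \<Rightarrow> complex"

definition vnorm :: "'a hspace \<Rightarrow> 'a \<Rightarrow> real" where
  "vnorm H x = sqrt (Re (vinner H x x))"

text \<open>\<^const>\<open>Metric_space\<close> wants a distance that is nonnegative and symmetric also off the
  carrier, hence the case distinction.\<close>

definition vdist :: "'a hspace \<Rightarrow> 'a \<Rightarrow> 'a \<Rightarrow> real" where
  "vdist H x y =
    (if x \<in> vecs H \<and> y \<in> vecs H then vnorm H (vadd H x (vscale H (-1) y)) else 0)"

locale inner_product_space =
  fixes H :: "'a hspace"
  assumes add_closed: "x \<in> vecs H \<Longrightarrow> y \<in> vecs H \<Longrightarrow> vadd H x y \<in> vecs H"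
    and zero_closed: "vzero H \<in> vecs H"
    and scale_closed: "x \<in> vecs H \<Longrightarrow> vscale H c x \<in> vecs H"
    and add_assoc: "x \<in> vecs H \<Longrightarrow> y \<in> vecs H \<Longrightarrow> z \<in> vecs H \<Longrightarrow>
      vadd H (vadd H x y) z = vadd H x (vadd H y z)"
    and add_commute: "x \<in> vecs H \<Longrightarrow> y \<in> vecs H \<Longrightarrow> vadd H x y = vadd H y x"
    and add_zero: "x \<in> vecs H \<Longrightarrow> vadd H (vzero H) x = x"
    and scale_add_right: "x \<in> vecs H \<Longrightarrow> y \<in> vecs H \<Longrightarrow>
      vscale H c (vadd H x y) = vadd H (vscale H c x) (vscale H c y)"
    and scale_add_left: "x \<in> vecs H \<Longrightarrow>
      vscale H (c + d) x = vadd H (vscale H c x) (vscale H d x)"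
    and scale_scale: "x \<in> vecs H \<Longrightarrow> vscale H c (vscale H d x) = vscale H (c * d) x"
    and scale_one: "x \<in> vecs H \<Longrightarrow> vscale H 1 x = x"
    and scale_zero: "x \<in> vecs H \<Longrightarrow> vscale H 0 x = vzero H"
    and inner_add: "x \<in> vecs H \<Longrightarrow> y \<in> vecs H \<Longrightarrow> z \<in> vecs H \<Longrightarrow>
      vinner H (vadd H x y) z = vinner H x z + vinner H y z"
    and inner_scale: "x \<in> vecs H \<Longrightarrow> y \<in> vecs H \<Longrightarrow>
      vinner H (vscale H c x) y = c * vinner H x y"
    and inner_commute: "x \<in> vecs H \<Longrightarrow> y \<in> vecs H \<Longrightarrow> vinner H y x = cnj (vinner H x y)"
    and inner_nonneg: "x \<in> vecs H \<Longrightarrow> 0 \<le> Re (vinner H x x)"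
    and inner_eq_zero: "x \<in> vecs H \<Longrightarrow> vinner H x x = 0 \<Longrightarrow> x = vzero H"

locale hilbert_space = inner_product_space +
  assumes complete: "Metric_space.mcomplete (vecs H) (vdist H)"

text \<open>The coefficient Hilbert spaces have carriers in \<open>(nat \<Rightarrow> complex) + 'e\<close>.  As \<open>'e\<close> is an
  arbitrary type, no Hilbert space is excluded; the left summand makes the type large enough,
  whatever \<open>'e\<close> is, to contain a copy of every separable Hilbert space.\<close>

type_synonym 'e large = "(nat \<Rightarrow> complex) + 'e"

definition complex_line :: "complex hspace" where
  "complex_line =
    \<lparr>vecs = UNIV, vadd = (+), vzero = 0, vscale = (*), vinner = (\<lambda>x y. x * cnj y)\<rparr>"

definition closed_subspace :: "'a hspace \<Rightarrow> 'a set \<Rightarrow> bool" where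
  "closed_subspace H Q \<longleftrightarrow>
    closedin (Metric_space.mtopology (vecs H) (vdist H)) Q \<and>
    vzero H \<in> Q \<and>
    (\<forall>x\<in>Q. \<forall>y\<in>Q. vadd H x y \<in> Q) \<and>
    (\<forall>c. \<forall>x\<in>Q. vscale H c x \<in> Q)"

abbreviation subspace_of :: "'a hspace \<Rightarrow> 'a set \<Rightarrow> 'a hspace" where
  "subspace_of H Q \<equiv> H\<lparr>vecs := Q\<rparr>"

definition orth_complement :: "'a hspace \<Rightarrow> 'a set \<Rightarrow> 'a set" where
  "orth_complement H S = {x \<in> vecs H. \<forall>y\<in>S. vinner H x y = 0}"

definition orth_proj :: "'a hspace \<Rightarrow> 'a set \<Rightarrow> 'a \<Rightarrow> 'a" where
  "orth_proj H Q x =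
    (THE y. y \<in> Q \<and> vadd H x (vscale H (-1) y) \<in> orth_complement H Q)"

definition adj :: "'a hspace \<Rightarrow> 'b hspace \<Rightarrow> ('a \<Rightarrow> 'b) \<Rightarrow> 'b \<Rightarrow> 'a" where
  "adj H G T y = (THE x. x \<in> vecs H \<and> (\<forall>u\<in>vecs H. vinner G (T u) y = vinner H u x))"

definition linear_op :: "'a hspace \<Rightarrow> 'b hspace \<Rightarrow> ('a \<Rightarrow> 'b) \<Rightarrow> bool" where
  "linear_op H G T \<longleftrightarrow>
    (\<forall>x\<in>vecs H. T x \<in> vecs G) \<and>
    (\<forall>x\<in>vecs H. \<forall>y\<in>vecs H. T (vadd H x y) = vadd G (T x) (T y)) \<and>
    (\<forall>c. \<forall>x\<in>vecs H. T (vscale H c x) = vscale G c (T x))"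

definition bounded_op :: "'a hspace \<Rightarrow> 'b hspace \<Rightarrow> ('a \<Rightarrow> 'b) \<Rightarrow> bool" where
  "bounded_op H G T \<longleftrightarrow>
    linear_op H G T \<and> (\<exists>C. \<forall>x\<in>vecs H. vnorm G (T x) \<le> C * vnorm H x)"

definition unitary_op :: "'a hspace \<Rightarrow> 'b hspace \<Rightarrow> ('a \<Rightarrow> 'b) \<Rightarrow> bool" where
  "unitary_op H G U \<longleftrightarrow>
    linear_op H G U \<and> U ` vecs H = vecs G \<and>
    (\<forall>x\<in>vecs H. \<forall>y\<in>vecs H. vinner G (U x) (U y) = vinner H x y)"

text \<open>A partial isometry is isometric on the orthogonal complement of its kernel.\<close>

definition partial_isometry :: "'a hspace \<Rightarrow> 'b hspace \<Rightarrow> ('a \<Rightarrow> 'b) \<Rightarrow> bool" where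
  "partial_isometry H G T \<longleftrightarrow>
    bounded_op H G T \<and>
    (\<forall>x \<in> orth_complement H {u \<in> vecs H. T u = vzero G}. vnorm G (T x) = vnorm H x)"


section \<open>Reproducing kernel Hilbert spaces\<close>

definition kernel_fun ::
    "'x set \<Rightarrow> ('x \<Rightarrow> 'x \<Rightarrow> complex) \<Rightarrow> 'e hspace \<Rightarrow> 'x \<Rightarrow> 'e \<Rightarrow> 'x \<Rightarrow> 'e" where
  "kernel_fun X K E w \<eta> = (\<lambda>z. if z \<in> X then vscale E (K z w) \<eta> else vzero E)"

text \<open>\<open>H\<close> is the Hilbert space of \<open>E\<close>-valued functions on \<open>X\<close> with reproducing kernel
  \<open>K(z,w) I\<^sub>E\<close>.  Functions on \<open>X\<close> are represented by total functions vanishing off \<open>X\<close>, and all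
  record fields are pinned down everywhere, so that by the usual Moore-Aronszajn argument at most
  one record satisfies the predicate.\<close>

definition is_rkhs ::
    "'x set \<Rightarrow> ('x \<Rightarrow> 'x \<Rightarrow> complex) \<Rightarrow> 'e hspace \<Rightarrow> ('x \<Rightarrow> 'e) hspace \<Rightarrow> bool" where
  "is_rkhs X K E H \<longleftrightarrow>
    hilbert_space H \<and>
    (\<forall>f\<in>vecs H. (\<forall>z\<in>X. f z \<in> vecs E) \<and> (\<forall>z. z \<notin> X \<longrightarrow> f z = vzero E)) \<and>
    vadd H = (\<lambda>f g z. vadd E (f z) (g z)) \<and>
    vzero H = (\<lambda>z. vzero E) \<and>
    vscale H = (\<lambda>c f z. vscale E c (f z)) \<and>
    (\<forall>f g. f \<notin> vecs H \<or> g \<notin> vecs H \<longrightarrow> vinner H f g = 0) \<and>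
    (\<forall>w\<in>X. \<forall>\<eta>\<in>vecs E.
      kernel_fun X K E w \<eta> \<in> vecs H \<and>
      (\<forall>f\<in>vecs H. vinner H f (kernel_fun X K E w \<eta>) = vinner E (f w) \<eta>))"

definition rkhs ::
    "'x set \<Rightarrow> ('x \<Rightarrow> 'x \<Rightarrow> complex) \<Rightarrow> 'e hspace \<Rightarrow> ('x \<Rightarrow> 'e) hspace" where
  "rkhs X K E = (THE H. is_rkhs X K E H)"

abbreviation unit_disc :: "complex set" where
  "unit_disc \<equiv> ball 0 1"

definition bergman_kernel :: "nat \<Rightarrow> complex \<Rightarrow> complex \<Rightarrow> complex" where
  "bergman_kernel m z w = 1 / (1 - z * cnj w) ^ m"

definition bergman_vec :: "nat \<Rightarrow> 'e hspace \<Rightarrow> (complex \<Rightarrow> 'e) hspace" where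
  "bergman_vec m E = rkhs unit_disc (bergman_kernel m) E"

abbreviation bergman :: "nat \<Rightarrow> (complex \<Rightarrow> complex) hspace" where
  "bergman m \<equiv> bergman_vec m complex_line"

abbreviation hardy :: "'e hspace \<Rightarrow> (complex \<Rightarrow> 'e) hspace" where
  "hardy E \<equiv> bergman_vec 1 E"

definition polydisc :: "nat \<Rightarrow> (nat \<Rightarrow> complex) set" where
  "polydisc n = {1..n} \<rightarrow>\<^sub>E unit_disc"

definition bergman_poly :: "nat \<Rightarrow> (nat \<Rightarrow> nat) \<Rightarrow> ((nat \<Rightarrow> complex) \<Rightarrow> complex) hspace" where
  "bergman_poly n m =
    rkhs (polydisc n) (\<lambda>z w. \<Prod>i=1..n. bergman_kernel (m i) (z i) (w i)) complex_line"


section \<open>Quotient modules\<close>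

definition mult_z :: "(complex \<Rightarrow> complex) \<Rightarrow> complex \<Rightarrow> complex" where
  "mult_z f = (\<lambda>z. z * f z)"

definition mult_coord :: "nat \<Rightarrow> ((nat \<Rightarrow> complex) \<Rightarrow> complex) \<Rightarrow> (nat \<Rightarrow> complex) \<Rightarrow> complex" where
  "mult_coord i f = (\<lambda>z. z i * f z)"

definition quotient_module_1 :: "nat \<Rightarrow> (complex \<Rightarrow> complex) set \<Rightarrow> bool" where
  "quotient_module_1 m Q \<longleftrightarrow>
    closed_subspace (bergman m) Q \<and>
    (\<forall>f\<in>Q. adj (bergman m) (bergman m) mult_z f \<in> Q)"

definition quotient_module ::
    "nat \<Rightarrow> (nat \<Rightarrow> nat) \<Rightarrow> ((nat \<Rightarrow> complex) \<Rightarrow> complex) set \<Rightarrow> bool" where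
  "quotient_module n m Q \<longleftrightarrow>
    closed_subspace (bergman_poly n m) Q \<and>
    (\<forall>i\<in>{1..n}. \<forall>f\<in>Q. adj (bergman_poly n m) (bergman_poly n m) (mult_coord i) f \<in> Q)"

definition compression ::
    "nat \<Rightarrow> (nat \<Rightarrow> nat) \<Rightarrow> ((nat \<Rightarrow> complex) \<Rightarrow> complex) set \<Rightarrow> nat \<Rightarrow>
      ((nat \<Rightarrow> complex) \<Rightarrow> complex) \<Rightarrow> (nat \<Rightarrow> complex) \<Rightarrow> complex" where
  "compression n m Q i f = orth_proj (bergman_poly n m) Q (mult_coord i f)"

definition doubly_commuting ::
    "nat \<Rightarrow> (nat \<Rightarrow> nat) \<Rightarrow> ((nat \<Rightarrow> complex) \<Rightarrow> complex) set \<Rightarrow> bool" where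
  "doubly_commuting n m Q \<longleftrightarrow>
    (let QH = subspace_of (bergman_poly n m) Q; C = compression n m Q in
      \<forall>i\<in>{1..n}. \<forall>j\<in>{1..n}. i < j \<longrightarrow>
        (\<forall>f\<in>Q. adj QH QH (C i) (C j f) = C j (adj QH QH (C i) f)))"

definition module_iso ::
    "nat \<Rightarrow> (nat \<Rightarrow> nat) \<Rightarrow> ((nat \<Rightarrow> complex) \<Rightarrow> complex) set \<Rightarrow>
      ((nat \<Rightarrow> complex) \<Rightarrow> complex) set \<Rightarrow> bool" where
  "module_iso n m Q Q' \<longleftrightarrow>
    (\<exists>U. unitary_op (subspace_of (bergman_poly n m) Q) (subspace_of (bergman_poly n m) Q') U \<and>
      (\<forall>i\<in>{1..n}. \<forall>f\<in>Q. U (compression n m Q i f) = compression n m Q' i (U f)))"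

text \<open>The identification of the Hilbert space tensor product of the one-variable spaces with the
  polydisc space sends \<open>f\<^sub>1 \<otimes> \<dots> \<otimes> f\<^sub>n\<close> to the function \<open>z \<mapsto> f\<^sub>1(z\<^sub>1) \<cdots> f\<^sub>n(z\<^sub>n)\<close>;
  a tensor product of closed subspaces is the closed linear span of such functions.\<close>

definition elementary_tensor ::
    "nat \<Rightarrow> (nat \<Rightarrow> complex \<Rightarrow> complex) \<Rightarrow> (nat \<Rightarrow> complex) \<Rightarrow> complex" where
  "elementary_tensor n f = (\<lambda>z. if z \<in> polydisc n then \<Prod>i=1..n. f i (z i) else 0)"

definition tensor_subspace ::
    "nat \<Rightarrow> (nat \<Rightarrow> nat) \<Rightarrow> (nat \<Rightarrow> (complex \<Rightarrow> complex) set) \<Rightarrow>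
      ((nat \<Rightarrow> complex) \<Rightarrow> complex) set" where
  "tensor_subspace n m Q =
    closed_subspace (bergman_poly n m) hull {elementary_tensor n f | f. \<forall>i\<in>{1..n}. f i \<in> Q i}"


section \<open>Multipliers\<close>

text \<open>Holomorphy of \<open>\<theta> : \<bbbD> \<rightarrow> B(E, \<complex>)\<close> is complex differentiability in the operator norm.\<close>

definition holomorphic_functionals :: "'e hspace \<Rightarrow> (complex \<Rightarrow> 'e \<Rightarrow> complex) \<Rightarrow> bool" where
  "holomorphic_functionals E \<theta> \<longleftrightarrow>
    (\<forall>z\<in>unit_disc. bounded_op E complex_line (\<theta> z)) \<and>
    (\<forall>z\<in>unit_disc. \<exists>D. bounded_op E complex_line D \<and>
      (\<forall>\<epsilon>>0. \<forall>\<^sub>F w in at z. \<forall>\<eta>\<in>vecs E.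
        cmod (\<theta> w \<eta> - \<theta> z \<eta> - (w - z) * D \<eta>) \<le> \<epsilon> * cmod (w - z) * vnorm E \<eta>))"

definition mult_op ::
    "(complex \<Rightarrow> 'e \<Rightarrow> complex) \<Rightarrow> (complex \<Rightarrow> 'e) \<Rightarrow> complex \<Rightarrow> complex" where
  "mult_op \<theta> f = (\<lambda>z. if z \<in> unit_disc then \<theta> z (f z) else 0)"

definition multipliers :: "nat \<Rightarrow> 'e hspace \<Rightarrow> (complex \<Rightarrow> 'e \<Rightarrow> complex) set" where
  "multipliers m E =
    {\<theta>. holomorphic_functionals E \<theta> \<and> (\<forall>f\<in>vecs (hardy E). mult_op \<theta> f \<in> vecs (bergman m))}"

definition multiplier_quotient ::
    "nat \<Rightarrow> 'e hspace \<Rightarrow> (complex \<Rightarrow> 'e \<Rightarrow> complex) \<Rightarrow> (complex \<Rightarrow> complex) set" where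
  "multiplier_quotient m E \<theta> = orth_complement (bergman m) (mult_op \<theta> ` vecs (hardy E))"

end

theory Submission
  imports Defs "HOL-Complex_Analysis.Cauchy_Integral_Formula"
begin

text \<open>Let \<open>S\<^sub>i\<close> be the adjoint of multiplication by \<open>z\<^sub>i\<close>, let \<open>C\<^sub>i\<close> be the compressions, and
  write \<open>K\<close> for the reproducing kernel of a quotient module \<open>Q\<close>. The adjoint of \<open>C\<^sub>i\<close> is the
  restriction of \<open>S\<^sub>i\<close> to \<open>Q\<close>.

  Suppose that \<open>Q\<close> is doubly commuting. The projection onto the functions that do not depend on
  \<open>z\<^sub>i\<close> is the polynomial \<open>\<Sum> (-1)\<^sup>k (m\<^sub>i choose k) M\<^sub>i\<^sup>k S\<^sub>i\<^sup>k\<close>. Its compression \<open>D\<^sub>i\<close> to \<open>Q\<close> is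
  therefore the same polynomial in \<open>C\<^sub>i\<close> and \<open>S\<^sub>i\<close>, commutes with \<open>C\<^sub>j\<close> and \<open>S\<^sub>j\<close> for \<open>j \<noteq> i\<close>,
  and the product of all the \<open>D\<^sub>i\<close> is the compression of the projection onto the constants, an
  operator of rank at most one. On the other hand the value of \<open>f \<in> Q\<close> at \<open>w\<close> is the value of
  \<open>(1 - w\<^sub>i S\<^sub>i)\<^sup>-\<^sup>m f\<close>, with \<open>m = m\<^sub>i\<close>, at the point where \<open>w\<^sub>i\<close> is replaced by \<open>0\<close>, and these
  resolvents obey the same commutation rules. Playing the two facts against each other splits
  one variable off the kernel (\<open>kernel_split\<close>), and by induction \<open>K(z,w) K(0,0)\<^sup>n\<^sup>-\<^sup>1\<close> is the
  product of the values of \<open>K\<close> on the coordinate axes (\<open>kernel_factorization\<close>). So \<open>Q\<close> is equal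
  to the tensor product of the closed spans of the restrictions of its kernel functions to the
  axes (\<open>module_eq_tensor\<close>).

  Conversely, on an elementary tensor \<open>S\<^sub>i\<close> and \<open>C\<^sub>j\<close> act in different slots
  (\<open>tensor_doubly_commuting\<close>), and a unitary equivalence of the compressions intertwines their
  adjoints as well (\<open>module_iso_doubly_commuting\<close>).

  In one variable, the range of multiplication by \<open>\<theta>\<close> is shift invariant, so its complement is a
  quotient module. Given a quotient module, let \<open>N\<close> be its complement and \<open>K\<^sub>N\<close> the kernel of
  \<open>N\<close>. As the shift is a contraction of \<open>N\<close>, the kernel \<open>(1 - z w\<^sup>*) K\<^sub>N(z,w)\<close> is positive; its
  Hilbert space serves as the coefficient space and point evaluation as \<open>\<theta>\<close>, so that \<open>\<theta>(z)
  \<theta>(w)\<^sup>* / (1 - z w\<^sup>*) = K\<^sub>N(z,w)\<close>, which says that \<open>M\<^sub>\<theta> M\<^sub>\<theta>\<^sup>*\<close> is the projection onto \<open>N\<close>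
  (\<open>multiplier_properties\<close>).

  All spaces are reproducing kernel spaces, so everything is reduced to kernels: they exist
  uniquely (\<open>rkhs_is_rkhs\<close>), operators on them are bounded once an explicit kernel is positive
  (\<open>weighted_composition\<close>), and identities between bounded operators are checked on kernel
  functions (\<open>ops_eq_on_total\<close>).\<close>

abbreviation vminus :: "'a hspace \<Rightarrow> 'a \<Rightarrow> 'a \<Rightarrow> 'a" where
  "vminus H x y \<equiv> vadd H x (vscale H (-1) y)"

text \<open>Optimising over \<open>t\<close> turns a one-sided quadratic estimate into an estimate of
  Cauchy-Schwarz type. It serves both for inner products and for vectors that maximise a
  quadratic functional.\<close>

lemma quadratic_bound:
  fixes a :: complex and b N :: real
  assumes "0 \<le> b" and "\<And>t :: complex. 2 * Re (t * a) - (cmod t)\<^sup>2 * b \<le> N"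
  shows "(cmod a)\<^sup>2 \<le> N * b"
proof (cases "b = 0")
  case True
  have "a = 0"
  proof (rule ccontr)
    assume "a \<noteq> 0"
    have "2 * Re (of_real s * cnj a * a) \<le> N" for s :: real
      using assms(2)[of "of_real s * cnj a"] True by simp
    then have *: "2 * s * (cmod a)\<^sup>2 \<le> N" for s :: real
      by (simp add: mult.assoc complex_norm_square[symmetric] mult.commute[of "cnj a"] flip: of_real_mult of_real_power)
    have "2 * ((\<bar>N\<bar> + 1) / (cmod a)\<^sup>2) * (cmod a)\<^sup>2 \<le> N"
      by (rule *)
    with \<open>a \<noteq> 0\<close> show False by simp
  qed
  with True show ?thesis by simp
next
  case False
  with assms(1) have b: "b > 0" by simp
  let ?t = "of_real (1 / b) * cnj a"
  have "Re (?t * a) = (cmod a)\<^sup>2 / b"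
    by (simp add: mult.assoc complex_norm_square[symmetric] mult.commute[of "cnj a"] flip: of_real_mult of_real_power of_real_divide)
  moreover have "(cmod ?t)\<^sup>2 * b = (cmod a)\<^sup>2 / b"
    using b by (simp add: norm_mult norm_divide power_divide power2_eq_square)
  ultimately have "(cmod a)\<^sup>2 / b \<le> N"
    using assms(2)[of ?t] by linarith
  with b show ?thesis by (simp add: field_simps)
qed

section \<open>Inner product spaces\<close>

context inner_product_space
begin

lemmas [simp] = add_closed zero_closed scale_closed inner_add inner_scale

lemma inner_add_right [simp]:
  "x \<in> vecs H \<Longrightarrow> y \<in> vecs H \<Longrightarrow> z \<in> vecs H \<Longrightarrow>
    vinner H z (vadd H x y) = vinner H z x + vinner H z y"
  using inner_commute[of "vadd H x y" z] inner_commute[of x z] inner_commute[of y z]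
  by simp

lemma inner_scale_right [simp]:
  "x \<in> vecs H \<Longrightarrow> y \<in> vecs H \<Longrightarrow> vinner H y (vscale H c x) = cnj c * vinner H y x"
  using inner_commute[of "vscale H c x" y] inner_commute[of x y] by simp

lemma inner_zero_left [simp]: "x \<in> vecs H \<Longrightarrow> vinner H (vzero H) x = 0"
  using inner_scale[of "vzero H" x 0] scale_zero[of "vzero H"] by simp

lemma inner_zero_right [simp]: "x \<in> vecs H \<Longrightarrow> vinner H x (vzero H) = 0"
  using inner_commute[of "vzero H" x] by simp

lemma inner_self: "x \<in> vecs H \<Longrightarrow> vinner H x x = of_real ((vnorm H x)\<^sup>2)"
  using inner_commute[of x x] inner_nonneg[of x]
  by (simp add: vnorm_def complex_eq_iff)

lemma norm_sq: "x \<in> vecs H \<Longrightarrow> (vnorm H x)\<^sup>2 = Re (vinner H x x)"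
  by (simp add: inner_self)

lemma norm_nonneg [simp]: "x \<in> vecs H \<Longrightarrow> 0 \<le> vnorm H x"
  using inner_nonneg by (simp add: vnorm_def)

lemma norm_eq_zero: "x \<in> vecs H \<Longrightarrow> vnorm H x = 0 \<longleftrightarrow> x = vzero H"
  using inner_eq_zero[of x] inner_self[of x] inner_zero_left[of "vzero H"]
  by (metis of_real_0 power_zero_numeral real_sqrt_zero vnorm_def zero_closed zero_complex.simps(1))

lemma norm_zero [simp]: "vnorm H (vzero H) = 0"
  by (simp add: norm_eq_zero)

lemma norm_add_sq:
  "x \<in> vecs H \<Longrightarrow> y \<in> vecs H \<Longrightarrow>
    (vnorm H (vadd H x y))\<^sup>2 = (vnorm H x)\<^sup>2 + 2 * Re (vinner H x y) + (vnorm H y)\<^sup>2"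
  using inner_commute[of x y] by (simp add: norm_sq)

lemma norm_minus_sq:
  "x \<in> vecs H \<Longrightarrow> y \<in> vecs H \<Longrightarrow>
    (vnorm H (vminus H x y))\<^sup>2 = (vnorm H x)\<^sup>2 - 2 * Re (vinner H x y) + (vnorm H y)\<^sup>2"
  using inner_commute[of x y] by (simp add: norm_sq)

lemma norm_scale: "x \<in> vecs H \<Longrightarrow> vnorm H (vscale H c x) = cmod c * vnorm H x"
proof -
  assume x: "x \<in> vecs H"
  have "vinner H (vscale H c x) (vscale H c x) = of_real ((cmod c * vnorm H x)\<^sup>2)"
    using x by (simp add: inner_self[OF x] power_mult_distrib complex_norm_square mult.assoc
        del: of_real_power)
  then have "(vnorm H (vscale H c x))\<^sup>2 = (cmod c * vnorm H x)\<^sup>2"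
    using x by (simp only: norm_sq scale_closed Re_complex_of_real)
  then show ?thesis using x by (simp add: power2_eq_iff_nonneg)
qed

lemma cauchy_schwarz:
  assumes x: "x \<in> vecs H" and y: "y \<in> vecs H"
  shows "cmod (vinner H x y) \<le> vnorm H x * vnorm H y"
proof -
  have "(cmod (vinner H x y))\<^sup>2 \<le> (vnorm H x)\<^sup>2 * (vnorm H y)\<^sup>2"
  proof (rule quadratic_bound)
    fix t :: complex
    have "0 \<le> (vnorm H (vminus H x (vscale H (cnj t) y)))\<^sup>2" by simp
    then show "2 * Re (t * vinner H x y) - (cmod t)\<^sup>2 * (vnorm H y)\<^sup>2 \<le> (vnorm H x)\<^sup>2"
      using x y by (simp only: norm_minus_sq scale_closed norm_scale inner_scale_right)
        (simp add: power_mult_distrib)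
  qed simp
  then show ?thesis
    using x y by (metis norm_nonneg mult_nonneg_nonneg power_mult_distrib power2_le_imp_le)
qed

lemma norm_triangle:
  assumes x: "x \<in> vecs H" and y: "y \<in> vecs H"
  shows "vnorm H (vadd H x y) \<le> vnorm H x + vnorm H y"
proof (rule power2_le_imp_le)
  have "Re (vinner H x y) \<le> vnorm H x * vnorm H y"
    using cauchy_schwarz[OF x y] complex_Re_le_cmod[of "vinner H x y"] by linarith
  then show "(vnorm H (vadd H x y))\<^sup>2 \<le> (vnorm H x + vnorm H y)\<^sup>2"
    using x y by (simp add: norm_add_sq power2_sum)
qed (use x y in simp)

text \<open>The operations satisfy their laws on the carrier only, so vector identities are not
  normalised algebraically; they are reduced to scalar identities by testing against all
  vectors, and this lemma starts the reduction.\<close>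

lemma minus_eq_zeroD:
  assumes x: "x \<in> vecs H" and y: "y \<in> vecs H" and "vminus H x y = vzero H"
  shows "x = y"
proof -
  have "x = vadd H (vminus H x y) y"
    using x y scale_add_left[of y "-1" 1] scale_one[of y] scale_zero[of y]
    by (metis add_assoc add_zero add_commute scale_closed zero_closed add.left_inverse)
  with assms show ?thesis by (simp add: add_zero)
qed

lemma eq_by_inner:
  assumes x: "x \<in> vecs H" and y: "y \<in> vecs H"
    and "\<And>z. z \<in> vecs H \<Longrightarrow> vinner H x z = vinner H y z"
  shows "x = y"
proof -
  have "vinner H (vminus H x y) (vminus H x y) = 0"
    using assms(3)[OF x] assms(3)[OF y] x y by simp
  with x y show ?thesis
    by (metis inner_eq_zero minus_eq_zeroD add_closed scale_closed)
qed

lemma eq_by_inner_right: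
  assumes "x \<in> vecs H" and "y \<in> vecs H"
    and "\<And>z. z \<in> vecs H \<Longrightarrow> vinner H z x = vinner H z y"
  shows "x = y"
  using assms eq_by_inner inner_commute by metis

lemma norm_minus_commute:
  "x \<in> vecs H \<Longrightarrow> y \<in> vecs H \<Longrightarrow> vnorm H (vminus H x y) = vnorm H (vminus H y x)"
  using norm_minus_sq[of x y] norm_minus_sq[of y x] inner_commute[of x y]
  by (subst power2_eq_iff_nonneg[symmetric]) simp_all

lemma norm_minus_triangle:
  assumes x: "x \<in> vecs H" and y: "y \<in> vecs H" and z: "z \<in> vecs H"
  shows "vnorm H (vminus H x z) \<le> vnorm H (vminus H x y) + vnorm H (vminus H y z)"
proof -
  have "vminus H x z = vadd H (vminus H x y) (vminus H y z)"
    by (rule eq_by_inner) (use x y z in \<open>simp_all add: algebra_simps\<close>)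
  then show ?thesis using norm_triangle[of "vminus H x y" "vminus H y z"] x y z by simp
qed

sublocale metric: Metric_space "vecs H" "vdist H"
proof
  fix x y :: 'a
  show "0 \<le> vdist H x y" by (simp add: vdist_def)
  show "vdist H x y = vdist H y x" by (simp add: vdist_def norm_minus_commute)
next
  fix x y assume "x \<in> vecs H" "y \<in> vecs H"
  then show "vdist H x y = 0 \<longleftrightarrow> x = y"
    using minus_eq_zeroD[of x y] scale_add_left[of x 1 "-1"] scale_one[of x] scale_zero[of x]
    by (auto simp: vdist_def norm_eq_zero)
next
  fix x y z assume "x \<in> vecs H" "y \<in> vecs H" "z \<in> vecs H"
  then show "vdist H x z \<le> vdist H x y + vdist H y z"
    by (simp add: vdist_def norm_minus_triangle)
qed

definition tends_to :: "(nat \<Rightarrow> 'a) \<Rightarrow> 'a \<Rightarrow> bool" where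
  "tends_to f x \<longleftrightarrow> (\<forall>k. f k \<in> vecs H) \<and> x \<in> vecs H \<and> (\<lambda>k. vnorm H (vminus H (f k) x)) \<longlonglongrightarrow> 0"

lemma tends_to_iff_limitin:
  "range f \<subseteq> vecs H \<Longrightarrow> tends_to f x \<longleftrightarrow> limitin metric.mtopology f x sequentially"
  unfolding tends_to_def metric.limitin_metric_dist_null
  by (auto simp: vdist_def image_subset_iff)

lemma closed_subspace_iff:
  "closed_subspace H Q \<longleftrightarrow> Q \<subseteq> vecs H \<and> vzero H \<in> Q \<and>
    (\<forall>x\<in>Q. \<forall>y\<in>Q. vadd H x y \<in> Q) \<and> (\<forall>c. \<forall>x\<in>Q. vscale H c x \<in> Q) \<and>
    (\<forall>f x. (\<forall>k. f k \<in> Q) \<and> tends_to f x \<longrightarrow> x \<in> Q)"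
proof -
  have "closedin metric.mtopology Q \<longleftrightarrow> Q \<subseteq> vecs H \<and> (\<forall>f x. (\<forall>k. f k \<in> Q) \<and> tends_to f x \<longrightarrow> x \<in> Q)"
  proof (cases "Q \<subseteq> vecs H")
    case True
    then have "(\<forall>k. f k \<in> Q) \<and> tends_to f x \<longleftrightarrow> range f \<subseteq> Q \<and> limitin metric.mtopology f x sequentially" for f x
      using tends_to_iff_limitin[of f x] by (auto simp: image_subset_iff)
    with True show ?thesis
      by (simp add: metric.metric_closedin_iff_sequentially_closed)
  qed (simp add: metric.metric_closedin_iff_sequentially_closed)
  then show ?thesis by (auto simp: closed_subspace_def)
qed

lemma tends_to_inner:
  assumes "tends_to f x" and y: "y \<in> vecs H"
  shows "(\<lambda>k. vinner H (f k) y) \<longlonglongrightarrow> vinner H x y"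
proof -
  have f: "\<And>k. f k \<in> vecs H" and x: "x \<in> vecs H"
    and lim: "(\<lambda>k. vnorm H (vminus H (f k) x)) \<longlonglongrightarrow> 0"
    using assms by (auto simp: tends_to_def)
  have "(\<lambda>k. vinner H (f k) y - vinner H x y) \<longlonglongrightarrow> 0"
  proof (rule Lim_null_comparison)
    show "\<forall>\<^sub>F k in sequentially. cmod (vinner H (f k) y - vinner H x y) \<le> vnorm H (vminus H (f k) x) * vnorm H y"
      using cauchy_schwarz[of "vminus H (f k) x" y for k] f x y by (auto intro!: always_eventually)
    show "(\<lambda>k. vnorm H (vminus H (f k) x) * vnorm H y) \<longlonglongrightarrow> 0"
      using tendsto_mult_right[OF lim] by simp
  qed
  then show ?thesis by (simp add: LIM_zero_iff)
qed

lemma tends_to_norm: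
  assumes "tends_to f x"
  shows "(\<lambda>k. vnorm H (f k)) \<longlonglongrightarrow> vnorm H x"
proof -
  have f: "\<And>k. f k \<in> vecs H" and x: "x \<in> vecs H"
    and lim: "(\<lambda>k. vnorm H (vminus H (f k) x)) \<longlonglongrightarrow> 0"
    using assms by (auto simp: tends_to_def)
  have "\<bar>vnorm H (f k) - vnorm H x\<bar> \<le> vnorm H (vminus H (f k) x)" for k
    using norm_minus_triangle[of "f k" x "vzero H"] norm_minus_triangle[of x "f k" "vzero H"]
      norm_minus_commute[of x "f k"] f[of k] x scale_zero[of "vzero H"] scale_scale[of "vzero H" "-1" 0]
    by (simp add: add_commute[of _ "vzero H"] add_zero)
  then have "(\<lambda>k. vnorm H (f k) - vnorm H x) \<longlonglongrightarrow> 0"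
    by (intro Lim_null_comparison[OF _ lim]) auto
  then show ?thesis by (simp add: LIM_zero_iff)
qed

lemma orth_complement_closed:
  assumes "S \<subseteq> vecs H"
  shows "closed_subspace H (orth_complement H S)"
  unfolding closed_subspace_iff
proof (intro conjI allI impI; (elim conjE)?)
  fix f x assume f: "\<forall>k. f k \<in> orth_complement H S" and lim: "tends_to f x"
  show "x \<in> orth_complement H S"
    unfolding orth_complement_def
  proof safe
    show "x \<in> vecs H" using lim by (simp add: tends_to_def)
    fix y assume y: "y \<in> S"
    have "(\<lambda>k. vinner H (f k) y) \<longlonglongrightarrow> vinner H x y"
      using tends_to_inner[OF lim] y assms by blast
    moreover have "vinner H (f k) y = 0" for k
      using f y by (auto simp: orth_complement_def)
    ultimately show "vinner H x y = 0" by (simp add: LIMSEQ_const_iff)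
  qed
qed (use assms in \<open>auto simp: orth_complement_def subset_iff\<close>)

lemma closed_subspace_vecs: "closed_subspace H (vecs H)"
  by (auto simp: closed_subspace_iff tends_to_def)

lemma closed_subspace_Inter:
  "\<T> \<noteq> {} \<Longrightarrow> (\<And>Q. Q \<in> \<T> \<Longrightarrow> closed_subspace H Q) \<Longrightarrow> closed_subspace H (\<Inter>\<T>)"
  unfolding closed_subspace_iff by (intro conjI; blast)

lemma hull_closed_subspace:
  "S \<subseteq> vecs H \<Longrightarrow> closed_subspace H (closed_subspace H hull S)"
  unfolding hull_def using closed_subspace_vecs by (intro closed_subspace_Inter) auto

lemma subspace_inner_product_space:
  assumes "closed_subspace H Q"
  shows "inner_product_space (subspace_of H Q)"
proof -
  have Q: "Q \<subseteq> vecs H" "vzero H \<in> Q" "\<And>x y. x \<in> Q \<Longrightarrow> y \<in> Q \<Longrightarrow> vadd H x y \<in> Q"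
    "\<And>x c. x \<in> Q \<Longrightarrow> vscale H c x \<in> Q"
    using assms by (auto simp: closed_subspace_iff)
  note [simp] = subsetD[OF Q(1)] Q
  show ?thesis
    by unfold_locales
      (auto simp: add_assoc add_zero scale_add_left scale_add_right scale_scale scale_one scale_zero inner_nonneg
        intro: add_commute inner_commute inner_eq_zero)
qed

end

lemma vnorm_subspace [simp]: "vnorm (subspace_of H Q) = vnorm H"
  by (simp add: vnorm_def fun_eq_iff)

section \<open>Hilbert spaces\<close>

lemma (in inner_product_space) hilbert_spaceI:
  assumes "\<And>f. (\<And>k. f k \<in> vecs H) \<Longrightarrow>
      (\<And>e. e > 0 \<Longrightarrow> \<exists>N. \<forall>i\<ge>N. \<forall>j\<ge>N. vnorm H (vminus H (f i) (f j)) < e) \<Longrightarrow> \<exists>x. tends_to f x"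
  shows "hilbert_space H"
proof
  show "metric.mcomplete"
    unfolding metric.mcomplete_def
  proof (intro allI impI)
    fix f assume f: "metric.MCauchy f"
    then have r: "range f \<subseteq> vecs H" by (simp add: metric.MCauchy_def)
    have "\<exists>x. tends_to f x"
    proof (rule assms)
      show "f k \<in> vecs H" for k using r by auto
      fix e :: real assume "e > 0"
      then obtain N where "\<forall>i j. N \<le> i \<longrightarrow> N \<le> j \<longrightarrow> vdist H (f i) (f j) < e"
        using f by (auto simp: metric.MCauchy_def)
      then show "\<exists>N. \<forall>i\<ge>N. \<forall>j\<ge>N. vnorm H (vminus H (f i) (f j)) < e"
        using r by (intro exI[of _ N]) (auto simp: vdist_def image_subset_iff)
    qed
    then show "\<exists>x. limitin metric.mtopology f x sequentially"
      using tends_to_iff_limitin[OF r] by blast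
  qed
qed

context hilbert_space
begin

lemma cauchy_tends_to:
  assumes f: "\<And>k. f k \<in> vecs H"
    and cauchy: "\<And>e. e > 0 \<Longrightarrow> \<exists>N. \<forall>i\<ge>N. \<forall>j\<ge>N. vnorm H (vminus H (f i) (f j)) < e"
  shows "\<exists>x. tends_to f x"
proof -
  have "metric.MCauchy f"
    unfolding metric.MCauchy_def using f cauchy by (auto simp: vdist_def)
  then obtain x where "limitin metric.mtopology f x sequentially"
    using complete by (auto simp: metric.mcomplete_def)
  then show ?thesis using tends_to_iff_limitin[of f] f by blast
qed

lemma subspace_hilbert_space:
  assumes "closed_subspace H Q"
  shows "hilbert_space (subspace_of H Q)"
proof -
  interpret Q: inner_product_space "subspace_of H Q"
    by (rule subspace_inner_product_space[OF assms])
  have sub: "Q \<subseteq> vecs H" using assms by (simp add: closed_subspace_iff)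
  show ?thesis
  proof (rule Q.hilbert_spaceI)
    fix f :: "nat \<Rightarrow> 'a"
    assume f: "\<And>k. f k \<in> vecs (subspace_of H Q)"
      and "\<And>e. e > 0 \<Longrightarrow> \<exists>N. \<forall>i\<ge>N. \<forall>j\<ge>N. vnorm (subspace_of H Q) (vminus (subspace_of H Q) (f i) (f j)) < e"
    then obtain x where x: "tends_to f x"
      using cauchy_tends_to[of f] subsetD[OF sub] by (simp, metis)
    then have "x \<in> Q" using assms f unfolding closed_subspace_iff by simp blast
    with x f show "\<exists>x. Q.tends_to f x"
      by (auto simp: tends_to_def Q.tends_to_def)
  qed
qed

text \<open>A bounded linear functional attains the supremum of \<open>2 Re l x - \<parallel>x\<parallel>\<^sup>2\<close>, by the
  parallelogram law, and it is represented by the maximiser.\<close>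

theorem riesz:
  assumes add: "\<And>x y. x \<in> vecs H \<Longrightarrow> y \<in> vecs H \<Longrightarrow> l (vadd H x y) = l x + l y"
    and scale: "\<And>c x. x \<in> vecs H \<Longrightarrow> l (vscale H c x) = c * l x"
    and bound: "\<And>x. x \<in> vecs H \<Longrightarrow> cmod (l x) \<le> C * vnorm H x"
  shows "\<exists>!y. y \<in> vecs H \<and> (\<forall>x\<in>vecs H. l x = vinner H x y)"
proof -
  define \<phi> where "\<phi> x = 2 * Re (l x) - (vnorm H x)\<^sup>2" for x
  have \<phi>_le: "\<phi> x \<le> C\<^sup>2" if x: "x \<in> vecs H" for x
  proof -
    have "\<phi> x \<le> 2 * C * vnorm H x - (vnorm H x)\<^sup>2"
      using bound[OF x] complex_Re_le_cmod[of "l x"] by (simp add: \<phi>_def)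
    also have "\<dots> \<le> C\<^sup>2"
      using zero_le_power2[of "C - vnorm H x"] unfolding power2_diff by linarith
    finally show ?thesis .
  qed
  then have bdd: "bdd_above (\<phi> ` vecs H)" by (intro bdd_aboveI2[where M = "C\<^sup>2"])
  define s where "s = Sup (\<phi> ` vecs H)"
  have \<phi>_le_s: "\<phi> x \<le> s" if "x \<in> vecs H" for x
    unfolding s_def using bdd that by (intro cSUP_upper)
  have "\<exists>x\<in>vecs H. s - 1 / real (Suc k) < \<phi> x" for k
    using less_cSUP_iff[of "vecs H" \<phi> "s - 1 / real (Suc k)"] bdd zero_closed
    by (simp add: s_def) (metis empty_iff zero_closed)
  then obtain f where f: "\<And>k. f k \<in> vecs H" and f_s: "\<And>k. s - 1 / real (Suc k) < \<phi> (f k)"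
    by metis
  \<comment> \<open>The parallelogram law at the midpoint: near-maximisers are close to each other.\<close>
  have gap: "(vnorm H (vminus H x y))\<^sup>2 \<le> 2 * (s - \<phi> x) + 2 * (s - \<phi> y)"
    if x: "x \<in> vecs H" and y: "y \<in> vecs H" for x y
  proof -
    let ?z = "vscale H (1/2) (vadd H x y)"
    have "\<phi> ?z = Re (l x) + Re (l y) - (vnorm H (vadd H x y))\<^sup>2 / 4"
      using x y by (simp add: \<phi>_def norm_scale power_divide add scale)
    also have "\<dots> = (\<phi> x + \<phi> y) / 2 + (vnorm H (vminus H x y))\<^sup>2 / 4"
      using x y by (simp add: \<phi>_def norm_add_sq norm_minus_sq norm_scale field_simps)
    finally show ?thesis using \<phi>_le_s[of ?z] x y by (simp add: field_simps)
  qed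
  have "\<exists>y. tends_to f y"
  proof (rule cauchy_tends_to[OF f])
    fix e :: real assume e: "e > 0"
    obtain N where N: "1 / real (Suc N) < e\<^sup>2 / 4"
      using nat_approx_posE[of "e\<^sup>2 / 4"] e by auto
    show "\<exists>N. \<forall>i\<ge>N. \<forall>j\<ge>N. vnorm H (vminus H (f i) (f j)) < e"
    proof (intro exI allI impI)
      fix i j assume ij: "N \<le> i" "N \<le> j"
      have "1 / real (Suc i) \<le> 1 / real (Suc N)" "1 / real (Suc j) \<le> 1 / real (Suc N)"
        using ij by (auto simp: frac_le)
      then have "s - \<phi> (f i) < e\<^sup>2 / 4" "s - \<phi> (f j) < e\<^sup>2 / 4"
        using f_s[of i] f_s[of j] N by linarith+
      then have "(vnorm H (vminus H (f i) (f j)))\<^sup>2 < e\<^sup>2"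
        by (intro order.strict_trans1[OF gap[OF f f, of i j]]) simp
      then show "vnorm H (vminus H (f i) (f j)) < e"
        using e by (simp add: power2_less_imp_less)
    qed
  qed
  then obtain y where y: "tends_to f y" by blast
  then have yH: "y \<in> vecs H" by (simp add: tends_to_def)
  have l_lim: "(\<lambda>k. l (f k)) \<longlonglongrightarrow> l y"
  proof -
    have "(\<lambda>k. l (f k) - l y) \<longlonglongrightarrow> 0"
    proof (rule Lim_null_comparison)
      show "\<forall>\<^sub>F k in sequentially. cmod (l (f k) - l y) \<le> C * vnorm H (vminus H (f k) y)"
        using bound[of "vminus H (f k) y" for k] f yH by (auto simp: add scale intro!: always_eventually)
      show "(\<lambda>k. C * vnorm H (vminus H (f k) y)) \<longlonglongrightarrow> 0"
        using y by (auto simp: tends_to_def intro!: tendsto_mult_right_zero)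
    qed
    then show ?thesis by (simp add: LIM_zero_iff)
  qed
  have "(\<lambda>k. \<phi> (f k)) \<longlonglongrightarrow> \<phi> y"
    unfolding \<phi>_def by (intro tendsto_intros l_lim tends_to_norm y)
  moreover have "(\<lambda>k. \<phi> (f k)) \<longlonglongrightarrow> s"
  proof (rule tendsto_sandwich)
    show "\<forall>\<^sub>F k in sequentially. s - 1 / real (Suc k) \<le> \<phi> (f k)"
      using f_s by (auto intro!: always_eventually less_imp_le)
    show "\<forall>\<^sub>F k in sequentially. \<phi> (f k) \<le> s"
      using \<phi>_le_s f by (auto intro!: always_eventually)
    have "(\<lambda>k. 1 / real (Suc k)) \<longlonglongrightarrow> 0"
      using LIMSEQ_inverse_real_of_nat by (simp add: inverse_eq_divide)
    then show "(\<lambda>k. s - 1 / real (Suc k)) \<longlonglongrightarrow> s"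
      using tendsto_diff[OF tendsto_const[of s]] by fastforce
  qed simp
  ultimately have \<phi>_y: "\<phi> y = s" using LIMSEQ_unique by blast
  \<comment> \<open>The first variation of \<open>\<phi>\<close> vanishes at its maximiser.\<close>
  have rep: "l x = vinner H x y" if x: "x \<in> vecs H" for x
  proof -
    have "(cmod (l x - vinner H x y))\<^sup>2 \<le> 0 * (vnorm H x)\<^sup>2"
    proof (rule quadratic_bound)
      fix t :: complex
      have "\<phi> (vadd H y (vscale H t x)) \<le> \<phi> y"
        using \<phi>_le_s x yH \<phi>_y by simp
      moreover have "Re (vinner H y (vscale H t x)) = Re (t * vinner H x y)"
        using x yH inner_commute[of x y] by simp
      ultimately show "2 * Re (t * (l x - vinner H x y)) - (cmod t)\<^sup>2 * (vnorm H x)\<^sup>2 \<le> 0"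
        using x yH by (simp add: \<phi>_def add scale norm_add_sq norm_scale power_mult_distrib algebra_simps)
    qed simp
    then show ?thesis by simp
  qed
  show ?thesis
  proof (rule ex1I[of _ y])
    fix z assume "z \<in> vecs H \<and> (\<forall>x\<in>vecs H. l x = vinner H x z)"
    then show "z = y" using rep yH by (intro eq_by_inner_right) auto
  qed (use rep yH in blast)
qed

end

context hilbert_space
begin

lemma inner_eq_commute:
  assumes "x \<in> vecs H" "y \<in> vecs H" "z \<in> vecs H"
  shows "vinner H z x = vinner H z y \<longleftrightarrow> vinner H x z = vinner H y z"
  using assms inner_commute[of z x] inner_commute[of z y] by simp

lemma inner_eq_zero_commute:
  assumes "x \<in> vecs H" "y \<in> vecs H"
  shows "vinner H x y = 0 \<longleftrightarrow> vinner H y x = 0"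
  using assms inner_commute[of x y] by simp

text \<open>The projection of \<open>x\<close> represents the functional \<open>y \<mapsto> \<langle>y, x\<rangle>\<close> on \<open>Q\<close>, which is a Hilbert
  space by itself.\<close>

lemma projection_exists:
  assumes Q: "closed_subspace H Q" and x: "x \<in> vecs H"
  shows "\<exists>!y. y \<in> Q \<and> vminus H x y \<in> orth_complement H Q"
proof -
  interpret QH: hilbert_space "subspace_of H Q" by (rule subspace_hilbert_space[OF Q])
  have sub: "\<And>y. y \<in> Q \<Longrightarrow> y \<in> vecs H" using Q by (auto simp: closed_subspace_iff)
  have "\<exists>!y. y \<in> vecs (subspace_of H Q) \<and>
      (\<forall>z\<in>vecs (subspace_of H Q). vinner H z x = vinner (subspace_of H Q) z y)"
    by (rule QH.riesz[where C = "vnorm H x"])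
      (use sub x cauchy_schwarz in \<open>auto simp: mult.commute\<close>)
  then have "\<exists>!y. y \<in> Q \<and> (\<forall>z\<in>Q. vinner H z x = vinner H z y)" by simp
  moreover have "(y \<in> Q \<and> (\<forall>z\<in>Q. vinner H z x = vinner H z y)) \<longleftrightarrow>
      (y \<in> Q \<and> vminus H x y \<in> orth_complement H Q)" for y
  proof (cases "y \<in> Q")
    case True
    then have "vinner H z x = vinner H z y \<longleftrightarrow> vinner H (vminus H x y) z = 0" if "z \<in> Q" for z
      using inner_eq_commute[of x y z] sub x that by simp
    with True sub x show ?thesis by (simp add: orth_complement_def del: inner_add)
  qed simp
  ultimately show ?thesis by simp
qed

lemma orth_proj_props:
  assumes Q: "closed_subspace H Q" and x: "x \<in> vecs H"
  shows "orth_proj H Q x \<in> Q" and "vminus H x (orth_proj H Q x) \<in> orth_complement H Q"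
  using theI'[OF projection_exists[OF Q x]] by (auto simp: orth_proj_def)

lemma orth_proj_closed [simp]:
  assumes Q: "closed_subspace H Q" and x: "x \<in> vecs H"
  shows "orth_proj H Q x \<in> vecs H"
  using orth_proj_props(1)[OF Q x] Q by (auto simp: closed_subspace_iff)

lemma closed_subspaceD:
  assumes "closed_subspace H Q"
  shows "x \<in> Q \<Longrightarrow> x \<in> vecs H" "vzero H \<in> Q" "x \<in> Q \<Longrightarrow> y \<in> Q \<Longrightarrow> vadd H x y \<in> Q"
    "x \<in> Q \<Longrightarrow> vscale H c x \<in> Q"
  using assms by (auto simp: closed_subspace_iff)

lemma orth_proj_inner:
  assumes Q: "closed_subspace H Q" and x: "x \<in> vecs H" and y: "y \<in> Q"
  shows "vinner H (orth_proj H Q x) y = vinner H x y"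
proof -
  have "vinner H (vminus H x (orth_proj H Q x)) y = 0"
    using orth_proj_props(2)[OF Q x] y by (auto simp: orth_complement_def)
  then show ?thesis using Q x closed_subspaceD(1)[OF Q y] by simp
qed

lemma orth_proj_inner_right:
  assumes Q: "closed_subspace H Q" and x: "x \<in> vecs H" and y: "y \<in> Q"
  shows "vinner H y (orth_proj H Q x) = vinner H y x"
  using orth_proj_inner[OF assms] inner_commute Q x closed_subspaceD(1)[OF Q y] orth_proj_closed[OF Q x]
  by metis

lemma eq_in_subspace:
  assumes Q: "closed_subspace H Q" and "x \<in> Q" "y \<in> Q" and "\<And>z. z \<in> Q \<Longrightarrow> vinner H x z = vinner H y z"
  shows "x = y"
proof -
  interpret QH: hilbert_space "subspace_of H Q" by (rule subspace_hilbert_space[OF Q])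
  show ?thesis using QH.eq_by_inner[of x y] assms by simp
qed

lemma orth_proj_eqI:
  assumes Q: "closed_subspace H Q" and x: "x \<in> vecs H" and y: "y \<in> Q"
    and "\<And>z. z \<in> Q \<Longrightarrow> vinner H y z = vinner H x z"
  shows "orth_proj H Q x = y"
  by (rule eq_in_subspace[OF Q orth_proj_props(1)[OF Q x] y])
    (use assms orth_proj_inner[OF Q x] in simp)

lemma orth_proj_id: "closed_subspace H Q \<Longrightarrow> x \<in> Q \<Longrightarrow> orth_proj H Q x = x"
  by (rule orth_proj_eqI) (auto dest: closed_subspaceD)

lemma norm_orth_proj_le:
  assumes Q: "closed_subspace H Q" and x: "x \<in> vecs H"
  shows "vnorm H (orth_proj H Q x) \<le> vnorm H x"
proof -
  let ?y = "orth_proj H Q x"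
  have y: "?y \<in> vecs H" "?y \<in> Q" using orth_proj_props[OF Q x] Q x by auto
  have "Re (vinner H x ?y) = (vnorm H ?y)\<^sup>2"
    unfolding norm_sq[OF y(1)] orth_proj_inner[OF Q x y(2)] by (rule refl)
  with norm_minus_sq[OF x y(1)] have "(vnorm H ?y)\<^sup>2 \<le> (vnorm H x)\<^sup>2"
    using zero_le_power2[of "vnorm H (vminus H x ?y)"] by linarith
  then show ?thesis by (rule power2_le_imp_le) (use x in simp)
qed

lemma mem_double_orth:
  assumes Q: "closed_subspace H Q" and x: "x \<in> vecs H"
    and "\<And>y. y \<in> orth_complement H Q \<Longrightarrow> vinner H x y = 0"
  shows "x \<in> Q"
proof -
  let ?y = "orth_proj H Q x"
  have y: "?y \<in> vecs H" "?y \<in> Q" "vminus H x ?y \<in> orth_complement H Q"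
    using orth_proj_props[OF Q x] Q x by auto
  have "vinner H x (vminus H x ?y) = 0" using assms(3) y by blast
  moreover have "vinner H ?y (vminus H x ?y) = 0"
    using y x inner_eq_zero_commute[of ?y "vminus H x ?y"]
    unfolding orth_complement_def by blast
  ultimately have "vinner H (vminus H x ?y) (vminus H x ?y) = 0"
    using x y by simp
  then have "vminus H x ?y = vzero H" by (rule inner_eq_zero[rotated]) (use x y in simp)
  then have "x = ?y" by (rule minus_eq_zeroD[OF x y(1)])
  with y show ?thesis by simp
qed

definition total :: "'a set \<Rightarrow> bool" where
  "total S \<longleftrightarrow> S \<subseteq> vecs H \<and>
    (\<forall>y\<in>vecs H. (\<forall>s\<in>S. vinner H y s = 0) \<longrightarrow> y = vzero H)"

lemma total_subspace:
  assumes S: "total S" and T: "closed_subspace H T" and "S \<subseteq> T"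
  shows "T = vecs H"
proof
  show "T \<subseteq> vecs H" using T by (auto dest: closed_subspaceD)
  show "vecs H \<subseteq> T"
  proof
    fix x assume x: "x \<in> vecs H"
    show "x \<in> T"
    proof (rule mem_double_orth[OF T x])
      fix y assume "y \<in> orth_complement H T"
      then have "y = vzero H" using S \<open>S \<subseteq> T\<close> unfolding total_def orth_complement_def by blast
      with x show "vinner H x y = 0" by simp
    qed
  qed
qed

text \<open>The equation \<open>x = y + a T x\<close> is a fixed point problem for a strict contraction, which
  takes the place of the Neumann series for \<open>(1 - a T)\<^sup>-\<^sup>1\<close>.\<close>

lemma neumann:
  assumes T: "linear_op H H T" and contr: "\<And>x. x \<in> vecs H \<Longrightarrow> vnorm H (T x) \<le> vnorm H x"
    and a: "cmod a < 1" and y: "y \<in> vecs H"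
  shows "\<exists>x\<in>vecs H. vminus H x (vscale H a (T x)) = y"
proof -
  define F where "F x = vadd H y (vscale H a (T x))" for x
  have Tc [simp]: "T x \<in> vecs H" if "x \<in> vecs H" for x using T that by (auto simp: linear_op_def)
  obtain x where x: "x \<in> vecs H" "F x = x"
  proof (rule metric.Banach_fixedpoint_thm[OF complete, of F "cmod a"])
    show "F \<in> vecs H \<rightarrow> vecs H" using y by (auto simp: F_def)
    fix u v assume u: "u \<in> vecs H" and v: "v \<in> vecs H"
    have "vminus H (F u) (F v) = vscale H a (vminus H (T u) (T v))"
      by (rule eq_by_inner) (use u v y in \<open>simp_all add: F_def algebra_simps\<close>)
    also have "\<dots> = vscale H a (T (vminus H u v))"
      using T u v by (simp add: linear_op_def)
    finally have "vnorm H (vminus H (F u) (F v)) \<le> cmod a * vnorm H (vminus H u v)"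
      using contr[of "vminus H u v"] u v by (simp add: norm_scale mult_left_mono)
    then show "vdist H (F u) (F v) \<le> cmod a * vdist H u v"
      using u v y by (simp add: vdist_def F_def)
  qed (use zero_closed a in blast)+
  have "vminus H x (vscale H a (T x)) = y"
  proof (rule eq_by_inner)
    fix z assume z: "z \<in> vecs H"
    have "vinner H x z = vinner H (F x) z" using x by simp
    then show "vinner H (vminus H x (vscale H a (T x))) z = vinner H y z"
      using x(1) y z by (simp add: F_def)
  qed (use x y in auto)
  with x show ?thesis by blast
qed

end

section \<open>Bounded operators and adjoints\<close>

lemma adj_exists:
  assumes "hilbert_space H" and "inner_product_space G" and T: "bounded_op H G T" and y: "y \<in> vecs G"
  shows "\<exists>!x. x \<in> vecs H \<and> (\<forall>u\<in>vecs H. vinner G (T u) y = vinner H u x)"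
proof -
  interpret H: hilbert_space H by fact
  interpret G: inner_product_space G by fact
  have lin: "\<And>x. x \<in> vecs H \<Longrightarrow> T x \<in> vecs G"
    "\<And>x y. x \<in> vecs H \<Longrightarrow> y \<in> vecs H \<Longrightarrow> T (vadd H x y) = vadd G (T x) (T y)"
    "\<And>x c. x \<in> vecs H \<Longrightarrow> T (vscale H c x) = vscale G c (T x)"
    using T by (auto simp: bounded_op_def linear_op_def)
  obtain C where C: "\<And>x. x \<in> vecs H \<Longrightarrow> vnorm G (T x) \<le> C * vnorm H x"
    using T by (auto simp: bounded_op_def)
  show ?thesis
  proof (rule H.riesz[where C = "C * vnorm G y"])
    fix x assume x: "x \<in> vecs H"
    have "cmod (vinner G (T x) y) \<le> vnorm G (T x) * vnorm G y"
      using G.cauchy_schwarz lin(1)[OF x] y by blast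
    also have "\<dots> \<le> C * vnorm H x * vnorm G y"
      using C[OF x] y by (simp add: mult_right_mono)
    finally show "cmod (vinner G (T x) y) \<le> C * vnorm G y * vnorm H x"
      by (simp add: mult_ac)
  qed (use lin y in auto)
qed

lemma adj_props:
  assumes "hilbert_space H" and "inner_product_space G" and T: "bounded_op H G T" and y: "y \<in> vecs G"
  shows "adj H G T y \<in> vecs H"
    and "u \<in> vecs H \<Longrightarrow> vinner G (T u) y = vinner H u (adj H G T y)"
  using theI'[OF adj_exists[OF assms]] by (auto simp: adj_def)

lemma adj_eqI:
  assumes "inner_product_space H"
    and "x \<in> vecs H" and "\<And>u. u \<in> vecs H \<Longrightarrow> vinner G (T u) y = vinner H u x"
  shows "adj H G T y = x"
  unfolding adj_def
proof (rule the_equality)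
  interpret H: inner_product_space H by fact
  fix z assume "z \<in> vecs H \<and> (\<forall>u\<in>vecs H. vinner G (T u) y = vinner H u z)"
  then show "z = x" using assms by (intro H.eq_by_inner_right) auto
qed (use assms in blast)

text \<open>The bound follows on testing the adjoint against itself: \<open>\<parallel>T\<^sup>* y\<parallel>\<^sup>2 = \<langle>T T\<^sup>* y, y\<rangle>\<close>.\<close>

lemma adj_norm_le:
  assumes "hilbert_space H" and "inner_product_space G" and T: "linear_op H G T" and y: "y \<in> vecs G"
    and C: "\<And>x. x \<in> vecs H \<Longrightarrow> vnorm G (T x) \<le> C * vnorm H x" "0 \<le> C"
  shows "vnorm H (adj H G T y) \<le> C * vnorm G y"
proof -
  interpret H: hilbert_space H by fact
  interpret G: inner_product_space G by fact
  have T': "bounded_op H G T" using T C(1) by (auto simp: bounded_op_def)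
  let ?x = "adj H G T y"
  have x: "?x \<in> vecs H" using adj_props(1)[OF assms(1,2) T' y] .
  then have Tx: "T ?x \<in> vecs G" using T by (auto simp: linear_op_def)
  have "(vnorm H ?x)\<^sup>2 = Re (vinner G (T ?x) y)"
    using adj_props(2)[OF assms(1,2) T' y x] x by (simp add: H.norm_sq)
  also have "\<dots> \<le> vnorm G (T ?x) * vnorm G y"
    using G.cauchy_schwarz[OF Tx y] complex_Re_le_cmod order_trans by blast
  also have "\<dots> \<le> C * vnorm H ?x * vnorm G y"
    using C(1)[OF x] y by (simp add: mult_right_mono)
  finally have "vnorm H ?x * vnorm H ?x \<le> vnorm H ?x * (C * vnorm G y)"
    by (simp add: power2_eq_square mult_ac)
  then show ?thesis
    using x y C(2) by (cases "vnorm H ?x = 0") (auto simp: less_le)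
qed

text \<open>Together with the minimality of hulls this extends a membership statement from generators
  to the closed subspace that they generate.\<close>

lemma preimage_closed_subspace:
  assumes "inner_product_space H" and "inner_product_space G" and T: "bounded_op H G T"
    and S: "closed_subspace G S"
  shows "closed_subspace H {x \<in> vecs H. T x \<in> S}"
proof -
  interpret H: inner_product_space H by fact
  interpret G: inner_product_space G by fact
  have lin: "\<And>x. x \<in> vecs H \<Longrightarrow> T x \<in> vecs G"
    "\<And>x y. x \<in> vecs H \<Longrightarrow> y \<in> vecs H \<Longrightarrow> T (vadd H x y) = vadd G (T x) (T y)"
    "\<And>x c. x \<in> vecs H \<Longrightarrow> T (vscale H c x) = vscale G c (T x)"
    using T by (auto simp: bounded_op_def linear_op_def)
  obtain C where C: "\<And>x. x \<in> vecs H \<Longrightarrow> vnorm G (T x) \<le> C * vnorm H x"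
    using T by (auto simp: bounded_op_def)
  have Sd: "vzero G \<in> S" "\<And>x y. x \<in> S \<Longrightarrow> y \<in> S \<Longrightarrow> vadd G x y \<in> S" "\<And>x c. x \<in> S \<Longrightarrow> vscale G c x \<in> S"
    "\<And>f x. (\<And>k. f k \<in> S) \<Longrightarrow> G.tends_to f x \<Longrightarrow> x \<in> S"
    using S unfolding G.closed_subspace_iff by blast+
  have zero: "T (vzero H) = vzero G"
    using lin(3)[of "vzero H" 0] H.scale_zero G.scale_zero lin(1) by simp
  show ?thesis
    unfolding H.closed_subspace_iff
  proof (intro conjI allI impI; (elim conjE)?)
    fix f x assume f: "\<forall>k. f k \<in> {x \<in> vecs H. T x \<in> S}" and lim: "H.tends_to f x"
    then have x: "x \<in> vecs H" by (simp add: H.tends_to_def)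
    have "G.tends_to (\<lambda>k. T (f k)) (T x)"
      unfolding G.tends_to_def
    proof (intro conjI allI)
      show "(\<lambda>k. vnorm G (vminus G (T (f k)) (T x))) \<longlonglongrightarrow> 0"
      proof (rule Lim_null_comparison)
        show "\<forall>\<^sub>F k in sequentially. norm (vnorm G (vminus G (T (f k)) (T x))) \<le> C * vnorm H (vminus H (f k) x)"
        proof (intro always_eventually allI)
          fix k
          have "vminus G (T (f k)) (T x) = T (vminus H (f k) x)"
            using f x lin by simp
          then show "norm (vnorm G (vminus G (T (f k)) (T x))) \<le> C * vnorm H (vminus H (f k) x)"
            using C[of "vminus H (f k) x"] f x lin(1) by simp
        qed
        show "(\<lambda>k. C * vnorm H (vminus H (f k) x)) \<longlonglongrightarrow> 0"
          using lim by (auto simp: H.tends_to_def intro!: tendsto_mult_right_zero)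
      qed
    qed (use f x lin in auto)
    then show "x \<in> {x \<in> vecs H. T x \<in> S}" using Sd(4)[of "\<lambda>k. T (f k)"] f x by simp
  qed (use Sd lin zero in auto)
qed

text \<open>Applied with the kernel functions as total set, this reduces operator identities to
  computations with kernels. For such a computation with values at a point, \<open>G\<close> is the complex
  line.\<close>

lemma ops_eq_on_total:
  assumes "hilbert_space H" and "inner_product_space G" and S: "hilbert_space.total H S"
    and T: "bounded_op H G T" "bounded_op H G T'"
    and eq: "\<And>s. s \<in> S \<Longrightarrow> T s = T' s" and x: "x \<in> vecs H"
  shows "T x = T' x"
proof -
  interpret H: hilbert_space H by fact
  interpret G: inner_product_space G by fact
  have lin: "\<And>x. x \<in> vecs H \<Longrightarrow> T x \<in> vecs G" "\<And>x. x \<in> vecs H \<Longrightarrow> T' x \<in> vecs G"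
    using T by (auto simp: bounded_op_def linear_op_def)
  show ?thesis
  proof (rule G.eq_by_inner)
    fix y assume y: "y \<in> vecs G"
    let ?d = "vminus H (adj H G T y) (adj H G T' y)"
    note p = adj_props[OF assms(1,2) T(1) y] adj_props[OF assms(1,2) T(2) y]
    have SH: "S \<subseteq> vecs H" using S by (simp add: H.total_def)
    have "adj H G T y = adj H G T' y"
    proof (rule H.minus_eq_zeroD)
      have d: "?d \<in> vecs H" using p by simp
      have "vinner H s ?d = 0" if "s \<in> S" for s
        using p(2)[of s] p(4)[of s] p(1,3) eq[OF that] subsetD[OF SH that] by simp
      then have "vinner H ?d s = 0" if "s \<in> S" for s
        using iffD1[OF H.inner_eq_zero_commute[OF subsetD[OF SH that] d]] that by metis
      then show "?d = vzero H" using S d unfolding H.total_def by blast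
    qed (use p in auto)
    then show "vinner G (T x) y = vinner G (T' x) y" using p(2,4) x by simp
  qed (use lin x in auto)
qed

section \<open>Positive kernels and their Hilbert spaces\<close>

text \<open>A list of pairs \<open>(w, \<eta>)\<close> stands for the finite sum of the functions \<open>K(\<cdot>,w) \<eta>\<close>. Working
  with the lists instead of the sums means that nothing has to be shown independent of the
  representation. In the space to be constructed, \<open>kernel_gram\<close> is the inner product of two such
  sums and \<open>kernel_pairing\<close> the inner product of \<open>f\<close> with such a sum.\<close>

definition kernel_pairing :: "'e hspace \<Rightarrow> ('x \<Rightarrow> 'e) \<Rightarrow> ('x \<times> 'e) list \<Rightarrow> complex" where
  "kernel_pairing E f q = (\<Sum>(v, \<zeta>)\<leftarrow>q. vinner E (f v) \<zeta>)"

definition kernel_gram ::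
    "('x \<Rightarrow> 'x \<Rightarrow> complex) \<Rightarrow> 'e hspace \<Rightarrow> ('x \<times> 'e) list \<Rightarrow> ('x \<times> 'e) list \<Rightarrow> complex" where
  "kernel_gram K E p q = (\<Sum>(w, \<eta>)\<leftarrow>p. \<Sum>(v, \<zeta>)\<leftarrow>q. K v w * vinner E \<eta> \<zeta>)"

definition kernel_norm :: "('x \<Rightarrow> 'x \<Rightarrow> complex) \<Rightarrow> 'e hspace \<Rightarrow> ('x \<times> 'e) list \<Rightarrow> real" where
  "kernel_norm K E p = sqrt (Re (kernel_gram K E p p))"

definition kernel_sum ::
    "'x set \<Rightarrow> ('x \<Rightarrow> 'x \<Rightarrow> complex) \<Rightarrow> 'e hspace \<Rightarrow> ('x \<times> 'e) list \<Rightarrow> 'x \<Rightarrow> 'e" where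
  "kernel_sum X K E p = (\<lambda>z. if z \<in> X
    then foldr (\<lambda>(w, \<eta>) s. vadd E (vscale E (K z w) \<eta>) s) p (vzero E) else vzero E)"

definition scale_nodes :: "'e hspace \<Rightarrow> complex \<Rightarrow> ('x \<times> 'e) list \<Rightarrow> ('x \<times> 'e) list" where
  "scale_nodes E c p = map (\<lambda>(w, \<eta>). (w, vscale E c \<eta>)) p"

abbreviation nodes :: "'x set \<Rightarrow> 'e hspace \<Rightarrow> ('x \<times> 'e) list set" where
  "nodes X E \<equiv> lists (X \<times> vecs E)"

definition functions_on :: "'x set \<Rightarrow> 'e hspace \<Rightarrow> ('x \<Rightarrow> 'e) set" where
  "functions_on X E = {f. (\<forall>z\<in>X. f z \<in> vecs E) \<and> (\<forall>z. z \<notin> X \<longrightarrow> f z = vzero E)}"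

text \<open>The functions that induce a bounded functional on the kernel sums. The least such \<open>C\<close>
  turns out to be the norm.\<close>

definition kernel_carrier :: "'x set \<Rightarrow> ('x \<Rightarrow> 'x \<Rightarrow> complex) \<Rightarrow> 'e hspace \<Rightarrow> ('x \<Rightarrow> 'e) set" where
  "kernel_carrier X K E = {f \<in> functions_on X E.
    \<exists>C. \<forall>q\<in>nodes X E. cmod (kernel_pairing E f q) \<le> C * kernel_norm K E q}"

text \<open>Convergence of kernel sums to \<open>f\<close>, formulated through the dual norm because \<open>f\<close> has no
  norm yet.\<close>

definition approximates ::
    "'x set \<Rightarrow> ('x \<Rightarrow> 'x \<Rightarrow> complex) \<Rightarrow> 'e hspace \<Rightarrow> (nat \<Rightarrow> ('x \<times> 'e) list) \<Rightarrow> ('x \<Rightarrow> 'e) \<Rightarrow> bool" where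
  "approximates X K E p f \<longleftrightarrow> (\<forall>k. p k \<in> nodes X E) \<and>
    (\<exists>\<epsilon>. \<epsilon> \<longlonglongrightarrow> 0 \<and> (\<forall>k. \<forall>q\<in>nodes X E.
      cmod (kernel_pairing E f q - kernel_gram K E (p k) q) \<le> \<epsilon> k * kernel_norm K E q))"

definition moore_aronszajn :: "'x set \<Rightarrow> ('x \<Rightarrow> 'x \<Rightarrow> complex) \<Rightarrow> 'e hspace \<Rightarrow> ('x \<Rightarrow> 'e) hspace" where
  "moore_aronszajn X K E =
    \<lparr>vecs = kernel_carrier X K E, vadd = \<lambda>f g z. vadd E (f z) (g z), vzero = \<lambda>z. vzero E,
     vscale = \<lambda>c f z. vscale E c (f z),
     vinner = \<lambda>f g. if f \<in> kernel_carrier X K E \<and> g \<in> kernel_carrier X K E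
       then lim (\<lambda>k. kernel_pairing E f ((SOME r. approximates X K E r g) k)) else 0\<rparr>"

lemma kernel_pairing_simps [simp]:
  "kernel_pairing E f [] = 0"
  "kernel_pairing E f ((v, \<zeta>) # q) = vinner E (f v) \<zeta> + kernel_pairing E f q"
  "kernel_pairing E f (p @ q) = kernel_pairing E f p + kernel_pairing E f q"
  by (simp_all add: kernel_pairing_def)

lemma kernel_gram_simps [simp]:
  "kernel_gram K E [] q = 0"
  "kernel_gram K E p [] = 0"
  "kernel_gram K E (p @ p') q = kernel_gram K E p q + kernel_gram K E p' q"
  "kernel_gram K E p (q @ q') = kernel_gram K E p q + kernel_gram K E p q'"
  by (auto simp: kernel_gram_def case_prod_unfold sum_list_addf)

lemma kernel_gram_single [simp]: "kernel_gram K E [(w, \<eta>)] [(v, \<zeta>)] = K v w * vinner E \<eta> \<zeta>"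
  by (simp add: kernel_gram_def)

locale positive_kernel = E: hilbert_space E for E :: "'e hspace" +
  fixes X :: "'x set" and K :: "'x \<Rightarrow> 'x \<Rightarrow> complex"
  assumes hermitian: "z \<in> X \<Longrightarrow> w \<in> X \<Longrightarrow> K w z = cnj (K z w)"
    and gram_nonneg: "p \<in> nodes X E \<Longrightarrow> 0 \<le> Re (kernel_gram K E p p)"
begin

abbreviation "pairing \<equiv> kernel_pairing E"
abbreviation "gram \<equiv> kernel_gram K E"
abbreviation "gnorm \<equiv> kernel_norm K E"
abbreviation "N \<equiv> nodes X E"
abbreviation "scl \<equiv> scale_nodes E"
abbreviation "ksum \<equiv> kernel_sum X K E"
abbreviation "MA \<equiv> moore_aronszajn X K E"

lemma scl_nodes [simp]: "p \<in> N \<Longrightarrow> scl c p \<in> N"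
  by (auto simp: scale_nodes_def lists_eq_set)

lemma gram_commute:
  assumes "p \<in> N" "q \<in> N"
  shows "gram q p = cnj (gram p q)"
proof -
  have *: "gram q p = cnj (\<Sum>(w, \<eta>)\<leftarrow>q. \<Sum>(v, \<zeta>)\<leftarrow>p. K w v * vinner E \<zeta> \<eta>)" if "q \<in> N" "p \<in> N" for p q
    using that(1)
  proof induction
    case Nil then show ?case by (simp add: kernel_gram_def)
  next
    case (Cons a q)
    have "(\<Sum>(v, \<zeta>)\<leftarrow>p. K v (fst a) * vinner E (snd a) \<zeta>) =
        cnj (\<Sum>(v, \<zeta>)\<leftarrow>p. K (fst a) v * vinner E \<zeta> (snd a))"
      using that(2)
    proof induction
      case (Cons b p')
      then show ?case using \<open>a \<in> X \<times> vecs E\<close> E.inner_commute[of "snd b" "snd a"]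
          hermitian[of "fst a" "fst b"]
        by (auto simp: case_prod_unfold)
    qed simp
    moreover have "gram q p = cnj (\<Sum>(w, \<eta>)\<leftarrow>q. \<Sum>(v, \<zeta>)\<leftarrow>p. K w v * vinner E \<zeta> \<eta>)"
      using Cons by auto
    ultimately show ?case by (simp add: kernel_gram_def case_prod_unfold)
  qed
  have "(\<Sum>(w, \<eta>)\<leftarrow>q. \<Sum>(v, \<zeta>)\<leftarrow>p. K w v * vinner E \<zeta> \<eta>) = gram p q"
  proof (induction q)
    case (Cons a q)
    have "gram p (a # q) = gram p [a] + gram p q"
      using kernel_gram_simps(4)[of K E p "[a]" q] by simp
    with Cons show ?case by (simp add: kernel_gram_def case_prod_unfold)
  qed simp
  with *[OF assms(2,1)] show ?thesis by simp
qed

lemma gram_scl [simp]: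
  assumes "p \<in> N" "q \<in> N"
  shows "gram (scl c p) q = c * gram p q" and "gram p (scl c q) = cnj c * gram p q"
proof -
  have *: "gram (scl c p) q = c * gram p q" if "p \<in> N" "q \<in> N" for p q c
    using that(1)
  proof (induction p)
    case (Cons a p)
    have "(\<Sum>(v, \<zeta>)\<leftarrow>q. K v (fst a) * vinner E (vscale E c (snd a)) \<zeta>) =
      c * (\<Sum>(v, \<zeta>)\<leftarrow>q. K v (fst a) * vinner E (snd a) \<zeta>)"
      using that(2) by induction (use Cons.hyps in \<open>auto simp: algebra_simps\<close>)
    with Cons show ?case
      by (auto simp: scale_nodes_def kernel_gram_def case_prod_unfold algebra_simps)
  qed (simp add: scale_nodes_def)
  show "gram (scl c p) q = c * gram p q" by (rule *[OF assms])
  show "gram p (scl c q) = cnj c * gram p q"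
    using *[OF assms(2,1)] gram_commute[OF assms] gram_commute[of "scl c q" p] assms by simp
qed

lemma pairing_scl [simp]:
  assumes "q \<in> N" and "f \<in> functions_on X E"
  shows "pairing f (scl c q) = cnj c * pairing f q"
  using assms(1)
  by induction (use assms(2) in \<open>auto simp: scale_nodes_def functions_on_def algebra_simps\<close>)

lemma pairing_add [simp]:
  assumes "q \<in> N" and "f \<in> functions_on X E" "g \<in> functions_on X E"
  shows "pairing (\<lambda>z. vadd E (f z) (g z)) q = pairing f q + pairing g q"
  using assms(1)
  by induction (use assms(2,3) in \<open>auto simp: functions_on_def algebra_simps\<close>)

lemma pairing_scale [simp]:
  assumes "q \<in> N" and "f \<in> functions_on X E"
  shows "pairing (\<lambda>z. vscale E c (f z)) q = c * pairing f q"
  using assms(1)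
  by induction (use assms(2) in \<open>auto simp: functions_on_def algebra_simps\<close>)

lemma gnorm_nonneg [simp]: "p \<in> N \<Longrightarrow> 0 \<le> gnorm p"
  by (simp add: kernel_norm_def gram_nonneg)

lemma gnorm_sq: "p \<in> N \<Longrightarrow> (gnorm p)\<^sup>2 = Re (gram p p)"
  by (simp add: kernel_norm_def gram_nonneg)

lemma gram_self: "p \<in> N \<Longrightarrow> gram p p = of_real ((gnorm p)\<^sup>2)"
  using gram_commute[of p p] by (simp add: gnorm_sq complex_eq_iff)

lemma gnorm_append_sq:
  assumes "p \<in> N" "q \<in> N"
  shows "(gnorm (p @ scl t q))\<^sup>2 = (gnorm p)\<^sup>2 + 2 * Re (cnj t * gram p q) + (cmod t)\<^sup>2 * (gnorm q)\<^sup>2"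
proof -
  have "gram (p @ scl t q) (p @ scl t q) =
      gram p p + (cnj t * gram p q + cnj (cnj t * gram p q)) + (t * cnj t) * gram q q"
    using assms gram_commute[OF assms] by (simp add: algebra_simps)
  also have "\<dots> = of_real ((gnorm p)\<^sup>2 + 2 * Re (cnj t * gram p q) + (cmod t)\<^sup>2 * (gnorm q)\<^sup>2)"
    unfolding complex_add_cnj complex_norm_square[symmetric] using assms by (simp add: gram_self)
  finally show ?thesis using assms by (simp only: gnorm_sq append_in_lists_conv scl_nodes Re_complex_of_real)
qed

lemma gram_cauchy_schwarz:
  assumes p: "p \<in> N" and q: "q \<in> N"
  shows "cmod (gram p q) \<le> gnorm p * gnorm q"
proof -
  have "(cmod (gram p q))\<^sup>2 \<le> (gnorm p)\<^sup>2 * (gnorm q)\<^sup>2"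
  proof (rule quadratic_bound)
    fix t :: complex
    have "0 \<le> (gnorm (p @ scl (- cnj t) q))\<^sup>2" by simp
    then show "2 * Re (t * gram p q) - (cmod t)\<^sup>2 * (gnorm q)\<^sup>2 \<le> (gnorm p)\<^sup>2"
      unfolding gnorm_append_sq[OF p q] by simp
  qed simp
  then show ?thesis
    by (metis p q gnorm_nonneg mult_nonneg_nonneg power_mult_distrib power2_le_imp_le)
qed

lemma ksum_at:
  assumes "p \<in> N" "z \<in> X" and "\<zeta> \<in> vecs E"
  shows "ksum p z \<in> vecs E \<and> vinner E (ksum p z) \<zeta> = gram p [(z, \<zeta>)]"
  using assms(1)
  by induction (use assms(2,3) in \<open>auto simp: kernel_sum_def kernel_gram_def\<close>)

lemma ksum_functions: "p \<in> N \<Longrightarrow> ksum p \<in> functions_on X E"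
  using ksum_at[of p _ "vzero E"] by (auto simp: functions_on_def kernel_sum_def)

lemma pairing_ksum [simp]:
  assumes "p \<in> N" "q \<in> N"
  shows "pairing (ksum p) q = gram p q"
  using assms(2)
proof induction
  case (Cons a q)
  then show ?case
    using ksum_at[OF assms(1), of "fst a" "snd a"] kernel_gram_simps(4)[of K E p "[a]" q]
    by (cases a) auto
qed simp

lemma ksum_carrier [simp]: "p \<in> N \<Longrightarrow> ksum p \<in> kernel_carrier X K E"
  using gram_cauchy_schwarz[of p] ksum_functions by (auto simp: kernel_carrier_def)

lemma carrierD: "f \<in> kernel_carrier X K E \<Longrightarrow> f \<in> functions_on X E"
  by (simp add: kernel_carrier_def)

lemma carrier_bound:
  assumes "f \<in> kernel_carrier X K E"
  obtains C where "0 \<le> C" and "\<And>q. q \<in> N \<Longrightarrow> cmod (pairing f q) \<le> C * gnorm q"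
proof -
  obtain C where C: "\<And>q. q \<in> N \<Longrightarrow> cmod (pairing f q) \<le> C * gnorm q"
    using assms by (auto simp: kernel_carrier_def)
  have "cmod (pairing f q) \<le> \<bar>C\<bar> * gnorm q" if "q \<in> N" for q
    using C[OF that] mult_right_mono[of C "\<bar>C\<bar>" "gnorm q"] gnorm_nonneg[OF that] by linarith
  then show ?thesis using that[of "\<bar>C\<bar>"] by simp
qed

text \<open>Near-maximisers of \<open>2 Re \<langle>f, p\<rangle> - \<parallel>p\<parallel>\<^sup>2\<close> approximate \<open>f\<close>: replacing \<open>p\<close> by \<open>p + t q\<close>
  cannot gain more than the defect of \<open>p\<close>.\<close>

lemma approximates_exists:
  assumes f: "f \<in> kernel_carrier X K E"
  shows "\<exists>p. approximates X K E p f"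
proof -
  obtain C where C: "\<And>q. q \<in> N \<Longrightarrow> cmod (pairing f q) \<le> C * gnorm q"
    using carrier_bound[OF f] by blast
  \<comment> \<open>The value of \<open>\<phi>\<close> at \<open>p\<close> is \<open>\<parallel>f\<parallel>\<^sup>2 - \<parallel>f - p\<parallel>\<^sup>2\<close> in the space to be constructed.\<close>
  define \<phi> where "\<phi> p = 2 * Re (pairing f p) - (gnorm p)\<^sup>2" for p
  have "\<phi> p \<le> C\<^sup>2" if p: "p \<in> N" for p
  proof -
    have "\<phi> p \<le> 2 * C * gnorm p - (gnorm p)\<^sup>2"
      using C[OF p] complex_Re_le_cmod[of "pairing f p"] by (simp add: \<phi>_def)
    also have "\<dots> \<le> C\<^sup>2"
      using zero_le_power2[of "C - gnorm p"] unfolding power2_diff by linarith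
    finally show ?thesis .
  qed
  then have bdd: "bdd_above (\<phi> ` N)" by (intro bdd_aboveI2[where M = "C\<^sup>2"])
  define s where "s = Sup (\<phi> ` N)"
  have \<phi>_le_s: "\<phi> p \<le> s" if "p \<in> N" for p
    unfolding s_def using bdd that by (intro cSUP_upper)
  have "[] \<in> N" by simp
  then have "\<exists>p\<in>N. s - 1 / real (Suc k) < \<phi> p" for k
    using less_cSUP_iff[of N \<phi> "s - 1 / real (Suc k)"] bdd unfolding s_def[symmetric] by auto
  then obtain p where p: "\<And>k. p k \<in> N" and p_s: "\<And>k. s - 1 / real (Suc k) < \<phi> (p k)"
    by metis
  have "cmod (pairing f q - gram (p k) q) \<le> sqrt (1 / real (Suc k)) * gnorm q" if q: "q \<in> N" for k q
  proof -
    have "(cmod (pairing f q - gram (p k) q))\<^sup>2 \<le> (s - \<phi> (p k)) * (gnorm q)\<^sup>2"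
    proof (rule quadratic_bound)
      fix t :: complex
      \<comment> \<open>Appending the list \<open>t\<^sup>* q\<close> to \<open>p k\<close> adds the corresponding kernel sums.\<close>
      have "\<phi> (p k @ scl (cnj t) q) \<le> s"
        by (rule \<phi>_le_s) (use p q in simp)
      then show "2 * Re (t * (pairing f q - gram (p k) q)) - (cmod t)\<^sup>2 * (gnorm q)\<^sup>2 \<le> s - \<phi> (p k)"
        unfolding \<phi>_def gnorm_append_sq[OF p q]
        using q carrierD[OF f] by (simp add: algebra_simps)
    qed simp
    also have "\<dots> \<le> (1 / real (Suc k)) * (gnorm q)\<^sup>2"
      by (intro mult_right_mono) (use p_s[of k] in linarith, simp)
    finally have "cmod (pairing f q - gram (p k) q) \<le> sqrt ((1 / real (Suc k)) * (gnorm q)\<^sup>2)"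
      by (rule real_le_rsqrt)
    then show ?thesis using q by (simp add: real_sqrt_mult real_sqrt_divide)
  qed
  moreover have "(\<lambda>k. sqrt (1 / real (Suc k))) \<longlonglongrightarrow> 0"
    using tendsto_real_sqrt[OF LIMSEQ_inverse_real_of_nat] by (simp add: inverse_eq_divide)
  ultimately show ?thesis using p unfolding approximates_def by blast
qed

text \<open>The difference of two approximations is tested against itself, so that its norm cancels
  once.\<close>

lemma approximates_gap:
  assumes "p \<in> N" "r \<in> N" and f: "f \<in> functions_on X E"
    and \<epsilon>: "\<And>q. q \<in> N \<Longrightarrow> cmod (pairing f q - gram p q) \<le> \<epsilon> * gnorm q"
    and \<delta>: "\<And>q. q \<in> N \<Longrightarrow> cmod (pairing f q - gram r q) \<le> \<delta> * gnorm q"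
  shows "gnorm (p @ scl (-1) r) \<le> \<bar>\<epsilon>\<bar> + \<bar>\<delta>\<bar>"
proof -
  let ?d = "p @ scl (-1) r"
  have d: "?d \<in> N" using assms by simp
  have "(gnorm ?d)\<^sup>2 = Re (gram p ?d - gram r ?d)"
    using gnorm_sq[OF d] kernel_gram_simps(3)[of K E p "scl (-1) r" ?d] gram_scl(1)[OF assms(2) d, of "-1"]
    by (simp del: kernel_gram_simps)
  also have "\<dots> \<le> cmod ((pairing f ?d - gram r ?d) - (pairing f ?d - gram p ?d))"
    using complex_Re_le_cmod[of "gram p ?d - gram r ?d"]
    by (simp del: kernel_gram_simps add: norm_minus_commute)
  also have "\<dots> \<le> (\<delta> + \<epsilon>) * gnorm ?d"
    using norm_triangle_ineq4[of "pairing f ?d - gram r ?d" "pairing f ?d - gram p ?d"] \<epsilon>[OF d] \<delta>[OF d]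
    unfolding distrib_right by linarith
  also have "\<dots> \<le> (\<bar>\<epsilon>\<bar> + \<bar>\<delta>\<bar>) * gnorm ?d"
    using gnorm_nonneg[OF d] by (intro mult_right_mono) auto
  finally have le: "gnorm ?d * gnorm ?d \<le> (\<bar>\<epsilon>\<bar> + \<bar>\<delta>\<bar>) * gnorm ?d"
    by (simp only: power2_eq_square)
  show ?thesis
  proof (cases "gnorm ?d = 0")
    case False
    then have "0 < gnorm ?d" using gnorm_nonneg[OF d] by linarith
    with le show ?thesis by (simp only: mult_le_cancel_right_pos)
  qed simp
qed

lemma approximates_pairing_diff:
  assumes f: "f \<in> kernel_carrier X K E" and p: "approximates X K E p g" and r: "approximates X K E r g"
    and g: "g \<in> functions_on X E"
  shows "\<exists>\<epsilon>. \<epsilon> \<longlonglongrightarrow> (0::real) \<and> (\<forall>i j. cmod (pairing f (p i) - pairing f (r j)) \<le> \<epsilon> i + \<epsilon> j)"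
proof -
  obtain \<alpha> where \<alpha>: "\<alpha> \<longlonglongrightarrow> 0" "\<And>k q. q \<in> N \<Longrightarrow> cmod (pairing g q - gram (p k) q) \<le> \<alpha> k * gnorm q"
    and pN: "\<And>k. p k \<in> N" using p by (auto simp: approximates_def)
  obtain \<beta> where \<beta>: "\<beta> \<longlonglongrightarrow> 0" "\<And>k q. q \<in> N \<Longrightarrow> cmod (pairing g q - gram (r k) q) \<le> \<beta> k * gnorm q"
    and rN: "\<And>k. r k \<in> N" using r by (auto simp: approximates_def)
  obtain C where C: "0 \<le> C" "\<And>q. q \<in> N \<Longrightarrow> cmod (pairing f q) \<le> C * gnorm q"
    using carrier_bound[OF f] by blast
  define \<epsilon> where "\<epsilon> k = C * (\<bar>\<alpha> k\<bar> + \<bar>\<beta> k\<bar>)" for k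
  have "cmod (pairing f (p i) - pairing f (r j)) \<le> \<epsilon> i + \<epsilon> j" for i j
  proof -
    have "cmod (pairing f (p i) - pairing f (r j)) = cmod (pairing f (p i @ scl (-1) (r j)))"
      using rN carrierD[OF f] by simp
    also have "\<dots> \<le> C * gnorm (p i @ scl (-1) (r j))"
      by (rule C) (use pN rN in simp)
    also have "\<dots> \<le> C * (\<bar>\<alpha> i\<bar> + \<bar>\<beta> j\<bar>)"
      by (intro mult_left_mono approximates_gap[OF pN rN g] \<alpha> \<beta> C)
    also have "\<dots> \<le> C * ((\<bar>\<alpha> i\<bar> + \<bar>\<beta> i\<bar>) + (\<bar>\<alpha> j\<bar> + \<bar>\<beta> j\<bar>))"
      by (intro mult_left_mono C) auto
    finally show ?thesis by (simp add: \<epsilon>_def algebra_simps)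
  qed
  moreover have "\<epsilon> \<longlonglongrightarrow> C * (\<bar>0\<bar> + \<bar>0\<bar>)"
    unfolding \<epsilon>_def by (intro tendsto_intros \<alpha> \<beta>)
  ultimately show ?thesis by auto
qed

text \<open>The inner product does not depend on the approximating sequence chosen in its definition.\<close>

lemma pairing_lim:
  assumes f: "f \<in> kernel_carrier X K E" and g: "g \<in> kernel_carrier X K E" and p: "approximates X K E p g"
  shows "(\<lambda>k. pairing f (p k)) \<longlonglongrightarrow> vinner MA f g"
proof -
  let ?r = "SOME r. approximates X K E r g"
  have r: "approximates X K E ?r g" using someI_ex[OF approximates_exists[OF g]] .
  obtain \<epsilon> where \<epsilon>: "\<epsilon> \<longlonglongrightarrow> (0::real)" "\<And>i j. cmod (pairing f (?r i) - pairing f (?r j)) \<le> \<epsilon> i + \<epsilon> j"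
    using approximates_pairing_diff[OF f r r carrierD[OF g]] by blast
  have "Cauchy (\<lambda>k. pairing f (?r k))"
  proof (rule metric_CauchyI)
    fix e :: real assume "0 < e"
    then have "\<forall>\<^sub>F k in sequentially. \<epsilon> k < e / 2"
      using order_tendstoD(2)[OF \<epsilon>(1), of "e / 2"] by simp
    then obtain M where M: "\<And>k. k \<ge> M \<Longrightarrow> \<epsilon> k < e / 2"
      by (auto simp: eventually_sequentially)
    show "\<exists>M. \<forall>i\<ge>M. \<forall>j\<ge>M. dist (pairing f (?r i)) (pairing f (?r j)) < e"
      using \<epsilon>(2) M by (intro exI[of _ M]) (smt (verit) dist_norm field_sum_of_halves)
  qed
  then have "convergent (\<lambda>k. pairing f (?r k))" by (rule Cauchy_convergent)
  then have lim: "(\<lambda>k. pairing f (?r k)) \<longlonglongrightarrow> vinner MA f g"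
    using f g by (simp add: moore_aronszajn_def convergent_LIMSEQ_iff)
  obtain \<delta> where \<delta>: "\<delta> \<longlonglongrightarrow> (0::real)" "\<And>i j. cmod (pairing f (p i) - pairing f (?r j)) \<le> \<delta> i + \<delta> j"
    using approximates_pairing_diff[OF f p r carrierD[OF g]] by blast
  have "(\<lambda>k. pairing f (p k) - pairing f (?r k)) \<longlonglongrightarrow> 0"
  proof (rule Lim_null_comparison)
    show "\<forall>\<^sub>F k in sequentially. cmod (pairing f (p k) - pairing f (?r k)) \<le> \<delta> k + \<delta> k"
      by (intro always_eventually allI \<delta>(2))
    show "(\<lambda>k. \<delta> k + \<delta> k) \<longlonglongrightarrow> 0" using tendsto_add[OF \<delta>(1) \<delta>(1)] by simp
  qed
  from tendsto_add[OF this lim] show ?thesis by simp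
qed

text \<open>Each member of the sequence is at a bounded distance from the first one.\<close>

lemma approximates_bounded:
  assumes "approximates X K E p g" and g: "g \<in> functions_on X E"
  obtains B where "\<And>k. gnorm (p k) \<le> B"
proof -
  obtain \<epsilon> where \<epsilon>: "\<epsilon> \<longlonglongrightarrow> 0" "\<And>k q. q \<in> N \<Longrightarrow> cmod (pairing g q - gram (p k) q) \<le> \<epsilon> k * gnorm q"
    and pN: "\<And>k. p k \<in> N" using assms by (auto simp: approximates_def)
  have "Bseq \<epsilon>" using \<epsilon>(1) by (meson convergentI convergent_imp_Bseq)
  then obtain M where M: "\<And>k. \<bar>\<epsilon> k\<bar> \<le> M" by (auto simp: Bseq_def)
  have "gnorm (p k) \<le> 2 * M + gnorm (p 0)" for k
  proof -
    let ?d = "p k @ scl (-1) (p 0)"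
    have d: "?d \<in> N" using pN by simp
    have "(gnorm (p k))\<^sup>2 = Re (gram (p k) ?d + gram (p k) (p 0))"
      using pN by (simp add: gnorm_sq)
    also have "\<dots> \<le> cmod (gram (p k) ?d) + cmod (gram (p k) (p 0))"
      using complex_Re_le_cmod norm_triangle_ineq order_trans by blast
    also have "\<dots> \<le> gnorm (p k) * gnorm ?d + gnorm (p k) * gnorm (p 0)"
      by (intro add_mono gram_cauchy_schwarz pN d)
    also have "\<dots> \<le> gnorm (p k) * (2 * M + gnorm (p 0))"
    proof -
      have "gnorm ?d \<le> \<bar>\<epsilon> k\<bar> + \<bar>\<epsilon> 0\<bar>" by (rule approximates_gap[OF pN pN g \<epsilon>(2) \<epsilon>(2)])
      also have "\<dots> \<le> 2 * M" using M[of k] M[of 0] by simp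
      finally show ?thesis
        unfolding distrib_left[symmetric] by (intro mult_left_mono add_right_mono) (use pN in auto)
    qed
    finally have le: "gnorm (p k) * gnorm (p k) \<le> gnorm (p k) * (2 * M + gnorm (p 0))"
      by (simp only: power2_eq_square)
    show ?thesis
    proof (cases "gnorm (p k) = 0")
      case True
      then show ?thesis using M[of 0] gnorm_nonneg[OF pN[of 0]] by simp
    next
      case False
      then have "0 < gnorm (p k)" using gnorm_nonneg[OF pN] by (simp add: less_le)
      with le show ?thesis by (simp only: mult_le_cancel_left_pos)
    qed
  qed
  then show ?thesis using that by blast
qed

lemma gram_lim:
  assumes f: "f \<in> kernel_carrier X K E" and g: "g \<in> kernel_carrier X K E"
    and p: "approximates X K E p f" and r: "approximates X K E r g"
  shows "(\<lambda>k. gram (p k) (r k)) \<longlonglongrightarrow> vinner MA f g"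
proof -
  obtain \<epsilon> where \<epsilon>: "\<epsilon> \<longlonglongrightarrow> 0" "\<And>k q. q \<in> N \<Longrightarrow> cmod (pairing f q - gram (p k) q) \<le> \<epsilon> k * gnorm q"
    using p by (auto simp: approximates_def)
  obtain B where B: "\<And>k. gnorm (r k) \<le> B" using approximates_bounded[OF r carrierD[OF g]] by blast
  have rN: "\<And>k. r k \<in> N" using r by (auto simp: approximates_def)
  have "(\<lambda>k. pairing f (r k) - gram (p k) (r k)) \<longlonglongrightarrow> 0"
  proof (rule Lim_null_comparison)
    show "\<forall>\<^sub>F k in sequentially. cmod (pairing f (r k) - gram (p k) (r k)) \<le> \<bar>\<epsilon> k\<bar> * B"
    proof (intro always_eventually allI)
      fix k
      have "\<epsilon> k * gnorm (r k) \<le> \<bar>\<epsilon> k\<bar> * B"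
        by (intro mult_mono) (use B[of k] rN in auto)
      then show "cmod (pairing f (r k) - gram (p k) (r k)) \<le> \<bar>\<epsilon> k\<bar> * B"
        using \<epsilon>(2)[OF rN, of k k] by linarith
    qed
    show "(\<lambda>k. \<bar>\<epsilon> k\<bar> * B) \<longlonglongrightarrow> 0"
      using \<epsilon>(1) by (intro tendsto_mult_left_zero tendsto_rabs_zero)
  qed
  from tendsto_diff[OF pairing_lim[OF f g r] this] show ?thesis by simp
qed

lemma approximates_const: "p \<in> N \<Longrightarrow> approximates X K E (\<lambda>_. p) (ksum p)"
  unfolding approximates_def by (auto intro!: exI[of _ "\<lambda>_. 0"])

lemma MA_simps [simp]:
  "vecs MA = kernel_carrier X K E"
  "vadd MA = (\<lambda>f g z. vadd E (f z) (g z))"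
  "vzero MA = (\<lambda>z. vzero E)"
  "vscale MA = (\<lambda>c f z. vscale E c (f z))"
  by (simp_all add: moore_aronszajn_def)

lemma functions_on_closed:
  assumes "f \<in> functions_on X E" "g \<in> functions_on X E"
  shows "(\<lambda>z. vadd E (f z) (g z)) \<in> functions_on X E" and "(\<lambda>z. vscale E c (f z)) \<in> functions_on X E"
    and "(\<lambda>z. vzero E) \<in> functions_on X E"
  using assms E.scale_scale[of "vzero E" c 0] E.scale_zero[of "vzero E"]
  by (auto simp: functions_on_def E.add_zero)

lemma carrier_add:
  assumes f: "f \<in> kernel_carrier X K E" and g: "g \<in> kernel_carrier X K E"
  shows "(\<lambda>z. vadd E (f z) (g z)) \<in> kernel_carrier X K E"
proof -
  obtain B where B: "\<And>q. q \<in> N \<Longrightarrow> cmod (pairing f q) \<le> B * gnorm q" using carrier_bound[OF f] by blast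
  obtain C where C: "\<And>q. q \<in> N \<Longrightarrow> cmod (pairing g q) \<le> C * gnorm q" using carrier_bound[OF g] by blast
  have "cmod (pairing (\<lambda>z. vadd E (f z) (g z)) q) \<le> (B + C) * gnorm q" if q: "q \<in> N" for q
    using norm_triangle_mono[OF B[OF q] C[OF q]] q carrierD[OF f] carrierD[OF g]
    by (simp add: distrib_right)
  then show ?thesis
    using functions_on_closed carrierD[OF f] carrierD[OF g] by (auto simp: kernel_carrier_def)
qed

lemma carrier_scale:
  assumes f: "f \<in> kernel_carrier X K E"
  shows "(\<lambda>z. vscale E c (f z)) \<in> kernel_carrier X K E"
proof -
  obtain B where B: "\<And>q. q \<in> N \<Longrightarrow> cmod (pairing f q) \<le> B * gnorm q" using carrier_bound[OF f] by blast
  have "cmod (pairing (\<lambda>z. vscale E c (f z)) q) \<le> (cmod c * B) * gnorm q" if q: "q \<in> N" for q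
    using mult_left_mono[OF B[OF q], of "cmod c"] q carrierD[OF f]
    by (simp add: norm_mult mult.assoc)
  then show ?thesis
    using functions_on_closed carrierD[OF f] by (auto simp: kernel_carrier_def)
qed

lemma pairing_zero [simp]: "q \<in> N \<Longrightarrow> pairing (\<lambda>z. vzero E) q = 0"
  by (induction rule: lists.induct) auto

lemma carrier_zero: "(\<lambda>z. vzero E) \<in> kernel_carrier X K E"
  by (auto simp: kernel_carrier_def functions_on_def intro!: exI[of _ 0])

text \<open>Since the inner product is the limit of \<open>pairing f (p k)\<close>, it is linear in \<open>f\<close>; since it
  is also the limit of Gram matrices, with both arguments approximated at once, it is symmetric
  and nonnegative.\<close>

lemma MA_inner_product_space: "inner_product_space MA"
proof
  fix f g h :: "'x \<Rightarrow> 'e" and c :: complex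
  show "f \<in> vecs MA \<Longrightarrow> g \<in> vecs MA \<Longrightarrow> vadd MA f g \<in> vecs MA" by (simp add: carrier_add)
  show "vzero MA \<in> vecs MA" by (simp add: carrier_zero)
  show "f \<in> vecs MA \<Longrightarrow> vscale MA c f \<in> vecs MA" by (simp add: carrier_scale)
  note F = carrierD functions_on_def
  have val: "f z \<in> vecs E" if "f \<in> vecs MA" for f z
    using that carrierD[of f] by (cases "z \<in> X") (auto simp: functions_on_def)
  show "f \<in> vecs MA \<Longrightarrow> g \<in> vecs MA \<Longrightarrow> h \<in> vecs MA \<Longrightarrow> vadd MA (vadd MA f g) h = vadd MA f (vadd MA g h)"
    using val by (simp add: E.add_assoc)
  show "f \<in> vecs MA \<Longrightarrow> g \<in> vecs MA \<Longrightarrow> vadd MA f g = vadd MA g f"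
    using val by (auto intro: E.add_commute)
  show "f \<in> vecs MA \<Longrightarrow> vadd MA (vzero MA) f = f" using val by (simp add: E.add_zero)
  show "f \<in> vecs MA \<Longrightarrow> g \<in> vecs MA \<Longrightarrow> vscale MA c (vadd MA f g) = vadd MA (vscale MA c f) (vscale MA c g)"
    using val by (simp add: E.scale_add_right)
  show "f \<in> vecs MA \<Longrightarrow> vscale MA (c + d) f = vadd MA (vscale MA c f) (vscale MA d f)" for d
    using val by (simp add: E.scale_add_left)
  show "f \<in> vecs MA \<Longrightarrow> vscale MA c (vscale MA d f) = vscale MA (c * d) f" for d
    using val by (simp add: E.scale_scale)
  show "f \<in> vecs MA \<Longrightarrow> vscale MA 1 f = f" using val by (simp add: E.scale_one)
  show "f \<in> vecs MA \<Longrightarrow> vscale MA 0 f = vzero MA" using val by (simp add: E.scale_zero)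
next
  fix f g h :: "'x \<Rightarrow> 'e" and c :: complex
  assume fM: "f \<in> vecs MA" and gM: "g \<in> vecs MA"
  then have f: "f \<in> kernel_carrier X K E" and g: "g \<in> kernel_carrier X K E" by simp_all
  obtain p where p: "approximates X K E p f" using approximates_exists[OF f] by blast
  obtain r where r: "approximates X K E r g" using approximates_exists[OF g] by blast
  have rN: "\<And>k. r k \<in> N" and pN: "\<And>k. p k \<in> N" using p r by (auto simp: approximates_def)
  show "vinner MA (vadd MA f g) h = vinner MA f h + vinner MA g h" if "h \<in> vecs MA"
  proof -
    have h: "h \<in> kernel_carrier X K E" using that by simp
    obtain s where s: "approximates X K E s h" using approximates_exists[OF h] by blast
    then have sN: "\<And>k. s k \<in> N" by (auto simp: approximates_def)
    have "(\<lambda>k. pairing (vadd MA f g) (s k)) \<longlonglongrightarrow> vinner MA (vadd MA f g) h"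
      by (rule pairing_lim[OF _ h s]) (simp add: carrier_add f g)
    moreover have "(\<lambda>k. pairing (vadd MA f g) (s k)) \<longlonglongrightarrow> vinner MA f h + vinner MA g h"
      using tendsto_add[OF pairing_lim[OF f h s] pairing_lim[OF g h s]] sN carrierD[OF f] carrierD[OF g] by simp
    ultimately show ?thesis by (rule LIMSEQ_unique)
  qed
  show "vinner MA (vscale MA c f) g = c * vinner MA f g"
  proof -
    have "(\<lambda>k. pairing (vscale MA c f) (r k)) \<longlonglongrightarrow> vinner MA (vscale MA c f) g"
      by (rule pairing_lim[OF _ g r]) (simp add: carrier_scale f)
    moreover have "(\<lambda>k. pairing (vscale MA c f) (r k)) \<longlonglongrightarrow> c * vinner MA f g"
      using tendsto_mult_left[OF pairing_lim[OF f g r]] rN carrierD[OF f] by simp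
    ultimately show ?thesis by (rule LIMSEQ_unique)
  qed
  show "vinner MA g f = cnj (vinner MA f g)"
  proof (rule LIMSEQ_unique[OF gram_lim[OF g f r p]])
    have "(\<lambda>k. cnj (gram (p k) (r k))) \<longlonglongrightarrow> cnj (vinner MA f g)"
      by (intro tendsto_intros gram_lim f g p r)
    then show "(\<lambda>k. gram (r k) (p k)) \<longlonglongrightarrow> cnj (vinner MA f g)"
      by (simp only: gram_commute[OF pN rN])
  qed
  have lim: "(\<lambda>k. gram (p k) (p k)) \<longlonglongrightarrow> vinner MA f f" by (rule gram_lim[OF f f p p])
  show "0 \<le> Re (vinner MA f f)"
    using tendsto_Re[OF lim] by (rule LIMSEQ_le_const) (use pN gram_nonneg in auto)
  show "f = vzero MA" if "vinner MA f f = 0"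
  proof -
    have zero: "pairing f q = 0" if q: "q \<in> N" for q
    proof -
      obtain \<epsilon> where \<epsilon>: "\<epsilon> \<longlonglongrightarrow> 0" "\<And>k q. q \<in> N \<Longrightarrow> cmod (pairing f q - gram (p k) q) \<le> \<epsilon> k * gnorm q"
        using p by (auto simp: approximates_def)
      have "(\<lambda>k. gnorm (p k)) \<longlonglongrightarrow> 0"
        using tendsto_real_sqrt[OF tendsto_Re[OF lim]] \<open>vinner MA f f = 0\<close> by (simp add: kernel_norm_def)
      then have "(\<lambda>k. \<epsilon> k * gnorm q + gnorm (p k) * gnorm q) \<longlonglongrightarrow> 0 * gnorm q + 0 * gnorm q"
        by (intro tendsto_intros \<epsilon>)
      moreover have "cmod (pairing f q) \<le> \<epsilon> k * gnorm q + gnorm (p k) * gnorm q" for k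
        using norm_triangle_sub[of "pairing f q" "gram (p k) q"] \<epsilon>(2)[OF q, of k] gram_cauchy_schwarz[OF pN q, of k]
        by linarith
      ultimately have "cmod (pairing f q) \<le> 0 * gnorm q + 0 * gnorm q"
        by (intro LIMSEQ_le_const) auto
      then show ?thesis by simp
    qed
    have "f z = vzero E" for z
    proof (cases "z \<in> X")
      case True
      then have fz: "f z \<in> vecs E" using carrierD[OF f] by (auto simp: functions_on_def)
      then have "vinner E (f z) (f z) = 0" using zero[of "[(z, f z)]"] True by simp
      with fz show ?thesis by (simp add: E.inner_eq_zero)
    qed (use carrierD[OF f] in \<open>auto simp: functions_on_def\<close>)
    then show ?thesis by auto
  qed
qed

interpretation M: inner_product_space MA by (rule MA_inner_product_space)

lemma MA_inner_ksum:
  assumes f: "f \<in> kernel_carrier X K E" and q: "q \<in> N"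
  shows "vinner MA f (ksum q) = pairing f q"
  using pairing_lim[OF f ksum_carrier[OF q] approximates_const[OF q]] by (simp add: LIMSEQ_const_iff)

lemma MA_norm_ksum: "q \<in> N \<Longrightarrow> vnorm MA (ksum q) = gnorm q"
  by (simp add: vnorm_def MA_inner_ksum kernel_norm_def)

text \<open>Evaluating the bound along an approximating sequence gives \<open>\<parallel>f\<parallel>\<^sup>2 \<le> C \<parallel>f\<parallel>\<close>. Weighted
  compositions and multiplication by \<open>\<theta>\<close> are shown to be well defined and bounded by this test.\<close>

lemma MA_criterion:
  assumes f: "f \<in> functions_on X E" and C: "0 \<le> C"
    and bound: "\<And>q. q \<in> N \<Longrightarrow> cmod (pairing f q) \<le> C * gnorm q"
  shows "f \<in> kernel_carrier X K E" and "vnorm MA f \<le> C"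
proof -
  show fM: "f \<in> kernel_carrier X K E" using f bound by (auto simp: kernel_carrier_def)
  obtain p where p: "approximates X K E p f" using approximates_exists[OF fM] by blast
  then have pN: "\<And>k. p k \<in> N" by (auto simp: approximates_def)
  note lim = gram_lim[OF fM fM p p]
  have "(\<lambda>k. gnorm (p k)) \<longlonglongrightarrow> vnorm MA f"
    using tendsto_real_sqrt[OF tendsto_Re[OF lim]] by (simp add: kernel_norm_def vnorm_def)
  then have lim_C: "(\<lambda>k. C * gnorm (p k)) \<longlonglongrightarrow> C * vnorm MA f" by (intro tendsto_intros)
  have "(\<lambda>k. cmod (pairing f (p k))) \<longlonglongrightarrow> cmod (vinner MA f f)"
    by (intro tendsto_intros pairing_lim[OF fM fM p])
  then have "cmod (vinner MA f f) \<le> C * vnorm MA f"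
    by (rule LIMSEQ_le[OF _ lim_C]) (use bound pN in auto)
  then have le: "vnorm MA f * vnorm MA f \<le> C * vnorm MA f"
    using M.inner_self[of f] fM by (simp add: power2_eq_square norm_mult)
  show "vnorm MA f \<le> C"
  proof (cases "vnorm MA f = 0")
    case False
    then have "0 < vnorm MA f" using M.norm_nonneg[of f] fM by (simp add: less_le)
    with le show ?thesis by (simp only: mult_le_cancel_right_pos)
  qed (use C in simp)
qed

lemma MA_pairing_le:
  assumes f: "f \<in> kernel_carrier X K E" and q: "q \<in> N"
  shows "cmod (pairing f q) \<le> vnorm MA f * gnorm q"
  using M.cauchy_schwarz[of f "ksum q"] f q MA_norm_ksum[OF q] by (simp add: MA_inner_ksum)

text \<open>A Cauchy sequence converges pointwise, and the estimates against kernel sums survive the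
  pointwise limit.\<close>

lemma MA_hilbert_space: "hilbert_space MA"
proof (rule M.hilbert_spaceI)
  fix f :: "nat \<Rightarrow> 'x \<Rightarrow> 'e"
  assume fM: "\<And>k. f k \<in> vecs MA"
    and cauchy: "\<And>e. e > 0 \<Longrightarrow> \<exists>n. \<forall>i\<ge>n. \<forall>j\<ge>n. vnorm MA (vminus MA (f i) (f j)) < e"
  have f: "\<And>k. f k \<in> kernel_carrier X K E" using fM by simp
  have d: "vminus MA (f i) (f j) \<in> kernel_carrier X K E" for i j
    using M.add_closed[OF fM M.scale_closed[OF fM], of i "-1" j] by (simp del: MA_simps(2-4))
  have pair_diff: "pairing (f i) q - pairing (f j) q = pairing (vminus MA (f i) (f j)) q" if "q \<in> N" for i j q
    using that carrierD[OF f] functions_on_closed(2)[of "f j" "f j" "-1"] by simp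
  have "\<exists>y. E.tends_to (\<lambda>k. f k z) y" if z: "z \<in> X" for z
  proof (rule E.cauchy_tends_to)
    have fz: "f k z \<in> vecs E" for k using carrierD[OF f] z by (auto simp: functions_on_def)
    then show "f k z \<in> vecs E" for k .
    fix e :: real assume e: "0 < e"
    define c where "c = sqrt (Re (K z z))"
    have K: "vnorm E (vminus E (f i z) (f j z)) \<le> vnorm MA (vminus MA (f i) (f j)) * \<bar>c\<bar>" for i j
    proof -
      let ?y = "vminus E (f i z) (f j z)"
      have y: "?y \<in> vecs E" using fz by simp
      have q: "[(z, ?y)] \<in> N" using z y by simp
      have "vnorm E ?y * vnorm E ?y = cmod (pairing (vminus MA (f i) (f j)) [(z, ?y)])"
        using E.inner_self[OF y] by (simp add: power2_eq_square norm_mult)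
      also have "\<dots> \<le> vnorm MA (vminus MA (f i) (f j)) * gnorm [(z, ?y)]"
        by (rule MA_pairing_le[OF d q])
      also have "gnorm [(z, ?y)] = c * vnorm E ?y"
        using E.inner_self[OF y] E.norm_nonneg[OF y] by (simp add: kernel_norm_def c_def real_sqrt_mult)
      also have "vnorm MA (vminus MA (f i) (f j)) * (c * vnorm E ?y)
          \<le> (vnorm MA (vminus MA (f i) (f j)) * \<bar>c\<bar>) * vnorm E ?y"
        unfolding mult.assoc[symmetric] using E.norm_nonneg[OF y] M.norm_nonneg[of "vminus MA (f i) (f j)"] d
        by (intro mult_right_mono mult_left_mono) auto
      finally have le: "vnorm E ?y * vnorm E ?y \<le> (vnorm MA (vminus MA (f i) (f j)) * \<bar>c\<bar>) * vnorm E ?y" .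
      show ?thesis
      proof (cases "vnorm E ?y = 0")
        case True
        then show ?thesis using M.norm_nonneg[of "vminus MA (f i) (f j)"] d by simp
      next
        case False
        then have "0 < vnorm E ?y" using E.norm_nonneg[OF y] by linarith
        with le show ?thesis by (simp only: mult_le_cancel_right_pos)
      qed
    qed
    obtain n where n: "\<And>i j. i \<ge> n \<Longrightarrow> j \<ge> n \<Longrightarrow> vnorm MA (vminus MA (f i) (f j)) < e / (\<bar>c\<bar> + 1)"
      using cauchy[of "e / (\<bar>c\<bar> + 1)"] e by (auto simp del: MA_simps)
    show "\<exists>n. \<forall>i\<ge>n. \<forall>j\<ge>n. vnorm E (vminus E (f i z) (f j z)) < e"
    proof (intro exI allI impI)
      fix i j assume ij: "n \<le> i" "n \<le> j"
      have "vnorm MA (vminus MA (f i) (f j)) * \<bar>c\<bar> \<le> vnorm MA (vminus MA (f i) (f j)) * (\<bar>c\<bar> + 1)"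
        using M.norm_nonneg[of "vminus MA (f i) (f j)"] d by (intro mult_left_mono) auto
      also have "\<dots> < e / (\<bar>c\<bar> + 1) * (\<bar>c\<bar> + 1)"
        using n[OF ij] by (intro mult_strict_right_mono) auto
      also have "\<dots> = e" by (simp add: add_nonneg_eq_0_iff)
      finally show "vnorm E (vminus E (f i z) (f j z)) < e" using K[of i j] by linarith
    qed
  qed
  then obtain y where y: "\<And>z. z \<in> X \<Longrightarrow> E.tends_to (\<lambda>k. f k z) (y z)" by metis
  define g where "g = (\<lambda>z. if z \<in> X then y z else vzero E)"
  have gF: "g \<in> functions_on X E" using y by (auto simp: g_def functions_on_def E.tends_to_def)
  have lim: "(\<lambda>k. pairing (f k) q) \<longlonglongrightarrow> pairing g q" if "q \<in> N" for q
    using that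
  proof induction
    case (Cons a q)
    obtain z \<zeta> where a: "a = (z, \<zeta>)" "z \<in> X" "\<zeta> \<in> vecs E" using Cons by auto
    with Cons show ?case using E.tends_to_inner[OF y, of z \<zeta>] by (auto simp: g_def intro!: tendsto_add)
  qed simp
  have close: "\<exists>n. \<forall>i\<ge>n. \<forall>q\<in>N. cmod (pairing (f i) q - pairing g q) \<le> e * gnorm q" if e: "e > 0" for e
  proof -
    obtain n where n: "\<And>i j. i \<ge> n \<Longrightarrow> j \<ge> n \<Longrightarrow> vnorm MA (vminus MA (f i) (f j)) < e"
      using cauchy[OF e] by (auto simp del: MA_simps)
    have "cmod (pairing (f i) q - pairing g q) \<le> e * gnorm q" if i: "i \<ge> n" and q: "q \<in> N" for i q
    proof (rule LIMSEQ_le_const2)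
      show "(\<lambda>k. cmod (pairing (f i) q - pairing (f k) q)) \<longlonglongrightarrow> cmod (pairing (f i) q - pairing g q)"
        by (intro tendsto_intros lim q)
      have "cmod (pairing (f i) q - pairing (f k) q) \<le> e * gnorm q" if "k \<ge> n" for k
        unfolding pair_diff[OF q] using MA_pairing_le[OF d q, of i k] n[OF i that] gnorm_nonneg[OF q]
        by (meson less_imp_le mult_right_mono order_trans)
      then show "\<exists>n. \<forall>k\<ge>n. cmod (pairing (f i) q - pairing (f k) q) \<le> e * gnorm q" by blast
    qed
    then show ?thesis by blast
  qed
  obtain n where n: "\<And>q. q \<in> N \<Longrightarrow> cmod (pairing (f n) q - pairing g q) \<le> 1 * gnorm q"
    using close[of 1] by auto
  have "cmod (pairing g q) \<le> (vnorm MA (f n) + 1) * gnorm q" if q: "q \<in> N" for q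
    using n[OF q] MA_pairing_le[OF f q, of n] norm_triangle_sub[of "pairing g q" "pairing (f n) q"]
    by (simp add: distrib_right norm_minus_commute)
  then have gM: "g \<in> kernel_carrier X K E" using gF by (auto simp: kernel_carrier_def)
  have "M.tends_to f g"
    unfolding M.tends_to_def
  proof (intro conjI allI)
    show "(\<lambda>k. vnorm MA (vminus MA (f k) g)) \<longlonglongrightarrow> 0"
    proof (rule LIMSEQ_I)
      fix e :: real assume e: "0 < e"
      obtain n where n: "\<And>i q. i \<ge> n \<Longrightarrow> q \<in> N \<Longrightarrow> cmod (pairing (f i) q - pairing g q) \<le> (e / 2) * gnorm q"
        using close[of "e / 2"] e by auto
      have "vnorm MA (vminus MA (f i) g) \<le> e / 2" if i: "i \<ge> n" for i
      proof (rule MA_criterion(2))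
        show "vminus MA (f i) g \<in> functions_on X E"
          using functions_on_closed carrierD[OF f] gF by simp
        fix q assume q: "q \<in> N"
        show "cmod (pairing (vminus MA (f i) g) q) \<le> e / 2 * gnorm q"
          using n[OF i q] q carrierD[OF f] gF functions_on_closed(2)[OF gF gF] by simp
      qed (use e in simp)
      moreover have "0 \<le> vnorm MA (vminus MA (f i) g)" for i
        by (rule M.norm_nonneg[OF M.add_closed[OF fM M.scale_closed]]) (simp add: gM)
      ultimately show "\<exists>n. \<forall>k\<ge>n. norm (vnorm MA (vminus MA (f k) g) - 0) < e"
        using e by (intro exI[of _ n]) (smt (verit) field_sum_of_halves real_norm_def)
    qed
  qed (use f gM in simp_all)
  then show "\<exists>x. M.tends_to f x" by blast
qed

lemma kernel_fun_ksum: "w \<in> X \<Longrightarrow> \<eta> \<in> vecs E \<Longrightarrow> kernel_fun X K E w \<eta> = ksum [(w, \<eta>)]"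
  by (simp add: kernel_fun_def kernel_sum_def fun_eq_iff E.add_commute[of _ "vzero E"] E.add_zero)

lemma MA_is_rkhs: "is_rkhs X K E MA"
  unfolding is_rkhs_def
proof (intro conjI ballI allI impI)
  fix w \<eta> assume w: "w \<in> X" "\<eta> \<in> vecs E"
  show "kernel_fun X K E w \<eta> \<in> vecs MA" using w by (simp add: kernel_fun_ksum)
  fix f assume "f \<in> vecs MA"
  then show "vinner MA f (kernel_fun X K E w \<eta>) = vinner E (f w) \<eta>"
    using w by (simp add: kernel_fun_ksum MA_inner_ksum)
qed (use MA_hilbert_space carrierD in \<open>auto simp: functions_on_def moore_aronszajn_def\<close>)

text \<open>In any space with kernel \<open>K\<close> the sums \<open>\<Sum> K(\<cdot>,w) \<eta>\<close> have the prescribed Gram matrix, so the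
  sequences that approximate a function converge to it there as well.\<close>

lemma is_rkhs_unique:
  assumes H: "is_rkhs X K E H"
  shows "H = MA"
proof -
  interpret H: hilbert_space H using H by (simp add: is_rkhs_def)
  have funs: "\<And>f. f \<in> vecs H \<Longrightarrow> f \<in> functions_on X E"
    and ops: "vadd H = (\<lambda>f g z. vadd E (f z) (g z))" "vzero H = (\<lambda>z. vzero E)"
      "vscale H = (\<lambda>c f z. vscale E c (f z))"
    and off: "\<And>f g. f \<notin> vecs H \<or> g \<notin> vecs H \<Longrightarrow> vinner H f g = 0"
    and ker: "\<And>w \<eta>. w \<in> X \<Longrightarrow> \<eta> \<in> vecs E \<Longrightarrow> kernel_fun X K E w \<eta> \<in> vecs H"
    and rep: "\<And>w \<eta> f. w \<in> X \<Longrightarrow> \<eta> \<in> vecs E \<Longrightarrow> f \<in> vecs H \<Longrightarrow> vinner H f (kernel_fun X K E w \<eta>) = vinner E (f w) \<eta>"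
    using H by (auto simp: is_rkhs_def functions_on_def)
  have ksum_Cons: "ksum ((w, \<eta>) # p) = vadd H (kernel_fun X K E w \<eta>) (ksum p)" for w \<eta> p
    by (auto simp: kernel_sum_def kernel_fun_def ops E.add_zero)
  have ksum: "ksum p \<in> vecs H \<and> (\<forall>f\<in>vecs H. vinner H f (ksum p) = pairing f p)" if "p \<in> N" for p
    using that
  proof induction
    case Nil
    have "ksum [] = vzero H" by (auto simp: kernel_sum_def ops)
    then show ?case by simp
  next
    case (Cons a p)
    then show ?case by (cases a) (auto simp: ksum_Cons ker rep)
  qed
  have gram: "vinner H (ksum p) (ksum q) = gram p q" if "p \<in> N" "q \<in> N" for p q
    using ksum that by simp
  have diff: "vnorm H (vminus H (ksum p) (ksum q)) = gnorm (p @ scl (-1) q)" if "p \<in> N" "q \<in> N" for p q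
  proof -
    have "(vnorm H (vminus H (ksum p) (ksum q)))\<^sup>2 = (gnorm (p @ scl (-1) q))\<^sup>2"
      using that ksum gram H.norm_minus_sq[of "ksum p" "ksum q"] gram_commute[OF that]
      by (simp only: gnorm_append_sq) (simp add: H.norm_sq gnorm_sq)
    then show ?thesis
      using that ksum by (subst power2_eq_iff_nonneg[symmetric]) simp_all
  qed
  have bound: "cmod (pairing f p) \<le> vnorm H f * gnorm p" if "f \<in> vecs H" "p \<in> N" for f p
    using H.cauchy_schwarz[of f "ksum p"] ksum[OF that(2)] that gram[of p p] by (simp add: vnorm_def[of H "ksum p"] kernel_norm_def)
  have sub: "vecs H \<subseteq> kernel_carrier X K E"
    using bound funs by (auto simp: kernel_carrier_def)
  have approx: "f \<in> vecs H \<and> H.tends_to (\<lambda>k. ksum (p k)) f"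
    if f: "f \<in> kernel_carrier X K E" and p: "approximates X K E p f" for f p
  proof -
    obtain \<epsilon> where \<epsilon>: "\<epsilon> \<longlonglongrightarrow> 0" "\<And>k q. q \<in> N \<Longrightarrow> cmod (pairing f q - gram (p k) q) \<le> \<epsilon> k * gnorm q"
      and pN: "\<And>k. p k \<in> N" using p by (auto simp: approximates_def)
    have "\<exists>g. H.tends_to (\<lambda>k. ksum (p k)) g"
    proof (rule H.cauchy_tends_to)
      fix e :: real assume "0 < e"
      then have "\<forall>\<^sub>F k in sequentially. \<bar>\<epsilon> k\<bar> < e / 2"
        using order_tendstoD(2)[OF tendsto_rabs_zero[OF \<epsilon>(1)], of "e / 2"] by simp
      then obtain M where M: "\<And>k. k \<ge> M \<Longrightarrow> \<bar>\<epsilon> k\<bar> < e / 2"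
        by (auto simp: eventually_sequentially)
      have "vnorm H (vminus H (ksum (p i)) (ksum (p j))) < e" if "i \<ge> M" "j \<ge> M" for i j
        using approximates_gap[OF pN pN carrierD[OF f] \<epsilon>(2) \<epsilon>(2), of i j] M[OF that(1)] M[OF that(2)]
          diff[OF pN pN, of i j] by linarith
      then show "\<exists>M. \<forall>i\<ge>M. \<forall>j\<ge>M. vnorm H (vminus H (ksum (p i)) (ksum (p j))) < e" by blast
    qed (use ksum pN in auto)
    then obtain g where g: "H.tends_to (\<lambda>k. ksum (p k)) g" by blast
    then have gH: "g \<in> vecs H" by (simp add: H.tends_to_def)
    have "pairing g q = pairing f q" if q: "q \<in> N" for q
    proof (rule LIMSEQ_unique)
      show "(\<lambda>k. gram (p k) q) \<longlonglongrightarrow> pairing g q"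
        using H.tends_to_inner[OF g, of "ksum q"] ksum[OF q] ksum[OF pN] gH q pN by simp
      have "(\<lambda>k. pairing f q - gram (p k) q) \<longlonglongrightarrow> 0"
        by (rule Lim_null_comparison[where g = "\<lambda>k. \<epsilon> k * gnorm q"])
          (use \<epsilon> q in \<open>auto intro!: tendsto_mult_left_zero always_eventually\<close>)
      from tendsto_diff[OF tendsto_const[of "pairing f q"] this]
      show "(\<lambda>k. gram (p k) q) \<longlonglongrightarrow> pairing f q" by simp
    qed
    then have inner: "vinner E (g z) \<zeta> = vinner E (f z) \<zeta>" if "z \<in> X" "\<zeta> \<in> vecs E" for z \<zeta>
      using that by (metis kernel_pairing_simps(1,2) add.right_neutral lists.simps mem_Sigma_iff)
    have "g z = f z" for z
      using funs[OF gH] carrierD[OF f] inner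
      by (cases "z \<in> X") (auto simp: functions_on_def intro: E.eq_by_inner)
    then have "g = f" by blast
    with g gH show ?thesis by simp
  qed
  have vecs: "vecs H = kernel_carrier X K E"
    using sub approx approximates_exists by blast
  have "vinner H f g = vinner MA f g" for f g
  proof (cases "f \<in> kernel_carrier X K E \<and> g \<in> kernel_carrier X K E")
    case True
    then obtain r where r: "approximates X K E r g" using approximates_exists by blast
    then have rN: "\<And>k. r k \<in> N" by (auto simp: approximates_def)
    have f: "f \<in> vecs H" and "g \<in> vecs H" using True vecs by auto
    have "H.tends_to (\<lambda>k. ksum (r k)) g" using approx r True by blast
    from tendsto_cnj[OF H.tends_to_inner[OF this f]]
    have "(\<lambda>k. vinner H f (ksum (r k))) \<longlonglongrightarrow> vinner H f g"
      using H.inner_commute[OF _ f] \<open>g \<in> vecs H\<close> ksum[OF rN] by simp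
    then have "(\<lambda>k. pairing f (r k)) \<longlonglongrightarrow> vinner H f g" using ksum[OF rN] f by simp
    with pairing_lim[of f g r] True r show ?thesis using LIMSEQ_unique by blast
  qed (use off vecs in \<open>auto simp: moore_aronszajn_def\<close>)
  then show ?thesis using vecs ops by (intro hspace.equality) auto
qed

theorem rkhs_is_rkhs: "is_rkhs X K E (rkhs X K E)" and rkhs_eq: "rkhs X K E = MA"
proof -
  show "rkhs X K E = MA"
    unfolding rkhs_def using MA_is_rkhs is_rkhs_unique by (rule the_equality)
  with MA_is_rkhs show "is_rkhs X K E (rkhs X K E)" by simp
qed

end

section \<open>Operations on positive kernels\<close>

lemma complex_line_simps [simp]:
  "vecs complex_line = UNIV" "vadd complex_line = (+)" "vzero complex_line = 0"
  "vscale complex_line = (*)" "vinner complex_line = (\<lambda>x y. x * cnj y)"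
  by (simp_all add: complex_line_def)

lemma vnorm_complex_line [simp]: "vnorm complex_line x = cmod x"
  by (simp add: vnorm_def complex_mult_cnj cmod_def power2_eq_square)

lemma hilbert_complex_line: "hilbert_space complex_line"
proof -
  interpret inner_product_space complex_line
    by unfold_locales (auto simp: algebra_simps)
  show ?thesis
  proof (rule hilbert_spaceI)
    fix f :: "nat \<Rightarrow> complex"
    assume c: "\<And>e. e > 0 \<Longrightarrow> \<exists>N. \<forall>i\<ge>N. \<forall>j\<ge>N. vnorm complex_line (vminus complex_line (f i) (f j)) < e"
    have "Cauchy f"
      using c by (intro metric_CauchyI) (auto simp: dist_norm)
    then obtain x where "f \<longlonglongrightarrow> x" unfolding Cauchy_convergent_iff convergent_def by blast
    then have "(\<lambda>k. cmod (f k - x)) \<longlonglongrightarrow> 0" by (simp add: tendsto_norm_zero_iff LIM_zero_iff)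
    then show "\<exists>x. tends_to f x"
      by (intro exI[of _ x]) (auto simp: tends_to_def)
  qed
qed

lemma positive_kernelI:
  assumes "hilbert_space E" and "\<And>z w. z \<in> X \<Longrightarrow> w \<in> X \<Longrightarrow> K w z = cnj (K z w)"
    and "\<And>p. p \<in> nodes X E \<Longrightarrow> 0 \<le> Re (kernel_gram K E p p)"
  shows "positive_kernel E X K"
  unfolding positive_kernel_def positive_kernel_axioms_def using assms by blast

lemma kernel_gram_cong:
  assumes "\<And>z w. z \<in> X \<Longrightarrow> w \<in> X \<Longrightarrow> K z w = L z w" and "p \<in> nodes X E" "q \<in> nodes X E"
  shows "kernel_gram K E p q = kernel_gram L E p q"
  unfolding kernel_gram_def using assms
  by (intro arg_cong[of _ _ sum_list] map_cong refl)
    (auto simp: lists_eq_set subset_iff intro!: arg_cong[of _ _ sum_list] map_cong)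

lemma positive_kernel_cong:
  assumes "positive_kernel E X K" and eq: "\<And>z w. z \<in> X \<Longrightarrow> w \<in> X \<Longrightarrow> L z w = K z w"
  shows "positive_kernel E X L"
proof -
  interpret positive_kernel E X K by fact
  show ?thesis
  proof (rule positive_kernelI)
    fix p assume p: "p \<in> nodes X E"
    have "kernel_gram L E p p = kernel_gram K E p p" by (rule kernel_gram_cong[OF eq p p])
    then show "0 \<le> Re (kernel_gram L E p p)" using gram_nonneg[OF p] by simp
  next
    fix z w assume zw: "z \<in> X" "w \<in> X"
    show "L w z = cnj (L z w)" unfolding eq[OF zw] eq[OF zw(2,1)] by (rule hermitian[OF zw])
  qed (rule E.hilbert_space_axioms)
qed

lemma kernel_gram_add:
  "kernel_gram (\<lambda>z w. K z w + L z w) E p q = kernel_gram K E p q + kernel_gram L E p q"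
  by (simp add: kernel_gram_def case_prod_unfold distrib_right sum_list_addf)

lemma kernel_gram_minus:
  "kernel_gram (\<lambda>z w. K z w - L z w) E p q = kernel_gram K E p q - kernel_gram L E p q"
  by (simp add: kernel_gram_def case_prod_unfold left_diff_distrib sum_list_subtractf)

lemma kernel_gram_mult: "kernel_gram (\<lambda>z w. c * K z w) E p q = c * kernel_gram K E p q"
  by (simp add: kernel_gram_def case_prod_unfold mult.assoc sum_list_const_mult)

lemma kernel_gram_sums:
  assumes "\<And>z w. z \<in> X \<Longrightarrow> w \<in> X \<Longrightarrow> (\<lambda>k. L k z w) sums K z w"
    and "p \<in> nodes X E" "q \<in> nodes X E"
  shows "(\<lambda>k. kernel_gram (L k) E p q) sums kernel_gram K E p q"
proof -
  have "(\<lambda>k. \<Sum>(v, \<zeta>)\<leftarrow>q. L k v w * vinner E \<eta> \<zeta>) sums (\<Sum>(v, \<zeta>)\<leftarrow>q. K v w * vinner E \<eta> \<zeta>)" if w: "w \<in> X" for w \<eta>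
    using assms(3)
  proof induction
    case (Cons a q)
    then show ?case using assms(1) w by (auto simp: case_prod_unfold intro!: sums_add sums_mult2)
  qed simp
  then show ?thesis
    unfolding kernel_gram_def
    using assms(2)
  proof (induction rule: lists.induct[OF assms(2)])
    case (2 a p)
    then show ?case by (auto simp: case_prod_unfold intro!: sums_add)
  qed simp
qed

text \<open>The Gram matrix of a convergent series of kernels is the series of the Gram matrices.\<close>

lemma positive_kernel_sums:
  assumes L: "\<And>k. positive_kernel E X (L k)"
    and sums: "\<And>z w. z \<in> X \<Longrightarrow> w \<in> X \<Longrightarrow> (\<lambda>k. L k z w) sums K z w"
  shows "positive_kernel E X K"
proof (rule positive_kernelI)
  show "hilbert_space E" using L[of 0] by (simp add: positive_kernel_def)
  fix z w assume zw: "z \<in> X" "w \<in> X"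
  have *: "L k w z = cnj (L k z w)" for k using positive_kernel.hermitian[OF L] zw by blast
  have "(\<lambda>k. L k w z) sums cnj (K z w)"
    unfolding * using sums[OF zw] by (simp only: sums_cnj)
  then show "K w z = cnj (K z w)"
    using sums[OF zw(2,1)] by (rule sums_unique2[symmetric])
next
  fix p assume p: "p \<in> nodes X E"
  have "(\<lambda>k. Re (kernel_gram (L k) E p p)) sums Re (kernel_gram K E p p)"
    by (rule sums_Re) (rule kernel_gram_sums[OF sums p p])
  then show "0 \<le> Re (kernel_gram K E p p)"
    by (rule sums_le[OF _ sums_zero, rotated]) (use positive_kernel.gram_nonneg[OF L p] in simp)
qed

lemma positive_kernel_add:
  assumes K: "positive_kernel E X K" and L: "positive_kernel E X L"
  shows "positive_kernel E X (\<lambda>z w. K z w + L z w)"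
proof -
  interpret K: positive_kernel E X K by fact
  interpret L: positive_kernel E X L by fact
  show ?thesis
  proof (rule positive_kernelI)
    fix z w assume zw: "z \<in> X" "w \<in> X"
    show "K w z + L w z = cnj (K z w + L z w)"
      unfolding K.hermitian[OF zw] L.hermitian[OF zw] by simp
  next
    fix p assume p: "p \<in> nodes X E"
    show "0 \<le> Re (kernel_gram (\<lambda>z w. K z w + L z w) E p p)"
      using K.gram_nonneg[OF p] L.gram_nonneg[OF p] by (simp add: kernel_gram_add)
  qed (rule K.E.hilbert_space_axioms)
qed

lemma positive_kernel_scale:
  assumes K: "positive_kernel E X K" and "0 \<le> c"
  shows "positive_kernel E X (\<lambda>z w. of_real c * K z w)"
proof -
  interpret K: positive_kernel E X K by fact
  show ?thesis
  proof (rule positive_kernelI)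
    fix z w assume zw: "z \<in> X" "w \<in> X"
    show "of_real c * K w z = cnj (of_real c * K z w)"
      unfolding K.hermitian[OF zw] by simp
  next
    fix p assume p: "p \<in> nodes X E"
    show "0 \<le> Re (kernel_gram (\<lambda>z w. of_real c * K z w) E p p)"
      using K.gram_nonneg[OF p] assms(2) by (simp add: kernel_gram_mult)
  qed (rule K.E.hilbert_space_axioms)
qed

text \<open>A change of nodes: composing a kernel with \<open>\<sigma>\<close> and multiplying it by \<open>\<psi>(z) \<psi>(w)\<^sup>*\<close> amounts
  to moving each node \<open>(w, \<eta>)\<close> to \<open>(\<sigma> w, \<psi>(w)\<^sup>* \<eta>)\<close>.\<close>

definition move_nodes :: "'e hspace \<Rightarrow> ('x \<Rightarrow> complex) \<Rightarrow> ('x \<Rightarrow> 'y) \<Rightarrow> ('x \<times> 'e) list \<Rightarrow> ('y \<times> 'e) list" where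
  "move_nodes E \<psi> \<sigma> p = map (\<lambda>(w, \<eta>). (\<sigma> w, vscale E (cnj (\<psi> w)) \<eta>)) p"

lemma move_nodes_in:
  assumes "inner_product_space E" and "\<sigma> ` X \<subseteq> Y" and "p \<in> nodes X E"
  shows "move_nodes E \<psi> \<sigma> p \<in> nodes Y E"
proof -
  interpret inner_product_space E by fact
  show ?thesis using assms(2,3) by (auto simp: move_nodes_def lists_eq_set)
qed

lemma kernel_gram_move:
  assumes "inner_product_space E" and "p \<in> nodes X E" and "q \<in> nodes X E"
  shows "kernel_gram L E (move_nodes E \<psi> \<sigma> p) (move_nodes E \<psi> \<sigma> q) =
    kernel_gram (\<lambda>z w. \<psi> z * cnj (\<psi> w) * L (\<sigma> z) (\<sigma> w)) E p q"
proof -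
  interpret inner_product_space E by fact
  have "(\<Sum>(v, \<zeta>)\<leftarrow>move_nodes E \<psi> \<sigma> q. L v (\<sigma> w) * vinner E (vscale E (cnj (\<psi> w)) \<eta>) \<zeta>) =
    (\<Sum>(v, \<zeta>)\<leftarrow>q. \<psi> v * cnj (\<psi> w) * L (\<sigma> v) (\<sigma> w) * vinner E \<eta> \<zeta>)" if "\<eta> \<in> vecs E" for w \<eta>
    using assms(3) by induction (use that in \<open>auto simp: move_nodes_def\<close>)
  then show ?thesis
    using assms(2) unfolding kernel_gram_def
    by (induction rule: lists.induct[OF assms(2)]) (auto simp: move_nodes_def case_prod_unfold)
qed

lemma kernel_pairing_move:
  assumes "inner_product_space E" and "q \<in> nodes X E" and "\<And>z. z \<in> X \<Longrightarrow> f (\<sigma> z) \<in> vecs E"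
  shows "kernel_pairing E f (move_nodes E \<psi> \<sigma> q) =
    kernel_pairing E (\<lambda>z. if z \<in> X then vscale E (\<psi> z) (f (\<sigma> z)) else vzero E) q"
proof -
  interpret inner_product_space E by fact
  show ?thesis
    using assms(2) by induction (use assms(3) in \<open>auto simp: move_nodes_def\<close>)
qed

lemma positive_kernel_move:
  assumes L: "positive_kernel E Y L" and \<sigma>: "\<sigma> ` X \<subseteq> Y"
  shows "positive_kernel E X (\<lambda>z w. \<psi> z * cnj (\<psi> w) * L (\<sigma> z) (\<sigma> w))"
proof -
  interpret L: positive_kernel E Y L by fact
  show ?thesis
  proof (rule positive_kernelI)
    fix z w assume "z \<in> X" "w \<in> X"
    then have *: "L (\<sigma> w) (\<sigma> z) = cnj (L (\<sigma> z) (\<sigma> w))" using \<sigma> L.hermitian by blast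
    show "\<psi> w * cnj (\<psi> z) * L (\<sigma> w) (\<sigma> z) = cnj (\<psi> z * cnj (\<psi> w) * L (\<sigma> z) (\<sigma> w))"
      unfolding * by simp
  next
    fix p assume p: "p \<in> nodes X E"
    show "0 \<le> Re (kernel_gram (\<lambda>z w. \<psi> z * cnj (\<psi> w) * L (\<sigma> z) (\<sigma> w)) E p p)"
      using L.gram_nonneg[OF move_nodes_in[OF L.E.inner_product_space_axioms \<sigma> p]]
        kernel_gram_move[OF L.E.inner_product_space_axioms p p] by metis
  qed (rule L.E.hilbert_space_axioms)
qed

text \<open>The Gram form of the constant kernel is the squared norm of the sum of the \<open>\<eta>\<close>.\<close>

lemma positive_kernel_one:
  assumes "hilbert_space E"
  shows "positive_kernel E X (\<lambda>z w. 1)"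
proof -
  interpret hilbert_space E by fact
  show ?thesis
  proof (rule positive_kernelI)
    fix p assume p: "p \<in> nodes X E"
    define s where "s = foldr (\<lambda>(w, \<eta>). vadd E \<eta>) p (vzero E)"
    have s: "s \<in> vecs E"
      unfolding s_def using p by induction auto
    have inner: "(\<Sum>(v, \<zeta>)\<leftarrow>p. vinner E \<eta> \<zeta>) = vinner E \<eta> s" if "\<eta> \<in> vecs E" for \<eta>
    proof -
      have "foldr (\<lambda>(w, \<eta>). vadd E \<eta>) p (vzero E) \<in> vecs E \<and>
          vinner E \<eta> (foldr (\<lambda>(w, \<eta>). vadd E \<eta>) p (vzero E)) = (\<Sum>(v, \<zeta>)\<leftarrow>p. vinner E \<eta> \<zeta>)"
        using p by induction (use that in auto)
      then show ?thesis by (simp add: s_def)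
    qed
    have "foldr (\<lambda>(w, \<eta>). vadd E \<eta>) q (vzero E) \<in> vecs E \<and>
        vinner E (foldr (\<lambda>(w, \<eta>). vadd E \<eta>) q (vzero E)) s = kernel_gram (\<lambda>z w. 1) E q p"
      if "q \<in> nodes X E" for q
      using that by induction (use s inner in \<open>auto simp: kernel_gram_def\<close>)
    from this[OF p] have "kernel_gram (\<lambda>z w. 1) E p p = vinner E s s"
      by (simp add: s_def)
    then show "0 \<le> Re (kernel_gram (\<lambda>z w. 1) E p p)" using inner_nonneg[OF s] by simp
  qed (use assms in auto)
qed

lemma bergman_kernel_Suc: "bergman_kernel (Suc k) z w = bergman_kernel k z w * bergman_kernel 1 z w"
  by (simp add: bergman_kernel_def)

lemma disc_kernel_nonzero:
  assumes "z \<in> unit_disc" "w \<in> unit_disc"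
  shows "1 - z * cnj w \<noteq> 0"
proof
  assume "1 - z * cnj w = 0"
  then have "cmod (z * cnj w) = 1" by (metis norm_one eq_iff_diff_eq_0)
  moreover have "cmod z * cmod w < 1 * 1"
    using assms by (intro mult_strict_mono') auto
  ultimately show False by (simp add: norm_mult)
qed

text \<open>The factor is the geometric series of \<open>\<phi>(z) \<phi>(w)\<^sup>*\<close>, and each term multiplies \<open>K\<close> in the
  form \<open>\<psi>(z) \<psi>(w)\<^sup>*\<close>.\<close>

lemma positive_kernel_szego_factor:
  assumes K: "positive_kernel E X K" and \<phi>: "\<phi> ` X \<subseteq> unit_disc"
  shows "positive_kernel E X (\<lambda>z w. K z w * bergman_kernel 1 (\<phi> z) (\<phi> w))"
proof (rule positive_kernel_sums)
  fix k
  show "positive_kernel E X (\<lambda>z w. \<phi> z ^ k * cnj (\<phi> w ^ k) * K z w)"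
    using positive_kernel_move[OF K, of id X "\<lambda>z. \<phi> z ^ k"] by simp
next
  fix z w assume "z \<in> X" "w \<in> X"
  then have "cmod (\<phi> z) < 1" "cmod (\<phi> w) < 1" using \<phi> by auto
  then have "cmod (\<phi> z) * cmod (\<phi> w) < 1 * 1" by (intro mult_strict_mono') auto
  then have "cmod (\<phi> z * cnj (\<phi> w)) < 1" by (simp add: norm_mult)
  then have "(\<lambda>k. (\<phi> z * cnj (\<phi> w)) ^ k) sums (1 / (1 - \<phi> z * cnj (\<phi> w)))" by (rule geometric_sums)
  from sums_mult2[OF this, of "K z w"]
  show "(\<lambda>k. \<phi> z ^ k * cnj (\<phi> w ^ k) * K z w) sums (K z w * bergman_kernel 1 (\<phi> z) (\<phi> w))"
    by (simp add: power_mult_distrib bergman_kernel_def mult.commute)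
qed

lemma positive_kernel_bergman_factor:
  assumes K: "positive_kernel E X K" and \<phi>: "\<phi> ` X \<subseteq> unit_disc"
  shows "positive_kernel E X (\<lambda>z w. K z w * bergman_kernel k (\<phi> z) (\<phi> w))"
proof (induction k)
  case 0
  then show ?case using K by (simp add: bergman_kernel_def)
next
  case (Suc k)
  show ?case
    using positive_kernel_szego_factor[OF Suc \<phi>]
    by (simp only: bergman_kernel_Suc[of k] mult.assoc)
qed

text \<open>Induction along \<open>B\<^sub>k\<^sub>+\<^sub>1 - 1 = (B\<^sub>k - 1) + \<phi>(z) \<phi>(w)\<^sup>* B\<^sub>k\<^sub>+\<^sub>1\<close>. This positivity makes
  setting a coordinate to zero a contraction.\<close>

lemma positive_kernel_bergman_minus_one:
  assumes K: "positive_kernel E X K" and \<phi>: "\<phi> ` X \<subseteq> unit_disc"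
  shows "positive_kernel E X (\<lambda>z w. K z w * (bergman_kernel k (\<phi> z) (\<phi> w) - 1))"
proof (induction k)
  case 0
  have "positive_kernel E X (\<lambda>z w. of_real 0 * K z w)" by (rule positive_kernel_scale[OF K]) simp
  then show ?case by (simp add: bergman_kernel_def)
next
  case (Suc k)
  have "positive_kernel E X (\<lambda>z w. \<phi> z * cnj (\<phi> w) * (K z w * bergman_kernel (Suc k) (\<phi> z) (\<phi> w)))"
    using positive_kernel_move[OF positive_kernel_bergman_factor[OF K \<phi>], of id X] by simp
  from positive_kernel_add[OF Suc this] show ?case
  proof (rule positive_kernel_cong)
    fix z w assume "z \<in> X" "w \<in> X"
    then have "1 - \<phi> z * cnj (\<phi> w) \<noteq> 0" using \<phi> by (intro disc_kernel_nonzero) auto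
    then have "bergman_kernel (Suc k) (\<phi> z) (\<phi> w) =
        bergman_kernel k (\<phi> z) (\<phi> w) + \<phi> z * cnj (\<phi> w) * bergman_kernel (Suc k) (\<phi> z) (\<phi> w)"
      by (simp add: bergman_kernel_def field_simps)
    then have "K z w * (bergman_kernel (Suc k) (\<phi> z) (\<phi> w) - 1) = K z w *
        (bergman_kernel k (\<phi> z) (\<phi> w) + \<phi> z * cnj (\<phi> w) * bergman_kernel (Suc k) (\<phi> z) (\<phi> w) - 1)"
      by (rule arg_cong[of _ _ "\<lambda>x. K z w * (x - 1)"])
    also have "\<dots> = K z w * (bergman_kernel k (\<phi> z) (\<phi> w) - 1) +
        \<phi> z * cnj (\<phi> w) * (K z w * bergman_kernel (Suc k) (\<phi> z) (\<phi> w))"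
      by (simp add: algebra_simps)
    finally show "K z w * (bergman_kernel (Suc k) (\<phi> z) (\<phi> w) - 1) = K z w * (bergman_kernel k (\<phi> z) (\<phi> w) - 1) +
        \<phi> z * cnj (\<phi> w) * (K z w * bergman_kernel (Suc k) (\<phi> z) (\<phi> w))" .
  qed
qed

lemma positive_kernel_bergman_prod:
  assumes K: "positive_kernel E X K" and "finite S" and \<phi>: "\<And>i z. i \<in> S \<Longrightarrow> z \<in> X \<Longrightarrow> \<phi> i z \<in> unit_disc"
  shows "positive_kernel E X (\<lambda>z w. K z w * (\<Prod>i\<in>S. bergman_kernel (m i) (\<phi> i z) (\<phi> i w)))"
  using assms(2,3)
proof (induction S)
  case empty
  then show ?case using K by simp
next
  case (insert i S)
  then have "positive_kernel E X (\<lambda>z w. K z w * (\<Prod>i\<in>S. bergman_kernel (m i) (\<phi> i z) (\<phi> i w)))" by auto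
  moreover have "\<phi> i ` X \<subseteq> unit_disc" using insert.prems by blast
  ultimately have "positive_kernel E X (\<lambda>z w. K z w * (\<Prod>i\<in>S. bergman_kernel (m i) (\<phi> i z) (\<phi> i w))
      * bergman_kernel (m i) (\<phi> i z) (\<phi> i w))"
    by (rule positive_kernel_bergman_factor)
  then show ?case using insert.hyps by (simp add: mult_ac)
qed

section \<open>Reproducing kernel Hilbert spaces\<close>

context positive_kernel
begin

lemma rkhs_ops [simp]:
  "vadd (rkhs X K E) = (\<lambda>f g z. vadd E (f z) (g z))"
  "vzero (rkhs X K E) = (\<lambda>z. vzero E)"
  "vscale (rkhs X K E) = (\<lambda>c f z. vscale E c (f z))"
  by (simp_all add: rkhs_eq)

lemma rkhs_hilbert_space: "hilbert_space (rkhs X K E)"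
  using MA_hilbert_space by (simp add: rkhs_eq)

lemma rkhs_functions: "f \<in> vecs (rkhs X K E) \<Longrightarrow> f \<in> functions_on X E"
  using carrierD by (simp add: rkhs_eq)

lemma rkhs_kernel_fun:
  assumes "w \<in> X" "\<eta> \<in> vecs E"
  shows "kernel_fun X K E w \<eta> \<in> vecs (rkhs X K E)"
    and "f \<in> vecs (rkhs X K E) \<Longrightarrow> vinner (rkhs X K E) f (kernel_fun X K E w \<eta>) = vinner E (f w) \<eta>"
  using rkhs_is_rkhs assms by (auto simp: is_rkhs_def)

lemma rkhs_criterion:
  assumes "f \<in> functions_on X E" and "0 \<le> C"
    and "\<And>q. q \<in> N \<Longrightarrow> cmod (pairing f q) \<le> C * gnorm q"
  shows "f \<in> vecs (rkhs X K E)" and "vnorm (rkhs X K E) f \<le> C"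
  using MA_criterion[OF assms] by (simp_all add: rkhs_eq)

lemma rkhs_pairing_le:
  "f \<in> vecs (rkhs X K E) \<Longrightarrow> q \<in> N \<Longrightarrow> cmod (pairing f q) \<le> vnorm (rkhs X K E) f * gnorm q"
  using MA_pairing_le by (simp add: rkhs_eq)

end

text \<open>Weighted composition operators \<open>f \<mapsto> \<psi> (f \<circ> \<sigma>)\<close> are bounded when the kernel inequality says
  that their adjoints are bounded on kernel functions.\<close>

lemma weighted_composition_in:
  assumes K: "positive_kernel E X K" and L: "positive_kernel E Y L" and \<sigma>: "\<sigma> ` X \<subseteq> Y"
    and C: "0 \<le> C" and D: "positive_kernel E X (\<lambda>z w. of_real (C\<^sup>2) * K z w - \<psi> z * cnj (\<psi> w) * L (\<sigma> z) (\<sigma> w))"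
    and f: "f \<in> vecs (rkhs Y L E)"
  shows "(\<lambda>z. if z \<in> X then vscale E (\<psi> z) (f (\<sigma> z)) else vzero E) \<in> vecs (rkhs X K E)" (is "?g \<in> _")
    and "vnorm (rkhs X K E) (\<lambda>z. if z \<in> X then vscale E (\<psi> z) (f (\<sigma> z)) else vzero E) \<le> C * vnorm (rkhs Y L E) f"
proof -
  interpret K: positive_kernel E X K by fact
  interpret L: positive_kernel E Y L by fact
  interpret D: positive_kernel E X "\<lambda>z w. of_real (C\<^sup>2) * K z w - \<psi> z * cnj (\<psi> w) * L (\<sigma> z) (\<sigma> w)" by fact
  interpret LH: hilbert_space "rkhs Y L E" by (rule L.rkhs_hilbert_space)
  have fF: "\<And>z. z \<in> X \<Longrightarrow> f (\<sigma> z) \<in> vecs E" using L.rkhs_functions[OF f] \<sigma> by (auto simp: functions_on_def)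
  have nf: "0 \<le> vnorm (rkhs Y L E) f" using f by simp
  have gF: "?g \<in> functions_on X E" using fF by (auto simp: functions_on_def)
  have bound: "cmod (kernel_pairing E ?g q) \<le> (C * vnorm (rkhs Y L E) f) * K.gnorm q" if q: "q \<in> nodes X E" for q
  proof -
    let ?q = "move_nodes E \<psi> \<sigma> q"
    have q': "?q \<in> nodes Y E" by (rule move_nodes_in[OF K.E.inner_product_space_axioms \<sigma> q])
    have "0 \<le> Re (of_real (C\<^sup>2) * K.gram q q - L.gram ?q ?q)"
      using D.gram_nonneg[OF q] kernel_gram_move[OF K.E.inner_product_space_axioms q q, of L \<psi> \<sigma>]
      by (simp only: kernel_gram_minus kernel_gram_mult)
    then have "(L.gnorm ?q)\<^sup>2 \<le> (C * K.gnorm q)\<^sup>2"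
      using K.gnorm_sq[OF q] L.gnorm_sq[OF q'] by (simp add: power_mult_distrib)
    then have "L.gnorm ?q \<le> C * K.gnorm q"
      by (rule power2_le_imp_le) (use C K.gnorm_nonneg[OF q] in simp)
    then have "vnorm (rkhs Y L E) f * L.gnorm ?q \<le> vnorm (rkhs Y L E) f * (C * K.gnorm q)"
      using nf by (rule mult_left_mono)
    with L.rkhs_pairing_le[OF f q'] show ?thesis
      using kernel_pairing_move[OF K.E.inner_product_space_axioms q, of f \<sigma> \<psi>] fF
      by (simp add: mult_ac)
  qed
  have nC: "0 \<le> C * vnorm (rkhs Y L E) f" using C nf by simp
  show "?g \<in> vecs (rkhs X K E)" and "vnorm (rkhs X K E) ?g \<le> C * vnorm (rkhs Y L E) f"
    using K.rkhs_criterion[OF gF nC bound] by auto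
qed

lemma weighted_composition_linear:
  assumes K: "positive_kernel E X K" and L: "positive_kernel E Y L" and \<sigma>: "\<sigma> ` X \<subseteq> Y"
    and C: "0 \<le> C" and D: "positive_kernel E X (\<lambda>z w. of_real (C\<^sup>2) * K z w - \<psi> z * cnj (\<psi> w) * L (\<sigma> z) (\<sigma> w))"
  shows "linear_op (rkhs Y L E) (rkhs X K E) (\<lambda>f z. if z \<in> X then vscale E (\<psi> z) (f (\<sigma> z)) else vzero E)"
proof -
  interpret K: positive_kernel E X K by fact
  interpret L: positive_kernel E Y L by fact
  have val: "f (\<sigma> z) \<in> vecs E" if "f \<in> vecs (rkhs Y L E)" "z \<in> X" for f z
    using L.rkhs_functions[OF that(1)] that(2) \<sigma> by (auto simp: functions_on_def)
  have zero: "vscale E c (vzero E) = vzero E" "vadd E (vzero E) (vzero E) = vzero E" for c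
    using K.E.scale_scale[of "vzero E" c 0] K.E.scale_zero[of "vzero E"] by (simp_all add: K.E.add_zero)
  show ?thesis
    unfolding linear_op_def using weighted_composition_in(1)[OF K L \<sigma> C D] val zero
    by (auto simp: fun_eq_iff K.E.scale_add_right K.E.scale_scale mult.commute)
qed

locale scalar_kernel = positive_kernel complex_line X K for X :: "'x set" and K +
  fixes H :: "('x \<Rightarrow> complex) hspace"
  assumes H_eq: "H = rkhs X K complex_line"
begin

lemma ops:
  "vadd H = (\<lambda>f g z. f z + g z)" "vzero H = (\<lambda>z. 0)" "vscale H = (\<lambda>c f z. c * f z)"
  by (simp_all add: H_eq)

sublocale hilbert_space H
  using rkhs_hilbert_space by (simp add: H_eq)

definition kf :: "'x \<Rightarrow> 'x \<Rightarrow> complex" where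
  "kf w = (\<lambda>z. if z \<in> X then K z w else 0)"

lemma kf_in [simp]: "w \<in> X \<Longrightarrow> kf w \<in> vecs H"
  using rkhs_kernel_fun(1)[of w 1] by (simp add: H_eq kernel_fun_def kf_def cong: if_cong)

lemma inner_kf [simp]:
  assumes "w \<in> X" "f \<in> vecs H"
  shows "vinner H f (kf w) = f w" and "vinner H (kf w) f = cnj (f w)"
proof -
  show *: "vinner H f (kf w) = f w"
    using rkhs_kernel_fun(2)[of w 1 f] assms by (simp add: H_eq kernel_fun_def kf_def cong: if_cong)
  show "vinner H (kf w) f = cnj (f w)"
    using inner_commute[of f "kf w"] assms * by simp
qed

lemma off_zero: "f \<in> vecs H \<Longrightarrow> z \<notin> X \<Longrightarrow> f z = 0"
  using rkhs_functions[of f] by (auto simp: H_eq functions_on_def)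

lemma fun_eqI: "f \<in> vecs H \<Longrightarrow> g \<in> vecs H \<Longrightarrow> (\<And>z. z \<in> X \<Longrightarrow> f z = g z) \<Longrightarrow> f = g"
  using off_zero by (metis ext)

lemma total_kf: "total (kf ` X)"
  unfolding total_def
proof (intro conjI ballI impI)
  fix f assume f: "f \<in> vecs H" and "\<forall>s\<in>kf ` X. vinner H f s = 0"
  then have "f z = 0" for z using f off_zero[OF f, of z] by (cases "z \<in> X") auto
  then show "f = vzero H" by (auto simp: ops)
qed auto

lemma eval_bounded: "w \<in> X \<Longrightarrow> f \<in> vecs H \<Longrightarrow> cmod (f w) \<le> vnorm H (kf w) * vnorm H f"
  using cauchy_schwarz[of f "kf w"] by (simp add: mult.commute)

lemma add_at: "vadd H f g z = f z + g z" and scale_at: "vscale H c f z = c * f z" and zero_at: "vzero H z = 0"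
  by (simp_all add: ops)

text \<open>By Cauchy-Schwarz a function of the space is dominated by the kernel. In this form
  domination is multiplicative, which is how products of functions of different variables are
  bounded.\<close>

lemma positive_kernel_minus_function:
  assumes f: "f \<in> vecs H"
  shows "positive_kernel complex_line X (\<lambda>z w. of_real ((vnorm H f)\<^sup>2) * K z w - f z * cnj (f w))"
proof (rule positive_kernelI)
  show "hilbert_space complex_line" by (rule hilbert_complex_line)
  show "of_real ((vnorm H f)\<^sup>2) * K w z - f w * cnj (f z) =
      cnj (of_real ((vnorm H f)\<^sup>2) * K z w - f z * cnj (f w))" if "z \<in> X" "w \<in> X" for z w
    unfolding hermitian[OF that] by simp
  fix p :: "('x \<times> complex) list" assume p: "p \<in> nodes X complex_line"
  have "kernel_gram (\<lambda>z w. f z * cnj (f w)) complex_line q p = cnj (pairing f q) * pairing f p" for q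
  proof (induction q)
    case (Cons a q)
    have "(\<Sum>(v, \<zeta>)\<leftarrow>p. f v * cnj (f (fst a)) * (snd a * cnj \<zeta>)) = cnj (f (fst a) * cnj (snd a)) * pairing f p"
      by (induction p) (simp_all add: case_prod_unfold kernel_pairing_def algebra_simps)
    with Cons show ?case
      by (simp add: kernel_gram_def kernel_pairing_def case_prod_unfold algebra_simps)
  qed simp
  then have "kernel_gram (\<lambda>z w. f z * cnj (f w)) complex_line p p = of_real ((cmod (pairing f p))\<^sup>2)"
    unfolding complex_norm_square by (simp only: mult.commute)
  moreover have "(cmod (pairing f p))\<^sup>2 \<le> (vnorm H f * gnorm p)\<^sup>2"
    using rkhs_pairing_le[of f p] f p by (intro power_mono) (auto simp: H_eq)
  ultimately show "0 \<le> Re (kernel_gram (\<lambda>z w. of_real ((vnorm H f)\<^sup>2) * K z w - f z * cnj (f w)) complex_line p p)"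
    using p gnorm_sq[OF p] by (simp only: kernel_gram_minus kernel_gram_mult)
      (simp add: power_mult_distrib del: of_real_power)
qed

end

lemma weighted_composition:
  assumes K: "scalar_kernel X K H" and L: "scalar_kernel Y L G" and \<sigma>: "\<sigma> ` X \<subseteq> Y" and C: "0 \<le> C"
    and D: "positive_kernel complex_line X (\<lambda>z w. of_real (C\<^sup>2) * K z w - \<psi> z * cnj (\<psi> w) * L (\<sigma> z) (\<sigma> w))"
  defines "W \<equiv> \<lambda>f z. if z \<in> X then \<psi> z * f (\<sigma> z) else 0"
  shows "linear_op G H W" and "f \<in> vecs G \<Longrightarrow> vnorm H (W f) \<le> C * vnorm G f"
proof -
  interpret K: scalar_kernel X K H by fact
  interpret L: scalar_kernel Y L G by fact
  have W: "W = (\<lambda>f z. if z \<in> X then vscale complex_line (\<psi> z) (f (\<sigma> z)) else vzero complex_line)"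
    by (simp add: W_def cong: if_cong)
  note ax = K.positive_kernel_axioms L.positive_kernel_axioms \<sigma> C D
  show "linear_op G H W" unfolding W L.H_eq K.H_eq by (rule weighted_composition_linear[OF ax])
  show "f \<in> vecs G \<Longrightarrow> vnorm H (W f) \<le> C * vnorm G f"
    unfolding W L.H_eq K.H_eq by (rule weighted_composition_in(2)[OF ax])
qed

lemma linear_op_cong:
  assumes "inner_product_space H" and "\<And>x. x \<in> vecs H \<Longrightarrow> T x = T' x"
  shows "linear_op H G T \<longleftrightarrow> linear_op H G T'"
proof -
  interpret inner_product_space H by fact
  show ?thesis unfolding linear_op_def using assms(2) by auto
qed

lemma linear_op_comp: "linear_op H G T \<Longrightarrow> linear_op G F S \<Longrightarrow> linear_op H F (\<lambda>x. S (T x))"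
  by (auto simp: linear_op_def)

lemma adj_bounded_op:
  assumes "hilbert_space H" and "hilbert_space G" and T: "bounded_op H G T"
  shows "bounded_op G H (adj H G T)"
proof -
  interpret H: hilbert_space H by fact
  interpret G: hilbert_space G by fact
  note p = adj_props[OF H.hilbert_space_axioms G.inner_product_space_axioms T]
  obtain C where C: "\<And>x. x \<in> vecs H \<Longrightarrow> vnorm G (T x) \<le> C * vnorm H x" and lin: "linear_op H G T"
    using T by (auto simp: bounded_op_def)
  have Tc: "x \<in> vecs H \<Longrightarrow> T x \<in> vecs G" for x using lin by (auto simp: linear_op_def)
  have "vnorm G (T x) \<le> \<bar>C\<bar> * vnorm H x" if "x \<in> vecs H" for x
    using C[OF that] mult_right_mono[of C "\<bar>C\<bar>" "vnorm H x"] H.norm_nonneg[OF that] by linarith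
  from adj_norm_le[OF H.hilbert_space_axioms G.inner_product_space_axioms lin _ this]
  have bound: "y \<in> vecs G \<Longrightarrow> vnorm H (adj H G T y) \<le> \<bar>C\<bar> * vnorm G y" for y by simp
  have "adj H G T (vadd G x y) = vadd H (adj H G T x) (adj H G T y)" if "x \<in> vecs G" "y \<in> vecs G" for x y
    by (rule adj_eqI[OF H.inner_product_space_axioms]) (use that p Tc in auto)
  moreover have "adj H G T (vscale G c x) = vscale H c (adj H G T x)" if "x \<in> vecs G" for c x
    by (rule adj_eqI[OF H.inner_product_space_axioms]) (use that p Tc in auto)
  ultimately show ?thesis
    unfolding bounded_op_def linear_op_def using p(1) bound by blast
qed

text \<open>The reproducing property turns the adjoint of a weighted composition into the motion of
  nodes.\<close>

lemma adj_weighted_composition_kf: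
  assumes K: "scalar_kernel X K H" and L: "scalar_kernel Y L G" and \<sigma>: "\<sigma> ` X \<subseteq> Y"
    and W: "linear_op G H W" "\<And>f z. f \<in> vecs G \<Longrightarrow> z \<in> X \<Longrightarrow> W f z = \<psi> z * f (\<sigma> z)" and w: "w \<in> X"
  shows "adj G H W (scalar_kernel.kf X K w) = vscale G (cnj (\<psi> w)) (scalar_kernel.kf Y L (\<sigma> w))"
proof -
  interpret K: scalar_kernel X K H by fact
  interpret L: scalar_kernel Y L G by fact
  have \<sigma>w: "\<sigma> w \<in> Y" using \<sigma> w by blast
  show ?thesis
  proof (rule adj_eqI[OF L.inner_product_space_axioms])
    fix u assume u: "u \<in> vecs G"
    then have "W u \<in> vecs H" using W(1) by (auto simp: linear_op_def)
    then show "vinner H (W u) (K.kf w) = vinner G u (vscale G (cnj (\<psi> w)) (L.kf (\<sigma> w)))"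
      using u w \<sigma>w W(2)[OF u w] by simp
  qed (use \<sigma>w in simp)
qed

lemma shift_contraction:
  assumes K: "scalar_kernel X K H"
    and D: "positive_kernel complex_line X (\<lambda>z w. (1 - \<phi> z * cnj (\<phi> w)) * K z w)"
    and M: "\<And>f z. f \<in> vecs H \<Longrightarrow> M f z = \<phi> z * f z"
  shows "linear_op H H M" and "f \<in> vecs H \<Longrightarrow> vnorm H (M f) \<le> vnorm H f"
proof -
  interpret K: scalar_kernel X K H by fact
  have M': "M f = (\<lambda>z. if z \<in> X then \<phi> z * f z else 0)" if "f \<in> vecs H" for f
    using M[OF that] K.off_zero[OF that] by auto
  have "positive_kernel complex_line X (\<lambda>z w. of_real (1\<^sup>2) * K z w - \<phi> z * cnj (\<phi> w) * K (id z) (id w))"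
    using D by (simp add: left_diff_distrib)
  note W = weighted_composition[where \<sigma> = id and \<psi> = \<phi> and C = 1, OF K K _ _ this]
  show "linear_op H H M"
  proof (rule iffD2[OF linear_op_cong[OF K.inner_product_space_axioms M']])
    show "linear_op H H (\<lambda>f z. if z \<in> X then \<phi> z * f z else 0)" using W(1) by (simp cong: if_cong)
  qed
  show "vnorm H (M f) \<le> vnorm H f" if "f \<in> vecs H"
    unfolding M'[OF that] using W(2)[OF _ _ that] by (simp cong: if_cong)
qed

section \<open>Weighted Bergman spaces\<close>

interpretation disc: scalar_kernel unit_disc "bergman_kernel k" "bergman k" for k
proof -
  have "positive_kernel complex_line unit_disc (\<lambda>z w. 1 * bergman_kernel k (id z) (id w))"
    by (intro positive_kernel_bergman_factor positive_kernel_one hilbert_complex_line) auto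
  then show "scalar_kernel unit_disc (bergman_kernel k) (bergman k)"
    by (simp add: scalar_kernel_def scalar_kernel_axioms_def bergman_vec_def)
qed

lemma bergman_kernel_shift:
  assumes "k \<ge> 1" "z \<in> unit_disc" "w \<in> unit_disc"
  shows "(1 - z * cnj w) * bergman_kernel k z w = bergman_kernel (k - 1) z w"
  using assms disc_kernel_nonzero[of z w]
  by (cases k) (auto simp: bergman_kernel_def)

text \<open>For \<open>k \<ge> 1\<close> the kernel \<open>(1 - z w\<^sup>*) B\<^sub>k(z,w)\<close> is again a Bergman kernel, of index \<open>k - 1\<close>,
  and hence positive.\<close>

lemma mult_z_contraction:
  assumes "k \<ge> 1"
  shows "linear_op (bergman k) (bergman k) mult_z"
    and "f \<in> vecs (bergman k) \<Longrightarrow> vnorm (bergman k) (mult_z f) \<le> vnorm (bergman k) f"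
proof -
  have "positive_kernel complex_line unit_disc (\<lambda>z w. (1 - id z * cnj (id w)) * bergman_kernel k z w)"
    by (rule positive_kernel_cong[OF disc.positive_kernel_axioms[of "k - 1"]])
      (use bergman_kernel_shift assms in simp)
  note * = shift_contraction[OF disc.scalar_kernel_axioms this, of mult_z]
  show "linear_op (bergman k) (bergman k) mult_z"
    and "f \<in> vecs (bergman k) \<Longrightarrow> vnorm (bergman k) (mult_z f) \<le> vnorm (bergman k) f"
    using * by (auto simp: mult_z_def)
qed

lemma bounded_mult_z: "k \<ge> 1 \<Longrightarrow> bounded_op (bergman k) (bergman k) mult_z"
  using mult_z_contraction unfolding bounded_op_def by (metis mult_1)

abbreviation shift_adj :: "nat \<Rightarrow> (complex \<Rightarrow> complex) \<Rightarrow> complex \<Rightarrow> complex" where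
  "shift_adj k \<equiv> adj (bergman k) (bergman k) mult_z"

definition poly_kernel :: "nat \<Rightarrow> (nat \<Rightarrow> nat) \<Rightarrow> (nat \<Rightarrow> complex) \<Rightarrow> (nat \<Rightarrow> complex) \<Rightarrow> complex" where
  "poly_kernel n m z w = (\<Prod>i=1..n. bergman_kernel (m i) (z i) (w i))"

lemma polydiscD: "z \<in> polydisc n \<Longrightarrow> i \<in> {1..n} \<Longrightarrow> z i \<in> unit_disc"
  unfolding polydisc_def by (rule PiE_mem)

interpretation poly: scalar_kernel "polydisc n" "poly_kernel n m" "bergman_poly n m" for n m
proof -
  have "positive_kernel complex_line (polydisc n)
      (\<lambda>z w. 1 * (\<Prod>i\<in>{1..n}. bergman_kernel (m i) (z i) (w i)))"
    by (intro positive_kernel_bergman_prod positive_kernel_one hilbert_complex_line) (auto dest: polydiscD)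
  then have "positive_kernel complex_line (polydisc n) (poly_kernel n m)"
    by (simp add: poly_kernel_def[abs_def])
  then show "scalar_kernel (polydisc n) (poly_kernel n m) (bergman_poly n m)"
    by (simp add: scalar_kernel_def scalar_kernel_axioms_def bergman_poly_def poly_kernel_def[abs_def])
qed

locale bergman_tuple =
  fixes n :: nat and m :: "nat \<Rightarrow> nat"
  assumes n_pos: "n \<ge> 1" and m_pos: "j \<in> {1..n} \<Longrightarrow> m j \<ge> 1"
begin

abbreviation "H \<equiv> bergman_poly n m"
abbreviation "A i \<equiv> bergman (m i)"
abbreviation "M \<equiv> mult_coord"
abbreviation "kf \<equiv> poly.kf n m"

text \<open>The adjoint shifts, whose common invariant subspaces are the quotient modules.\<close>

definition S :: "nat \<Rightarrow> ((nat \<Rightarrow> complex) \<Rightarrow> complex) \<Rightarrow> (nat \<Rightarrow> complex) \<Rightarrow> complex" where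
  "S i = adj H H (M i)"

lemma poly_kernel_split:
  assumes "i \<in> {1..n}"
  shows "poly_kernel n m z w = bergman_kernel (m i) (z i) (w i) * (\<Prod>j\<in>{1..n}-{i}. bergman_kernel (m j) (z j) (w j))"
  unfolding poly_kernel_def using assms by (subst prod.remove[of _ i]) auto

lemma positive_kernel_rest:
  assumes "positive_kernel complex_line (polydisc n) L"
  shows "positive_kernel complex_line (polydisc n) (\<lambda>z w. L z w * (\<Prod>j\<in>{1..n}-{i}. bergman_kernel (m j) (z j) (w j)))"
  by (intro positive_kernel_bergman_prod assms) (auto dest: polydiscD)

lemma mult_coord_contraction:
  assumes i: "i \<in> {1..n}"
  shows "linear_op H H (M i)" and "f \<in> vecs H \<Longrightarrow> vnorm H (M i f) \<le> vnorm H f"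
proof -
  have "positive_kernel complex_line (polydisc n) (\<lambda>z w. 1 * bergman_kernel (m i - 1) (z i) (w i))"
    by (intro positive_kernel_bergman_factor positive_kernel_one hilbert_complex_line) (use i in \<open>auto dest: polydiscD\<close>)
  from positive_kernel_rest[OF this, of i]
  have "positive_kernel complex_line (polydisc n) (\<lambda>z w. (1 - z i * cnj (w i)) * poly_kernel n m z w)"
  proof (rule positive_kernel_cong)
    fix z w assume "z \<in> polydisc n" "w \<in> polydisc n"
    then show "(1 - z i * cnj (w i)) * poly_kernel n m z w = 1 * bergman_kernel (m i - 1) (z i) (w i) *
        (\<Prod>j\<in>{1..n}-{i}. bergman_kernel (m j) (z j) (w j))"
      using bergman_kernel_shift[OF m_pos[OF i], of "z i" "w i"] i polydiscD[of z n i] polydiscD[of w n i]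
      by (simp only: poly_kernel_split[OF i] mult.assoc[symmetric]) simp
  qed
  note * = shift_contraction[OF poly.scalar_kernel_axioms this, of "M i"]
  show "linear_op H H (M i)" and "f \<in> vecs H \<Longrightarrow> vnorm H (M i f) \<le> vnorm H f"
    using * by (auto simp: mult_coord_def)
qed

lemma bounded_M: "i \<in> {1..n} \<Longrightarrow> bounded_op H H (M i)"
  using mult_coord_contraction unfolding bounded_op_def by (metis mult_1)

lemma M_in [simp]: "i \<in> {1..n} \<Longrightarrow> f \<in> vecs H \<Longrightarrow> M i f \<in> vecs H"
  using mult_coord_contraction(1) by (auto simp: linear_op_def)

lemma S_in [simp]: "i \<in> {1..n} \<Longrightarrow> f \<in> vecs H \<Longrightarrow> S i f \<in> vecs H"
  and S_inner: "i \<in> {1..n} \<Longrightarrow> f \<in> vecs H \<Longrightarrow> g \<in> vecs H \<Longrightarrow> vinner H (M i f) g = vinner H f (S i g)"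
  using adj_props[OF poly.hilbert_space_axioms poly.inner_product_space_axioms bounded_M]
  by (auto simp: S_def)

lemma S_inner': "i \<in> {1..n} \<Longrightarrow> f \<in> vecs H \<Longrightarrow> g \<in> vecs H \<Longrightarrow> vinner H (S i f) g = vinner H f (M i g)"
  using S_inner[of i g f] poly.inner_commute[of "M i g" n m f] poly.inner_commute[of g n m "S i f"] by simp

lemma S_norm: "i \<in> {1..n} \<Longrightarrow> f \<in> vecs H \<Longrightarrow> vnorm H (S i f) \<le> vnorm H f"
  using adj_norm_le[OF poly.hilbert_space_axioms poly.inner_product_space_axioms mult_coord_contraction(1), where C = 1 and y = f]
    mult_coord_contraction(2) by (simp add: S_def)

lemma bounded_S: "i \<in> {1..n} \<Longrightarrow> bounded_op H H (S i)"
  unfolding S_def by (intro adj_bounded_op poly.hilbert_space_axioms bounded_M)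

lemma S_linear:
  assumes "i \<in> {1..n}" "f \<in> vecs H"
  shows "g \<in> vecs H \<Longrightarrow> S i (vadd H f g) = vadd H (S i f) (S i g)" and "S i (vscale H c f) = vscale H c (S i f)"
  using bounded_S[OF assms(1)] assms(2) by (auto simp: bounded_op_def linear_op_def)

lemma S_commute:
  assumes "i \<in> {1..n}" "j \<in> {1..n}" "f \<in> vecs H"
  shows "S i (S j f) = S j (S i f)"
proof (rule poly.eq_by_inner)
  fix g assume g: "g \<in> vecs H"
  have "M j (M i g) = M i (M j g)" by (auto simp: mult_coord_def)
  then show "vinner H (S i (S j f)) g = vinner H (S j (S i f)) g"
    using assms g by (simp add: S_inner')
qed (use assms in auto)

lemma S_kf: "i \<in> {1..n} \<Longrightarrow> w \<in> polydisc n \<Longrightarrow> S i (kf w) = vscale H (cnj (w i)) (kf w)"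
  unfolding S_def using mult_coord_contraction(1)
  by (subst adj_weighted_composition_kf[OF poly.scalar_kernel_axioms poly.scalar_kernel_axioms, of id n n m m _ "\<lambda>z. z i"])
    (auto simp: mult_coord_def)

lemma S_pow_in [simp]: "i \<in> {1..n} \<Longrightarrow> f \<in> vecs H \<Longrightarrow> (S i ^^ k) f \<in> vecs H"
  by (induction k) auto

lemma S_pow_kf: "i \<in> {1..n} \<Longrightarrow> w \<in> polydisc n \<Longrightarrow> (S i ^^ k) (kf w) = vscale H (cnj (w i) ^ k) (kf w)"
  by (induction k) (auto simp: poly.scale_one poly.scale_scale S_kf S_linear mult.commute)

section \<open>Setting coordinates to zero\<close>

definition zero_coords :: "nat set \<Rightarrow> (nat \<Rightarrow> complex) \<Rightarrow> nat \<Rightarrow> complex" where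
  "zero_coords I z = (\<lambda>i. if i \<in> I then 0 else z i)"

text \<open>The orthogonal projection onto the functions that do not depend on the variables in \<open>I\<close>.\<close>

definition Z :: "nat set \<Rightarrow> ((nat \<Rightarrow> complex) \<Rightarrow> complex) \<Rightarrow> (nat \<Rightarrow> complex) \<Rightarrow> complex" where
  "Z I f = (\<lambda>z. if z \<in> polydisc n then f (zero_coords I z) else 0)"

lemma zero_coords_in [simp]: "I \<subseteq> {1..n} \<Longrightarrow> z \<in> polydisc n \<Longrightarrow> zero_coords I z \<in> polydisc n"
  unfolding polydisc_def zero_coords_def by (auto simp: PiE_iff extensional_def)

lemma zero_coords_insert: "zero_coords (insert i I) z = zero_coords I (zero_coords {i} z)"
  by (auto simp: zero_coords_def)

lemma bergman_kernel_zero [simp]: "bergman_kernel k 0 w = 1" "bergman_kernel k z 0 = 1"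
  by (simp_all add: bergman_kernel_def)

lemma poly_kernel_zero_coords:
  "poly_kernel n m (zero_coords I z) w = poly_kernel n m z (zero_coords I w)"
  unfolding poly_kernel_def by (intro prod.cong) (auto simp: zero_coords_def)

lemma bounded_Z_single:
  assumes i: "i \<in> {1..n}"
  shows "bounded_op H H (Z {i})"
proof -
  have "positive_kernel complex_line (polydisc n) (\<lambda>z w. 1 * (bergman_kernel (m i) (z i) (w i) - 1))"
    by (intro positive_kernel_bergman_minus_one positive_kernel_one hilbert_complex_line) (use i in \<open>auto dest: polydiscD\<close>)
  from positive_kernel_rest[OF this, of i]
  have D: "positive_kernel complex_line (polydisc n) (\<lambda>z w. of_real (1\<^sup>2) * poly_kernel n m z w -
      1 * cnj 1 * poly_kernel n m (zero_coords {i} z) (zero_coords {i} w))"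
  proof (rule positive_kernel_cong)
    fix z w
    have "(\<Prod>j\<in>{1..n}-{i}. bergman_kernel (m j) (zero_coords {i} z j) (zero_coords {i} w j)) =
        (\<Prod>j\<in>{1..n}-{i}. bergman_kernel (m j) (z j) (w j))"
      by (intro prod.cong) (auto simp: zero_coords_def)
    moreover have "bergman_kernel (m i) (zero_coords {i} z i) (zero_coords {i} w i) = 1"
      by (simp add: zero_coords_def)
    ultimately show "of_real (1\<^sup>2) * poly_kernel n m z w -
        1 * cnj 1 * poly_kernel n m (zero_coords {i} z) (zero_coords {i} w) =
      1 * (bergman_kernel (m i) (z i) (w i) - 1) * (\<Prod>j\<in>{1..n}-{i}. bergman_kernel (m j) (z j) (w j))"
      by (simp add: poly_kernel_split[OF i] left_diff_distrib)
  qed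
  have "zero_coords {i} ` polydisc n \<subseteq> polydisc n" using i by auto
  from weighted_composition[where \<sigma> = "zero_coords {i}" and \<psi> = "\<lambda>_. 1" and C = 1,
      OF poly.scalar_kernel_axioms poly.scalar_kernel_axioms this _ D]
  show ?thesis
    unfolding bounded_op_def Z_def by (intro conjI exI[of _ 1]) (auto cong: if_cong)
qed

lemma Z_insert: "I \<subseteq> {1..n} \<Longrightarrow> i \<in> {1..n} \<Longrightarrow> Z (insert i I) f = Z {i} (Z I f)"
  unfolding Z_def by (subst zero_coords_insert) (auto cong: if_cong)

lemma Z_empty: "f \<in> vecs H \<Longrightarrow> Z {} f = f"
  using poly.off_zero[of f n m] by (auto simp: Z_def zero_coords_def)

lemma Z_single_in [simp]: "i \<in> {1..n} \<Longrightarrow> f \<in> vecs H \<Longrightarrow> Z {i} f \<in> vecs H"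
  using bounded_Z_single by (auto simp: bounded_op_def linear_op_def)

text \<open>On kernel functions both \<open>Z\<close> and its adjoint replace the \<open>i\<close>-th coordinate of the node by
  zero.\<close>

lemma Z_single_symmetric:
  assumes i: "i \<in> {1..n}" and f: "f \<in> vecs H" and g: "g \<in> vecs H"
  shows "vinner H (Z {i} f) g = vinner H f (Z {i} g)"
proof -
  have "adj H H (Z {i}) g = Z {i} g"
  proof (rule ops_eq_on_total[where T = "adj H H (Z {i})" and T' = "Z {i}",
        OF poly.hilbert_space_axioms poly.inner_product_space_axioms poly.total_kf])
    fix s assume "s \<in> poly.kf n m ` polydisc n"
    then obtain w where w: "w \<in> polydisc n" "s = kf w" by auto
    have zw: "zero_coords {i} w \<in> polydisc n" using w i by simp
    have "adj H H (Z {i}) s = kf (zero_coords {i} w)"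
    proof (rule adj_eqI[OF poly.inner_product_space_axioms])
      fix u assume u: "u \<in> vecs H"
      show "vinner H (Z {i} u) s = vinner H u (kf (zero_coords {i} w))"
        unfolding w(2) poly.inner_kf(1)[OF w(1) Z_single_in[OF i u]] poly.inner_kf(1)[OF zw u]
        using w(1) by (simp add: Z_def)
    qed (use zw in simp)
    also have "\<dots> = Z {i} s"
      using w(1) zero_coords_in[of "{i}"] i
      by (simp add: w(2) poly.kf_def Z_def poly_kernel_zero_coords fun_eq_iff)
    finally show "adj H H (Z {i}) s = Z {i} s" .
  next
    show "bounded_op H H (adj H H (Z {i}))"
      by (intro adj_bounded_op poly.hilbert_space_axioms bounded_Z_single i)
  qed (rule bounded_Z_single[OF i], rule g)
  with adj_props(2)[OF poly.hilbert_space_axioms poly.inner_product_space_axioms bounded_Z_single[OF i] g f]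
  show ?thesis by (simp only:)
qed

lemma Z_props:
  assumes "I \<subseteq> {1..n}" and "f \<in> vecs H"
  shows "Z I f \<in> vecs H" and "g \<in> vecs H \<Longrightarrow> vinner H (Z I f) g = vinner H f (Z I g)"
    and "l \<in> {1..n} - I \<Longrightarrow> Z I (S l f) = S l (Z I f)"
proof -
  have "finite I" using assms(1) finite_subset by blast
  then have *: "\<forall>f\<in>vecs H. Z I f \<in> vecs H \<and> (\<forall>g\<in>vecs H. vinner H (Z I f) g = vinner H f (Z I g))"
    using assms(1)
  proof induction
    case empty then show ?case by (simp add: Z_empty)
  next
    case (insert i I)
    have i: "i \<in> {1..n}" and I: "I \<subseteq> {1..n}" using insert.prems by auto
    have com: "Z {i} (Z I f) = Z I (Z {i} f)" for f
    proof
      fix z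
      have "zero_coords I (zero_coords {i} z) = zero_coords {i} (zero_coords I z)"
        by (auto simp: zero_coords_def)
      then show "Z {i} (Z I f) z = Z I (Z {i} f) z"
        using zero_coords_in[OF I, of z] zero_coords_in[of "{i}" z] i by (simp add: Z_def)
    qed
    show ?case
      unfolding Z_insert[OF I i]
    proof (intro ballI conjI)
      fix f assume f: "f \<in> vecs H"
      show fi: "Z {i} (Z I f) \<in> vecs H" using insert.IH[OF I] f i by simp
      fix g assume g: "g \<in> vecs H"
      have "vinner H (Z {i} (Z I f)) g = vinner H f (Z I (Z {i} g))"
        using insert.IH[OF I] f g i by (simp add: Z_single_symmetric)
      then show "vinner H (Z {i} (Z I f)) g = vinner H f (Z {i} (Z I g))" by (simp add: com)
    qed
  qed
  then show in': "Z I f \<in> vecs H" and sym: "g \<in> vecs H \<Longrightarrow> vinner H (Z I f) g = vinner H f (Z I g)"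
    using assms by auto
  show "Z I (S l f) = S l (Z I f)" if l: "l \<in> {1..n} - I"
  proof (rule poly.eq_by_inner)
    fix g assume g: "g \<in> vecs H"
    have "Z I (M l g) = M l (Z I g)"
      using l by (auto simp: Z_def mult_coord_def zero_coords_def)
    then show "vinner H (Z I (S l f)) g = vinner H (S l (Z I f)) g"
      using assms * l g by (simp add: S_inner')
  qed (use assms * l in auto)
qed

lemma bounded_scalar_sum:
  assumes "finite J" and "\<And>j. j \<in> J \<Longrightarrow> bounded_op G complex_line (T j)"
  shows "bounded_op G complex_line (\<lambda>x. \<Sum>j\<in>J. T j x)"
proof -
  have "\<forall>j\<in>J. \<exists>C. \<forall>x\<in>vecs G. cmod (T j x) \<le> C * vnorm G x"
    using assms(2) by (auto simp: bounded_op_def)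
  then obtain C where C: "\<And>j x. j \<in> J \<Longrightarrow> x \<in> vecs G \<Longrightarrow> cmod (T j x) \<le> C j * vnorm G x" by metis
  have "cmod (\<Sum>j\<in>J. T j x) \<le> (\<Sum>j\<in>J. C j) * vnorm G x" if "x \<in> vecs G" for x
    unfolding sum_distrib_right using C that by (intro sum_norm_le) auto
  then show ?thesis
    using assms(2) by (auto simp: bounded_op_def linear_op_def sum.distrib sum_distrib_left)
qed

text \<open>On kernel functions \<open>S\<^sub>i\<close> is multiplication by the conjugate of \<open>w\<^sub>i\<close>, so the sum is a
  binomial expansion of \<open>(1 - z\<^sub>i w\<^sub>i\<^sup>*)\<^sup>m\<close>, which cancels the \<open>i\<close>-th factor of the kernel just
  as setting \<open>z\<^sub>i\<close> to zero does.\<close>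

lemma Z_single_hereditary:
  assumes i: "i \<in> {1..n}" and f: "f \<in> vecs H" and z: "z \<in> polydisc n"
  shows "Z {i} f z = (\<Sum>k\<le>m i. of_nat (m i choose k) * (- z i) ^ k * (S i ^^ k) f z)"
proof (rule ops_eq_on_total[where T = "\<lambda>f. Z {i} f z" and G = complex_line and
      T' = "\<lambda>f. \<Sum>k\<le>m i. of_nat (m i choose k) * (- z i) ^ k * (S i ^^ k) f z",
      OF poly.hilbert_space_axioms _ poly.total_kf])
  show "inner_product_space complex_line" using hilbert_complex_line by (simp add: hilbert_space_def)
  show "f \<in> vecs H" by fact
  have Sk: "vnorm H ((S i ^^ k) f) \<le> vnorm H f" if "f \<in> vecs H" for f k
  proof (induction k)
    case (Suc k)
    then show ?case using S_norm[OF i S_pow_in[OF i that], of k] by simp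
  qed simp
  have Sadd: "(S i ^^ k) (vadd H f g) = vadd H ((S i ^^ k) f) ((S i ^^ k) g)" if "f \<in> vecs H" "g \<in> vecs H" for f g k
    using that i by (induction k) (auto simp: S_linear)
  have Sscale: "(S i ^^ k) (vscale H c f) = vscale H c ((S i ^^ k) f)" if "f \<in> vecs H" for f c k
    using that i by (induction k) (auto simp: S_linear)
  have bounded: "bounded_op H complex_line (\<lambda>f. c * (S i ^^ k) f z)" for c k
    unfolding bounded_op_def linear_op_def
  proof (intro conjI exI ballI allI)
    fix f assume f: "f \<in> vecs H"
    have "cmod ((S i ^^ k) f z) \<le> vnorm H (kf z) * vnorm H f"
      using poly.eval_bounded[OF z S_pow_in[OF i f, of k]] Sk[OF f, of k] z
        mult_left_mono[OF Sk[OF f, of k], of "vnorm H (kf z)"] by simp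
    then show "vnorm complex_line (c * (S i ^^ k) f z) \<le> (cmod c * vnorm H (kf z)) * vnorm H f"
      by (simp add: norm_mult mult.assoc mult_left_mono)
  qed (auto simp: Sadd Sscale poly.add_at poly.scale_at algebra_simps)
  show "bounded_op H complex_line (\<lambda>f. \<Sum>k\<le>m i. of_nat (m i choose k) * (- z i) ^ k * (S i ^^ k) f z)"
    by (intro bounded_scalar_sum bounded) simp
  have "bounded_op H complex_line (\<lambda>f. Z {i} f z)"
    unfolding bounded_op_def linear_op_def
  proof (intro conjI exI ballI allI)
    fix f assume f: "f \<in> vecs H"
    show "vnorm complex_line (Z {i} f z) \<le> vnorm H (kf (zero_coords {i} z)) * vnorm H f"
      using poly.eval_bounded[OF zero_coords_in[OF _ z] f, of "{i}"] i z by (simp add: Z_def)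
  qed (use z in \<open>auto simp: Z_def poly.add_at poly.scale_at\<close>)
  then show "bounded_op H complex_line (\<lambda>f. Z {i} f z)" .
  fix s assume "s \<in> poly.kf n m ` polydisc n"
  then obtain w where w: "w \<in> polydisc n" "s = kf w" by auto
  have nz: "1 - z i * cnj (w i) \<noteq> 0"
    using disc_kernel_nonzero polydiscD z w i by blast
  have Sz: "(S i ^^ k) s z = cnj (w i) ^ k * poly_kernel n m z w" for k
    unfolding w(2) S_pow_kf[OF i w(1)] poly.scale_at using z by (simp add: poly.kf_def)
  have "(\<Sum>k\<le>m i. of_nat (m i choose k) * (- z i) ^ k * (S i ^^ k) s z) =
      (\<Sum>k\<le>m i. of_nat (m i choose k) * (- (z i * cnj (w i))) ^ k * 1 ^ (m i - k)) * poly_kernel n m z w"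
    unfolding sum_distrib_right
    by (intro sum.cong refl)
      (simp add: Sz power_mult_distrib power_minus[of "z i"] power_minus[of "z i * _"])
  also have "\<dots> = (1 - z i * cnj (w i)) ^ m i * poly_kernel n m z w"
    using binomial_ring[of "- (z i * cnj (w i))" 1 "m i"] by simp
  also have "\<dots> = poly_kernel n m (zero_coords {i} z) w"
  proof -
    have "(\<Prod>j\<in>{1..n}-{i}. bergman_kernel (m j) (zero_coords {i} z j) (w j)) =
        (\<Prod>j\<in>{1..n}-{i}. bergman_kernel (m j) (z j) (w j))"
      by (intro prod.cong) (auto simp: zero_coords_def)
    moreover have "bergman_kernel (m i) (zero_coords {i} z i) (w i) = 1" by (simp add: zero_coords_def)
    ultimately show ?thesis
      using nz by (simp add: poly_kernel_split[OF i] bergman_kernel_def)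
  qed
  finally show "Z {i} s z = (\<Sum>k\<le>m i. of_nat (m i choose k) * (- z i) ^ k * (S i ^^ k) s z)"
    using w z i by (simp add: Z_def poly.kf_def)
qed

end

context bergman_tuple
begin

section \<open>Restriction to the axes and elementary tensors\<close>

definition axis :: "nat \<Rightarrow> complex \<Rightarrow> nat \<Rightarrow> complex" where
  "axis i a = (\<lambda>j\<in>{1..n}. if j = i then a else 0)"

definition R :: "nat \<Rightarrow> ((nat \<Rightarrow> complex) \<Rightarrow> complex) \<Rightarrow> complex \<Rightarrow> complex" where
  "R i f = (\<lambda>a. if a \<in> unit_disc then f (axis i a) else 0)"

abbreviation "et \<equiv> elementary_tensor n"
abbreviation "kd i \<equiv> disc.kf (m i)"

lemma axis_in [simp]: "a \<in> unit_disc \<Longrightarrow> axis i a \<in> polydisc n"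
  by (auto simp: axis_def polydisc_def)

lemma poly_kernel_axis:
  assumes "i \<in> {1..n}"
  shows "poly_kernel n m (axis i a) w = bergman_kernel (m i) a (w i)"
    and "poly_kernel n m z (axis i b) = bergman_kernel (m i) (z i) b"
proof -
  have "(\<Prod>j\<in>{1..n}-{i}. bergman_kernel (m j) (axis i a j) (w j)) = 1"
    by (intro prod.neutral) (auto simp: axis_def)
  then show "poly_kernel n m (axis i a) w = bergman_kernel (m i) a (w i)"
    using assms by (simp add: poly_kernel_split[OF assms] axis_def)
  have "(\<Prod>j\<in>{1..n}-{i}. bergman_kernel (m j) (z j) (axis i b j)) = 1"
    by (intro prod.neutral) (auto simp: axis_def)
  then show "poly_kernel n m z (axis i b) = bergman_kernel (m i) (z i) b"
    using assms by (simp add: poly_kernel_split[OF assms] axis_def)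
qed

lemma axis_at: "i \<in> {1..n} \<Longrightarrow> axis i a i = a"
  by (simp add: axis_def)

text \<open>On an axis the kernel of the polydisc reduces to the kernel of the disc, so the Gram
  matrices of the moved nodes agree.\<close>

lemma bounded_R:
  assumes i: "i \<in> {1..n}"
  shows "bounded_op H (A i) (R i)"
proof -
  have "positive_kernel complex_line unit_disc (\<lambda>z w. of_real 0 * bergman_kernel 0 z w)"
    by (rule positive_kernel_scale[OF disc.positive_kernel_axioms]) simp
  then have D: "positive_kernel complex_line unit_disc (\<lambda>z w. of_real (1\<^sup>2) * bergman_kernel (m i) z w -
      1 * cnj 1 * poly_kernel n m (axis i z) (axis i w))"
    by (simp add: poly_kernel_axis[OF i] axis_at[OF i])
  have "axis i ` unit_disc \<subseteq> polydisc n" by auto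
  from weighted_composition[where \<sigma> = "axis i" and \<psi> = "\<lambda>_. 1" and C = 1,
      OF disc.scalar_kernel_axioms poly.scalar_kernel_axioms this _ D]
  show ?thesis
    unfolding bounded_op_def R_def by (intro conjI exI[of _ 1]) (auto cong: if_cong)
qed

lemma R_in [simp]: "i \<in> {1..n} \<Longrightarrow> f \<in> vecs H \<Longrightarrow> R i f \<in> vecs (A i)"
  using bounded_R by (auto simp: bounded_op_def linear_op_def)

text \<open>Induction along \<open>A B - a b = (A - a) B + a (B - b)\<close>, where \<open>A\<close>, \<open>B\<close> are kernels that
  dominate \<open>a\<close>, \<open>b\<close>.\<close>

lemma tensor_dominated:
  assumes "finite I" and "I \<subseteq> {1..n}" and "\<And>i. i \<in> I \<Longrightarrow> f i \<in> vecs (A i)"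
  shows "positive_kernel complex_line (polydisc n) (\<lambda>z w.
    (\<Prod>i\<in>I. of_real ((vnorm (A i) (f i))\<^sup>2) * bergman_kernel (m i) (z i) (w i)) -
    (\<Prod>i\<in>I. f i (z i)) * cnj (\<Prod>i\<in>I. f i (w i)))"
  using assms
proof (induction I)
  case empty
  have "positive_kernel complex_line (polydisc n) (\<lambda>z w. of_real 0 * poly_kernel n m z w)"
    by (rule positive_kernel_scale[OF poly.positive_kernel_axioms]) simp
  then show ?case by simp
next
  case (insert i I)
  let ?B = "\<lambda>i z w. of_real ((vnorm (A i) (f i))\<^sup>2) * bergman_kernel (m i) (z i) (w i)"
  let ?F = "\<lambda>z. \<Prod>i\<in>I. f i (z i)"
  have i: "i \<in> {1..n}" and fi: "f i \<in> vecs (A i)" using insert.prems by auto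
  have coord: "(\<lambda>z. z i) ` polydisc n \<subseteq> unit_disc" using i polydiscD by blast
  have "positive_kernel complex_line (polydisc n) (\<lambda>z w. (\<Prod>j\<in>I. ?B j z w) - ?F z * cnj (?F w))"
    using insert by auto
  from positive_kernel_scale[OF positive_kernel_bergman_factor[OF this coord, of "m i"],
      of "(vnorm (A i) (f i))\<^sup>2"]
  have 1: "positive_kernel complex_line (polydisc n) (\<lambda>z w. of_real ((vnorm (A i) (f i))\<^sup>2) *
      (((\<Prod>j\<in>I. ?B j z w) - ?F z * cnj (?F w)) * bergman_kernel (m i) (z i) (w i)))" by simp
  have 2: "positive_kernel complex_line (polydisc n) (\<lambda>z w. ?F z * cnj (?F w) *
      (?B i z w - f i (z i) * cnj (f i (w i))))"
    by (rule positive_kernel_move[where \<sigma> = "\<lambda>z. z i" and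
          L = "\<lambda>a b. of_real ((vnorm (A i) (f i))\<^sup>2) * bergman_kernel (m i) a b - f i a * cnj (f i b)"])
      (rule disc.positive_kernel_minus_function[OF fi], rule coord)
  show ?case
    by (rule positive_kernel_cong[OF positive_kernel_add[OF 1 2]])
      (use insert.hyps in \<open>simp add: algebra_simps\<close>)
qed

lemma et_split:
  assumes "i \<in> {1..n}"
  shows "et (f(i := g)) = (\<lambda>z. if z \<in> polydisc n then (\<Prod>j\<in>{1..n}-{i}. f j (z j)) * g (z i) else 0)"
proof
  fix z
  have "(\<Prod>j=1..n. (f(i := g)) j (z j)) = g (z i) * (\<Prod>j\<in>{1..n}-{i}. (f(i := g)) j (z j))"
    using assms by (subst prod.remove[of _ i]) auto
  also have "(\<Prod>j\<in>{1..n}-{i}. (f(i := g)) j (z j)) = (\<Prod>j\<in>{1..n}-{i}. f j (z j))"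
    by (intro prod.cong) auto
  finally show "et (f(i := g)) z = (if z \<in> polydisc n then (\<Prod>j\<in>{1..n}-{i}. f j (z j)) * g (z i) else 0)"
    by (simp add: elementary_tensor_def mult.commute)
qed

text \<open>Inserting a function into one slot is a weighted composition, with the product of the
  other functions as weight.\<close>

lemma bounded_slot:
  assumes i: "i \<in> {1..n}" and f: "\<And>j. j \<in> {1..n} - {i} \<Longrightarrow> f j \<in> vecs (A j)"
  shows "bounded_op (A i) H (\<lambda>g. et (f(i := g)))"
proof -
  let ?I = "{1..n} - {i}"
  let ?\<psi> = "\<lambda>z. \<Prod>j\<in>?I. f j (z j)"
  let ?C = "\<Prod>j\<in>?I. vnorm (A j) (f j)"
  have C: "0 \<le> ?C" using f by (intro prod_nonneg) auto
  have coord: "(\<lambda>z. z i) ` polydisc n \<subseteq> unit_disc" using i polydiscD by blast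
  have "positive_kernel complex_line (polydisc n) (\<lambda>z w.
    (\<Prod>j\<in>?I. of_real ((vnorm (A j) (f j))\<^sup>2) * bergman_kernel (m j) (z j) (w j)) - ?\<psi> z * cnj (?\<psi> w))"
    by (rule tensor_dominated) (use f in auto)
  from positive_kernel_bergman_factor[OF this coord, of "m i"]
  have D: "positive_kernel complex_line (polydisc n) (\<lambda>z w. of_real (?C\<^sup>2) * poly_kernel n m z w -
      ?\<psi> z * cnj (?\<psi> w) * bergman_kernel (m i) (z i) (w i))"
  proof (rule positive_kernel_cong)
    fix z w
    have "of_real (?C\<^sup>2) * poly_kernel n m z w =
        (\<Prod>j\<in>?I. of_real ((vnorm (A j) (f j))\<^sup>2) * bergman_kernel (m j) (z j) (w j)) * bergman_kernel (m i) (z i) (w i)"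
      by (simp add: poly_kernel_split[OF i] prod.distrib prod_power_distrib[symmetric] mult_ac)
    then show "of_real (?C\<^sup>2) * poly_kernel n m z w - ?\<psi> z * cnj (?\<psi> w) * bergman_kernel (m i) (z i) (w i) =
      ((\<Prod>j\<in>?I. of_real ((vnorm (A j) (f j))\<^sup>2) * bergman_kernel (m j) (z j) (w j)) - ?\<psi> z * cnj (?\<psi> w)) *
        bergman_kernel (m i) (z i) (w i)"
      by (simp only: left_diff_distrib)
  qed
  from weighted_composition[where \<sigma> = "\<lambda>z. z i" and \<psi> = ?\<psi> and C = ?C,
      OF poly.scalar_kernel_axioms disc.scalar_kernel_axioms coord C D]
  show ?thesis
    unfolding bounded_op_def et_split[OF i] by blast
qed

lemma et_in:
  assumes "\<And>j. j \<in> {1..n} \<Longrightarrow> f j \<in> vecs (A j)"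
  shows "et f \<in> vecs H"
proof -
  have 1: "1 \<in> {1..n}" using n_pos by simp
  have "linear_op (A 1) H (\<lambda>g. et (f(1 := g)))"
    using bounded_slot[OF 1, of f] assms by (simp add: bounded_op_def)
  then have "et (f(1 := f 1)) \<in> vecs H"
    using assms[OF 1] unfolding linear_op_def by blast
  then show ?thesis by (simp only: fun_upd_triv)
qed

lemma et_cong: "(\<And>j. j \<in> {1..n} \<Longrightarrow> f j = g j) \<Longrightarrow> et f = et g"
  by (auto simp: elementary_tensor_def)

lemma kf_et: "w \<in> polydisc n \<Longrightarrow> kf w = et (\<lambda>j. kd j (w j))"
proof
  fix z
  have "poly_kernel n m z w = (\<Prod>j=1..n. kd j (w j) (z j))" if "z \<in> polydisc n"
    unfolding poly_kernel_def
    by (intro prod.cong refl) (use polydiscD[OF that] in \<open>simp add: disc.kf_def\<close>)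
  then show "kf w z = et (\<lambda>j. kd j (w j)) z"
    by (simp add: poly.kf_def elementary_tensor_def)
qed

lemma kd_in: "w \<in> polydisc n \<Longrightarrow> j \<in> {1..n} \<Longrightarrow> kd j (w j) \<in> vecs (A j)"
  using polydiscD by auto

text \<open>Both sides are bounded linear in each slot of the first tensor, so each slot can be
  reduced to kernel functions.\<close>

lemma et_inner:
  assumes f: "\<And>j. j \<in> {1..n} \<Longrightarrow> f j \<in> vecs (A j)" and g: "\<And>j. j \<in> {1..n} \<Longrightarrow> g j \<in> vecs (A j)"
  shows "vinner H (et g) (et f) = (\<Prod>j=1..n. vinner (A j) (g j) (f j))"
proof -
  have fH: "et f \<in> vecs H" by (rule et_in[OF f])
  have slots: "vinner H (et g) (et f) = (\<Prod>j=1..n. vinner (A j) (g j) (f j))"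
    if "finite I" "I \<subseteq> {1..n}" "\<And>j. j \<in> {1..n} \<Longrightarrow> g j \<in> vecs (A j)"
      "\<And>j. j \<in> {1..n} - I \<Longrightarrow> \<exists>a\<in>unit_disc. g j = kd j a" for I g
    using that
  proof (induction I arbitrary: g)
    case empty
    then have "\<forall>j\<in>{1..n}. \<exists>a\<in>unit_disc. g j = kd j a" by simp
    then obtain w where w: "\<And>j. j \<in> {1..n} \<Longrightarrow> w j \<in> unit_disc \<and> g j = kd j (w j)" by metis
    define w' where "w' = restrict w {1..n}"
    have w': "w' \<in> polydisc n" using w by (auto simp: w'_def polydisc_def)
    have "et g = kf w'"
      unfolding kf_et[OF w'] by (rule et_cong) (use w in \<open>simp add: w'_def\<close>)
    then have "vinner H (et g) (et f) = cnj (et f w')"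
      using w' fH by simp
    also have "\<dots> = (\<Prod>j=1..n. vinner (A j) (g j) (f j))"
      using w' w f by (simp add: elementary_tensor_def w'_def)
    finally show ?case .
  next
    case (insert i I)
    have i: "i \<in> {1..n}" using insert.prems by auto
    let ?c = "\<Prod>j\<in>{1..n}-{i}. vinner (A j) (g j) (f j)"
    have slot: "bounded_op (A i) H (\<lambda>h. et (g(i := h)))"
      by (rule bounded_slot[OF i]) (use insert.prems in auto)
    then obtain C where C: "\<And>h. h \<in> vecs (A i) \<Longrightarrow> vnorm H (et (g(i := h))) \<le> C * vnorm (A i) h"
      by (auto simp: bounded_op_def)
    have lin: "linear_op (A i) H (\<lambda>h. et (g(i := h)))" using slot by (simp add: bounded_op_def)
    have split: "(\<Prod>j=1..n. vinner (A j) ((g(i := h)) j) (f j)) = vinner (A i) h (f i) * ?c" for h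
    proof -
      have "(\<Prod>j\<in>{1..n}-{i}. vinner (A j) ((g(i := h)) j) (f j)) = ?c" by (intro prod.cong) auto
      then show ?thesis using i by (subst prod.remove[of _ i]) auto
    qed
    have "vinner H (et (g(i := g i))) (et f) = vinner (A i) (g i) (f i) * ?c"
    proof (rule ops_eq_on_total[where T = "\<lambda>h. vinner H (et (g(i := h))) (et f)" and
          T' = "\<lambda>h. vinner (A i) h (f i) * ?c" and G = complex_line,
          OF disc.hilbert_space_axioms _ disc.total_kf])
      show "inner_product_space complex_line" using hilbert_complex_line by (simp add: hilbert_space_def)
      show "g i \<in> vecs (A i)" using insert.prems i by simp
      show "bounded_op (A i) complex_line (\<lambda>h. vinner H (et (g(i := h))) (et f))"
        unfolding bounded_op_def
      proof (intro conjI exI ballI)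
        show "linear_op (A i) complex_line (\<lambda>h. vinner H (et (g(i := h))) (et f))"
          using lin fH by (auto simp: linear_op_def)
        fix h assume h: "h \<in> vecs (A i)"
        have "et (g(i := h)) \<in> vecs H" using lin h by (auto simp: linear_op_def)
        from poly.cauchy_schwarz[OF this fH]
        show "vnorm complex_line (vinner H (et (g(i := h))) (et f)) \<le> (C * vnorm H (et f)) * vnorm (A i) h"
          using mult_right_mono[OF C[OF h], of "vnorm H (et f)"] fH by (simp add: mult_ac)
      qed
      show "bounded_op (A i) complex_line (\<lambda>h. vinner (A i) h (f i) * ?c)"
        unfolding bounded_op_def
      proof (intro conjI exI ballI)
        show "linear_op (A i) complex_line (\<lambda>h. vinner (A i) h (f i) * ?c)"
          using f[OF i] by (auto simp: linear_op_def algebra_simps)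
        fix h assume h: "h \<in> vecs (A i)"
        show "vnorm complex_line (vinner (A i) h (f i) * ?c) \<le> (vnorm (A i) (f i) * cmod ?c) * vnorm (A i) h"
          using mult_right_mono[OF disc.cauchy_schwarz[OF h f[OF i]], of "cmod ?c"]
          by (simp add: norm_mult mult_ac)
      qed
      fix s assume "s \<in> disc.kf (m i) ` unit_disc"
      then obtain a where a: "a \<in> unit_disc" "s = kd i a" by auto
      have "vinner H (et (g(i := s))) (et f) = (\<Prod>j=1..n. vinner (A j) ((g(i := s)) j) (f j))"
      proof (rule insert.IH)
        show "\<And>j. j \<in> {1..n} - I \<Longrightarrow> \<exists>a\<in>unit_disc. (g(i := s)) j = kd j a"
          using insert.prems(3) a by auto
      qed (use insert.prems a in auto)
      then show "vinner H (et (g(i := s))) (et f) = vinner (A i) s (f i) * ?c"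
        using split by simp
    qed
    then show ?case using split[of "g i"] by simp
  qed
  show ?thesis by (rule slots[of "{1..n}"]) (use g in auto)
qed

lemma shift_adj_in [simp]: "i \<in> {1..n} \<Longrightarrow> f \<in> vecs (A i) \<Longrightarrow> shift_adj (m i) f \<in> vecs (A i)"
  and shift_adj_inner: "i \<in> {1..n} \<Longrightarrow> f \<in> vecs (A i) \<Longrightarrow> g \<in> vecs (A i) \<Longrightarrow>
    vinner (A i) (mult_z f) g = vinner (A i) f (shift_adj (m i) g)"
  using adj_props[OF disc.hilbert_space_axioms disc.inner_product_space_axioms bounded_mult_z] m_pos by auto

lemma mult_z_in [simp]: "i \<in> {1..n} \<Longrightarrow> f \<in> vecs (A i) \<Longrightarrow> mult_z f \<in> vecs (A i)"
  using mult_z_contraction(1)[OF m_pos] by (auto simp: linear_op_def)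

lemma M_et: "i \<in> {1..n} \<Longrightarrow> M i (et f) = et (f(i := mult_z (f i)))"
  using et_split[of i f "f i"] et_split[of i f "mult_z (f i)"]
  by (auto simp: mult_coord_def mult_z_def)

text \<open>Tested against a kernel function, which is itself an elementary tensor, the claim becomes
  an identity in the slot \<open>i\<close>.\<close>

lemma S_et:
  assumes i: "i \<in> {1..n}" and f: "\<And>j. j \<in> {1..n} \<Longrightarrow> f j \<in> vecs (A j)"
  shows "S i (et f) = et (f(i := shift_adj (m i) (f i)))"
proof (rule poly.fun_eqI)
  have f': "j \<in> {1..n} \<Longrightarrow> (f(i := shift_adj (m i) (f i))) j \<in> vecs (A j)" for j
    using f i by auto
  show "S i (et f) \<in> vecs H" using et_in[OF f] i by simp
  show "et (f(i := shift_adj (m i) (f i))) \<in> vecs H" by (rule et_in[OF f'])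
  fix w assume w: "w \<in> polydisc n"
  let ?k = "\<lambda>j. kd j (w j)"
  have k: "j \<in> {1..n} \<Longrightarrow> ?k j \<in> vecs (A j)" for j using kd_in[OF w] .
  have k': "j \<in> {1..n} \<Longrightarrow> (?k(i := mult_z (?k i))) j \<in> vecs (A j)" for j
    using k i by auto
  have "S i (et f) w = vinner H (S i (et f)) (kf w)"
    using w i et_in[OF f] by simp
  also have "\<dots> = vinner H (et f) (et (?k(i := mult_z (?k i))))"
    using S_inner'[OF i et_in[OF f] poly.kf_in[OF w]] by (simp only: kf_et[OF w] M_et[OF i])
  also have "\<dots> = (\<Prod>j=1..n. vinner (A j) (f j) ((?k(i := mult_z (?k i))) j))"
    by (rule et_inner[OF k' f])
  also have "\<dots> = (\<Prod>j=1..n. vinner (A j) ((f(i := shift_adj (m i) (f i))) j) (?k j))"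
  proof (intro prod.cong refl)
    fix j assume j: "j \<in> {1..n}"
    have "vinner (A i) (f i) (mult_z (?k i)) = vinner (A i) (shift_adj (m i) (f i)) (?k i)"
      using shift_adj_inner[OF i k[OF i] f[OF i]] disc.inner_commute[OF mult_z_in[OF i k[OF i]] f[OF i]]
        disc.inner_commute[OF k[OF i] shift_adj_in[OF i f[OF i]]] by simp
    then show "vinner (A j) (f j) ((?k(i := mult_z (?k i))) j) = vinner (A j) ((f(i := shift_adj (m i) (f i))) j) (?k j)"
      by simp
  qed
  also have "\<dots> = vinner H (et (f(i := shift_adj (m i) (f i)))) (kf w)"
    unfolding kf_et[OF w] by (rule et_inner[OF k f', symmetric])
  also have "\<dots> = et (f(i := shift_adj (m i) (f i))) w"
    by (rule poly.inner_kf(1)[OF w et_in[OF f']])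
  finally show "S i (et f) w = et (f(i := shift_adj (m i) (f i))) w" .
qed

text \<open>The adjoint of the restriction to an axis extends a function constantly in the other
  variables, and therefore intertwines the shifts.\<close>

lemma R_S:
  assumes i: "i \<in> {1..n}" and f: "f \<in> vecs H"
  shows "R i (S i f) = shift_adj (m i) (R i f)"
proof -
  \<comment> \<open>\<open>kd j 0\<close> is the constant function \<open>1\<close> on the disc.\<close>
  let ?E = "\<lambda>h. et ((\<lambda>j. kd j 0)(i := h))"
  have k0: "kd j 0 \<in> vecs (A j)" for j by simp
  have bE: "bounded_op (A i) H ?E" by (rule bounded_slot[OF i]) (use k0 in auto)
  have "adj H (A i) (R i) h = ?E h" if h: "h \<in> vecs (A i)" for h
  proof (rule ops_eq_on_total[where T = "adj H (A i) (R i)" and T' = ?E,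
        OF disc.hilbert_space_axioms poly.inner_product_space_axioms disc.total_kf])
    show "bounded_op (A i) H (adj H (A i) (R i))"
      by (rule adj_bounded_op[OF poly.hilbert_space_axioms disc.hilbert_space_axioms bounded_R[OF i]])
    show "bounded_op (A i) H ?E" by (rule bE)
    fix s assume "s \<in> disc.kf (m i) ` unit_disc"
    then obtain a where a: "a \<in> unit_disc" "s = kd i a" by auto
    have "?E s = kf (axis i a)"
      unfolding kf_et[OF axis_in[OF a(1)]] by (rule et_cong) (auto simp: axis_def a)
    moreover have "adj H (A i) (R i) s = kf (axis i a)"
    proof (rule adj_eqI[OF poly.inner_product_space_axioms])
      fix u assume u: "u \<in> vecs H"
      have "vinner (A i) (R i u) s = u (axis i a)"
        using a R_in[OF i u] by (simp add: R_def[of i u] del: R_in)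
      then show "vinner (A i) (R i u) s = vinner H u (kf (axis i a))" using a u by simp
    qed (use a in simp)
    ultimately show "adj H (A i) (R i) s = ?E s" by simp
  qed (rule h)
  with adj_props(2)[OF poly.hilbert_space_axioms disc.inner_product_space_axioms bounded_R[OF i]]
  have RE: "vinner (A i) (R i u) h = vinner H u (?E h)" if "u \<in> vecs H" "h \<in> vecs (A i)" for u h
    using that by simp
  show ?thesis
  proof (rule disc.eq_by_inner)
    show "R i (S i f) \<in> vecs (A i)" "shift_adj (m i) (R i f) \<in> vecs (A i)" using i f by auto
    fix h assume h: "h \<in> vecs (A i)"
    have Eh: "?E h \<in> vecs H" using bE h by (auto simp: bounded_op_def linear_op_def)
    have "vinner (A i) (R i (S i f)) h = vinner H (S i f) (?E h)" using RE i f h by simp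
    also have "\<dots> = vinner H f (M i (?E h))" using S_inner'[OF i f Eh] .
    also have "\<dots> = vinner (A i) (R i f) (mult_z h)" using RE[OF f mult_z_in[OF i h]] by (simp add: M_et[OF i])
    also have "\<dots> = cnj (vinner (A i) (mult_z h) (R i f))"
      using disc.inner_commute[OF mult_z_in[OF i h] R_in[OF i f]] .
    also have "\<dots> = cnj (vinner (A i) h (shift_adj (m i) (R i f)))"
      using shift_adj_inner[OF i h R_in[OF i f]] by simp
    also have "\<dots> = vinner (A i) (shift_adj (m i) (R i f)) h"
      using disc.inner_commute[OF h shift_adj_in[OF i R_in[OF i f]]] by simp
    finally show "vinner (A i) (R i (S i f)) h = vinner (A i) (shift_adj (m i) (R i f)) h" .
  qed
qed

end

lemma bounded_op_comp:
  assumes "inner_product_space H" and "inner_product_space G" and T: "bounded_op H G T" and S: "bounded_op G F S"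
  shows "bounded_op H F (\<lambda>x. S (T x))"
proof -
  interpret H: inner_product_space H by fact
  interpret G: inner_product_space G by fact
  obtain B where B: "\<And>x. x \<in> vecs H \<Longrightarrow> vnorm G (T x) \<le> B * vnorm H x" using T by (auto simp: bounded_op_def)
  obtain C where C: "\<And>x. x \<in> vecs G \<Longrightarrow> vnorm F (S x) \<le> C * vnorm G x" using S by (auto simp: bounded_op_def)
  have TG: "x \<in> vecs H \<Longrightarrow> T x \<in> vecs G" for x using T by (auto simp: bounded_op_def linear_op_def)
  have "vnorm F (S (T x)) \<le> (\<bar>C\<bar> * B) * vnorm H x" if x: "x \<in> vecs H" for x
  proof -
    have "vnorm F (S (T x)) \<le> C * vnorm G (T x)" by (rule C[OF TG[OF x]])
    also have "\<dots> \<le> \<bar>C\<bar> * vnorm G (T x)" using TG[OF x] by (intro mult_right_mono) auto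
    also have "\<dots> \<le> \<bar>C\<bar> * (B * vnorm H x)" using B[OF x] by (intro mult_left_mono) auto
    finally show ?thesis by (simp add: mult.assoc)
  qed
  then show ?thesis
    using T S unfolding bounded_op_def by (blast intro: linear_op_comp)
qed

text \<open>The set is the orthogonal complement of all differences of the two adjoints.\<close>

lemma equalizer_closed_subspace:
  assumes "hilbert_space H" and "inner_product_space G" and T: "bounded_op H G T" "bounded_op H G T'"
  shows "closed_subspace H {x \<in> vecs H. T x = T' x}"
proof -
  interpret H: hilbert_space H by fact
  interpret G: inner_product_space G by fact
  note p = adj_props[OF assms(1,2) T(1)] adj_props[OF assms(1,2) T(2)]
  have lin: "\<And>x. x \<in> vecs H \<Longrightarrow> T x \<in> vecs G" "\<And>x. x \<in> vecs H \<Longrightarrow> T' x \<in> vecs G"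
    using T by (auto simp: bounded_op_def linear_op_def)
  let ?D = "(\<lambda>y. vminus H (adj H G T y) (adj H G T' y)) ` vecs G"
  have D: "?D \<subseteq> vecs H" using p by auto
  have "{x \<in> vecs H. T x = T' x} = orth_complement H ?D"
  proof -
    have "T x = T' x \<longleftrightarrow> (\<forall>y\<in>vecs G. vinner H x (vminus H (adj H G T y) (adj H G T' y)) = 0)" if x: "x \<in> vecs H" for x
    proof -
      have "vinner H x (vminus H (adj H G T y) (adj H G T' y)) = vinner G (T x) y - vinner G (T' x) y"
        if "y \<in> vecs G" for y
        using p that x by simp
      then show ?thesis using G.eq_by_inner[OF lin(1)[OF x] lin(2)[OF x]] by auto
    qed
    then show ?thesis by (auto simp: orth_complement_def)
  qed
  then show ?thesis using H.orth_complement_closed[OF D] by simp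
qed

lemma (in hilbert_space) bounded_orth_proj:
  assumes Q: "closed_subspace H Q"
  shows "bounded_op H H (orth_proj H Q)"
  unfolding bounded_op_def
proof (intro conjI exI ballI)
  show "linear_op H H (orth_proj H Q)"
    unfolding linear_op_def
  proof (intro conjI ballI allI)
    fix x y c assume x: "x \<in> vecs H"
    show "orth_proj H Q x \<in> vecs H" using Q x by simp
    show "orth_proj H Q (vscale H c x) = vscale H c (orth_proj H Q x)"
      by (rule orth_proj_eqI[OF Q])
        (use x Q orth_proj_props(1)[OF Q x] closed_subspaceD(1,4)[OF Q] orth_proj_inner[OF Q x] in auto)
    assume y: "y \<in> vecs H"
    show "orth_proj H Q (vadd H x y) = vadd H (orth_proj H Q x) (orth_proj H Q y)"
      by (rule orth_proj_eqI[OF Q])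
        (use x y Q orth_proj_props(1)[OF Q] closed_subspaceD(1,3)[OF Q] orth_proj_inner[OF Q] in auto)
  qed
  show "vnorm H (orth_proj H Q x) \<le> 1 * vnorm H x" if "x \<in> vecs H" for x
    using norm_orth_proj_le[OF Q that] by simp
qed

context bergman_tuple
begin

section \<open>Compressions to quotient modules\<close>

lemma quotient_module_iff:
  "quotient_module n m Q \<longleftrightarrow> closed_subspace H Q \<and> (\<forall>i\<in>{1..n}. \<forall>f\<in>Q. S i f \<in> Q)"
  by (simp add: quotient_module_def S_def)

abbreviation "C Q i \<equiv> compression n m Q i"

lemma C_in: "closed_subspace H Q \<Longrightarrow> i \<in> {1..n} \<Longrightarrow> f \<in> Q \<Longrightarrow> C Q i f \<in> Q"
  unfolding compression_def by (intro poly.orth_proj_props(1) M_in) (auto dest: poly.closed_subspaceD)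

lemma C_inner:
  assumes Q: "closed_subspace H Q" and i: "i \<in> {1..n}" and f: "f \<in> Q" and g: "g \<in> Q"
  shows "vinner H (C Q i f) g = vinner H f (S i g)"
  using poly.orth_proj_inner[OF Q M_in[OF i poly.closed_subspaceD(1)[OF Q f]] g]
    S_inner[OF i poly.closed_subspaceD(1)[OF Q f] poly.closed_subspaceD(1)[OF Q g]]
  by (simp add: compression_def)

text \<open>Because \<open>Q\<close> is invariant under \<open>S\<^sub>i\<close>, no projection is needed in the adjoint of the
  compression.\<close>

lemma adj_compression:
  assumes Q: "quotient_module n m Q" and i: "i \<in> {1..n}" and f: "f \<in> Q"
  shows "adj (subspace_of H Q) (subspace_of H Q) (C Q i) f = S i f"
proof -
  have Qc: "closed_subspace H Q" and "S i f \<in> Q" using Q i f by (auto simp: quotient_module_iff)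
  then show ?thesis
    using f i by (intro adj_eqI poly.subspace_inner_product_space) (auto simp: C_inner[OF Qc i])
qed

lemma doubly_commuting_iff:
  assumes Q: "quotient_module n m Q"
  shows "doubly_commuting n m Q \<longleftrightarrow>
    (\<forall>i\<in>{1..n}. \<forall>j\<in>{1..n}. i < j \<longrightarrow> (\<forall>f\<in>Q. S i (C Q j f) = C Q j (S i f)))"
proof -
  have Qc: "closed_subspace H Q" using Q by (simp add: quotient_module_iff)
  show ?thesis
    unfolding doubly_commuting_def Let_def
    using adj_compression[OF Q] C_in[OF Qc] by (intro ball_cong refl imp_cong) simp
qed

section \<open>Tensor products are doubly commuting\<close>

lemma tensor_generators_in:
  assumes "\<And>i. i \<in> {1..n} \<Longrightarrow> closed_subspace (A i) (B i)"
  shows "{et f | f. \<forall>i\<in>{1..n}. f i \<in> B i} \<subseteq> vecs H"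
proof safe
  fix f assume f: "\<forall>i\<in>{1..n}. f i \<in> B i"
  show "et f \<in> vecs H" by (rule et_in) (use f disc.closed_subspaceD(1)[OF assms] in blast)
qed

lemma tensor_closed:
  assumes "\<And>i. i \<in> {1..n} \<Longrightarrow> closed_subspace (A i) (B i)"
  shows "closed_subspace H (tensor_subspace n m B)"
  unfolding tensor_subspace_def by (intro poly.hull_closed_subspace tensor_generators_in assms)

lemma tensor_generator: "(\<And>i. i \<in> {1..n} \<Longrightarrow> f i \<in> B i) \<Longrightarrow> et f \<in> tensor_subspace n m B"
  unfolding tensor_subspace_def by (rule hull_inc) auto

lemma tensor_induct:
  assumes "closed_subspace H P" and "\<And>f. (\<And>i. i \<in> {1..n} \<Longrightarrow> f i \<in> B i) \<Longrightarrow> et f \<in> P"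
  shows "tensor_subspace n m B \<subseteq> P"
  unfolding tensor_subspace_def by (rule hull_minimal) (use assms in auto)

lemma quotient_module_1D:
  assumes "quotient_module_1 k B"
  shows "closed_subspace (bergman k) B" and "f \<in> B \<Longrightarrow> shift_adj k f \<in> B"
  using assms by (auto simp: quotient_module_1_def)

lemma tensor_quotient_module:
  assumes B: "\<And>i. i \<in> {1..n} \<Longrightarrow> quotient_module_1 (m i) (B i)"
  shows "quotient_module n m (tensor_subspace n m B)"
  unfolding quotient_module_iff
proof (intro conjI ballI)
  let ?T = "tensor_subspace n m B"
  note Bc = quotient_module_1D(1)[OF B]
  show T: "closed_subspace H ?T" by (rule tensor_closed[OF Bc])
  fix i f assume i: "i \<in> {1..n}" and f: "f \<in> ?T"
  have "?T \<subseteq> {f \<in> vecs H. S i f \<in> ?T}"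
  proof (rule tensor_induct)
    show "closed_subspace H {f \<in> vecs H. S i f \<in> ?T}"
      by (rule preimage_closed_subspace[OF poly.inner_product_space_axioms poly.inner_product_space_axioms bounded_S[OF i] T])
    fix g assume g: "\<And>j. j \<in> {1..n} \<Longrightarrow> g j \<in> B j"
    then have gA: "\<And>j. j \<in> {1..n} \<Longrightarrow> g j \<in> vecs (A j)" using disc.closed_subspaceD(1)[OF Bc] by blast
    have "et (g(i := shift_adj (m i) (g i))) \<in> ?T"
      by (rule tensor_generator) (use g quotient_module_1D(2)[OF B[OF i]] i in auto)
    then show "et g \<in> {f \<in> vecs H. S i f \<in> ?T}"
      using et_in[OF gA] S_et[OF i gA] by simp
  qed
  with f show "S i f \<in> ?T" by blast
qed

text \<open>The part of the shifted function that is orthogonal to \<open>B\<^sub>j\<close> produces a tensor orthogonal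
  to all generators of the tensor product.\<close>

lemma C_tensor:
  assumes B: "\<And>i. i \<in> {1..n} \<Longrightarrow> closed_subspace (A i) (B i)" and j: "j \<in> {1..n}"
    and f: "\<And>i. i \<in> {1..n} \<Longrightarrow> f i \<in> B i"
  shows "C (tensor_subspace n m B) j (et f) = et (f(j := orth_proj (A j) (B j) (mult_z (f j))))"
  unfolding compression_def
proof (rule poly.orth_proj_eqI[OF tensor_closed[OF B]])
  let ?T = "tensor_subspace n m B" and ?p = "orth_proj (A j) (B j) (mult_z (f j))"
  have fA: "\<And>i. i \<in> {1..n} \<Longrightarrow> f i \<in> vecs (A i)" using f disc.closed_subspaceD(1)[OF B] by blast
  have mz: "mult_z (f j) \<in> vecs (A j)" using fA[OF j] j by simp
  have p: "?p \<in> B j" by (rule disc.orth_proj_props(1)[OF B[OF j] mz])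
  have fm: "\<And>i. i \<in> {1..n} \<Longrightarrow> (f(j := mult_z (f j))) i \<in> vecs (A i)" using fA mz by auto
  have fp: "\<And>i. i \<in> {1..n} \<Longrightarrow> (f(j := ?p)) i \<in> vecs (A i)"
    using fA disc.closed_subspaceD(1)[OF B[OF j] p] by auto
  show MH: "M j (et f) \<in> vecs H" using et_in[OF fA] j by simp
  show pT: "et (f(j := ?p)) \<in> ?T" by (rule tensor_generator) (use f p in auto)
  have pH: "et (f(j := ?p)) \<in> vecs H" by (rule et_in[OF fp])
  let ?d = "vminus H (et (f(j := ?p))) (M j (et f))"
  have d: "?d \<in> vecs H" using MH pH by simp
  have "?T \<subseteq> orth_complement H {?d}"
  proof (rule tensor_induct)
    show "closed_subspace H (orth_complement H {?d})" by (rule poly.orth_complement_closed) (use d in simp)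
    fix g assume g: "\<And>i. i \<in> {1..n} \<Longrightarrow> g i \<in> B i"
    have gA: "\<And>i. i \<in> {1..n} \<Longrightarrow> g i \<in> vecs (A i)" using g disc.closed_subspaceD(1)[OF B] by blast
    have "vinner H (et g) (et (f(j := ?p))) = vinner H (et g) (et (f(j := mult_z (f j))))"
    proof -
      have "(\<Prod>i=1..n. vinner (A i) (g i) ((f(j := ?p)) i)) = (\<Prod>i=1..n. vinner (A i) (g i) ((f(j := mult_z (f j))) i))"
        by (intro prod.cong refl) (use disc.orth_proj_inner_right[OF B[OF j] mz g[OF j]] in auto)
      then show ?thesis using et_inner[where f = "f(j := ?p)", OF fp gA] et_inner[where f = "f(j := mult_z (f j))", OF fm gA]
        by simp
    qed
    then have "vinner H (et g) ?d = 0"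
      using et_in[OF gA] pH MH M_et[OF j, of f] by simp
    then show "et g \<in> orth_complement H {?d}" using et_in[OF gA] by (simp add: orth_complement_def)
  qed
  then show "vinner H (et (f(j := ?p))) z = vinner H (M j (et f)) z" if "z \<in> ?T" for z
  proof -
    have z: "z \<in> vecs H" "vinner H z ?d = 0"
      using \<open>?T \<subseteq> orth_complement H {?d}\<close> that by (auto simp: orth_complement_def)
    then have "vinner H z (et (f(j := ?p))) = vinner H z (M j (et f))" using pH MH by simp
    then show ?thesis using poly.inner_eq_commute[OF pH MH z(1)] by blast
  qed
qed

text \<open>On a generator the two operators change different slots, and generators suffice as both
  compositions are bounded.\<close>

lemma tensor_doubly_commuting:
  assumes B: "\<And>i. i \<in> {1..n} \<Longrightarrow> quotient_module_1 (m i) (B i)"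
  shows "doubly_commuting n m (tensor_subspace n m B)"
proof (rule iffD2[OF doubly_commuting_iff[OF tensor_quotient_module[OF B]]]; (intro ballI impI)?)
  let ?T = "tensor_subspace n m B"
  note Bc = quotient_module_1D(1)[OF B]
  have T: "closed_subspace H ?T" by (rule tensor_closed[OF Bc])
  fix i j f assume i: "i \<in> {1..n}" and j: "j \<in> {1..n}" and "i < j" and f: "f \<in> ?T"
  let ?E = "{f \<in> vecs H. S i (C ?T j f) = C ?T j (S i f)}"
  have bC: "bounded_op H H (C ?T j)"
    unfolding compression_def
    by (rule bounded_op_comp[OF poly.inner_product_space_axioms poly.inner_product_space_axioms bounded_M[OF j] poly.bounded_orth_proj[OF T]])
  have "?T \<subseteq> ?E"
  proof (rule tensor_induct)
    show "closed_subspace H ?E"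
      by (rule equalizer_closed_subspace[OF poly.hilbert_space_axioms poly.inner_product_space_axioms
          bounded_op_comp[OF poly.inner_product_space_axioms poly.inner_product_space_axioms bC bounded_S[OF i]]
          bounded_op_comp[OF poly.inner_product_space_axioms poly.inner_product_space_axioms bounded_S[OF i] bC]])
    fix g assume g: "\<And>j. j \<in> {1..n} \<Longrightarrow> g j \<in> B j"
    have gA: "\<And>j. j \<in> {1..n} \<Longrightarrow> g j \<in> vecs (A j)" using g disc.closed_subspaceD(1)[OF Bc] by blast
    let ?p = "orth_proj (A j) (B j) (mult_z (g j))" and ?s = "shift_adj (m i) (g i)"
    have mz: "mult_z (g j) \<in> vecs (A j)" using gA[OF j] j by simp
    have p: "?p \<in> B j" by (rule disc.orth_proj_props(1)[OF Bc[OF j] mz])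
    have gp: "\<And>l. l \<in> {1..n} \<Longrightarrow> (g(j := ?p)) l \<in> vecs (A l)"
      using gA disc.closed_subspaceD(1)[OF Bc[OF j] p] by auto
    have gs: "\<And>l. l \<in> {1..n} \<Longrightarrow> (g(i := ?s)) l \<in> B l"
      using g quotient_module_1D(2)[OF B[OF i] g[OF i]] by auto
    have "S i (C ?T j (et g)) = et ((g(j := ?p))(i := ?s))"
      using C_tensor[OF Bc j g] S_et[where f = "g(j := ?p)", OF i gp] \<open>i < j\<close> by simp
    also have "\<dots> = C ?T j (S i (et g))"
      using C_tensor[where f = "g(i := ?s)", OF Bc j gs] S_et[OF i gA] \<open>i < j\<close> by (simp add: fun_upd_twist)
    finally show "et g \<in> ?E" using et_in[OF gA] by simp
  qed
  with f show "S i (C ?T j f) = C ?T j (S i f)" by blast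
qed

section \<open>Double commutativity is an invariant of unitary equivalence\<close>

text \<open>Being unitary, \<open>U\<close> also intertwines the adjoints of the compressions, which are the \<open>S\<^sub>i\<close>.\<close>

lemma module_iso_doubly_commuting:
  assumes Q: "quotient_module n m Q" and Q': "quotient_module n m Q'" and iso: "module_iso n m Q Q'"
    and dc: "doubly_commuting n m Q'"
  shows "doubly_commuting n m Q"
proof -
  obtain U where U: "unitary_op (subspace_of H Q) (subspace_of H Q') U"
    and UC: "\<And>i f. i \<in> {1..n} \<Longrightarrow> f \<in> Q \<Longrightarrow> U (C Q i f) = C Q' i (U f)"
    using iso by (auto simp: module_iso_def)
  have Qc: "closed_subspace H Q" and SQ: "\<And>i f. i \<in> {1..n} \<Longrightarrow> f \<in> Q \<Longrightarrow> S i f \<in> Q"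
    and Qc': "closed_subspace H Q'" and SQ': "\<And>i f. i \<in> {1..n} \<Longrightarrow> f \<in> Q' \<Longrightarrow> S i f \<in> Q'"
    using Q Q' by (auto simp: quotient_module_iff)
  have UQ: "\<And>f. f \<in> Q \<Longrightarrow> U f \<in> Q'" and surj: "U ` Q = Q'"
    and Uinner: "\<And>f g. f \<in> Q \<Longrightarrow> g \<in> Q \<Longrightarrow> vinner H (U f) (U g) = vinner H f g"
    using U by (auto simp: unitary_op_def)
  have US: "U (S i f) = S i (U f)" if i: "i \<in> {1..n}" and f: "f \<in> Q" for i f
  proof (rule poly.eq_in_subspace[OF Qc'])
    show "U (S i f) \<in> Q'" "S i (U f) \<in> Q'" using i f SQ SQ' UQ by auto
    fix z assume "z \<in> Q'"
    then obtain g where g: "g \<in> Q" "z = U g" using surj by auto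
    have "vinner H (U (S i f)) z = vinner H (S i f) g" using g i f SQ Uinner by simp
    also have "\<dots> = cnj (vinner H (C Q i g) f)"
      using C_inner[OF Qc i g(1) f] poly.inner_commute[of g n m "S i f"]
        poly.closed_subspaceD(1)[OF Qc g(1)] poly.closed_subspaceD(1)[OF Qc SQ[OF i f]] by simp
    also have "\<dots> = cnj (vinner H (C Q' i z) (U f))"
      using Uinner[OF C_in[OF Qc i g(1)] f] UC[OF i g(1)] g by simp
    also have "\<dots> = vinner H (S i (U f)) z"
      using C_inner[OF Qc' i _ UQ[OF f], of z] \<open>z \<in> Q'\<close> poly.inner_commute[of z n m "S i (U f)"]
        poly.closed_subspaceD(1)[OF Qc' \<open>z \<in> Q'\<close>] poly.closed_subspaceD(1)[OF Qc' SQ'[OF i UQ[OF f]]] by simp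
    finally show "vinner H (U (S i f)) z = vinner H (S i (U f)) z" .
  qed
  show ?thesis
    unfolding doubly_commuting_iff[OF Q]
  proof (intro ballI impI)
    fix i j f assume i: "i \<in> {1..n}" and j: "j \<in> {1..n}" and "i < j" and f: "f \<in> Q"
    have l: "S i (C Q j f) \<in> Q" and r: "C Q j (S i f) \<in> Q"
      using SQ[OF i C_in[OF Qc j f]] C_in[OF Qc j SQ[OF i f]] by auto
    have "S i (C Q' j (U f)) = C Q' j (S i (U f))"
      using dc i j \<open>i < j\<close> UQ[OF f] unfolding doubly_commuting_iff[OF Q'] by blast
    then have eq: "U (S i (C Q j f)) = U (C Q j (S i f))"
      using US[OF i C_in[OF Qc j f]] US[OF i f] UC[OF j f] UC[OF j SQ[OF i f]] by simp
    show "S i (C Q j f) = C Q j (S i f)"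
    proof (rule poly.eq_in_subspace[OF Qc l r])
      fix z assume "z \<in> Q"
      then show "vinner H (S i (C Q j f)) z = vinner H (C Q j (S i f)) z"
        using Uinner[OF l] Uinner[OF r] eq by metis
    qed
  qed
qed

lemma module_iso_refl:
  assumes Q: "closed_subspace H Q"
  shows "module_iso n m Q Q"
  unfolding module_iso_def
  by (rule exI[of _ id]) (use poly.closed_subspaceD[OF Q] in \<open>auto simp: unitary_op_def linear_op_def\<close>)

end

context bergman_tuple
begin

lemma inner_sum:
  assumes "finite J" and "\<And>k. k \<in> J \<Longrightarrow> h k \<in> vecs H" and g: "g \<in> vecs H"
  shows "(\<lambda>z. \<Sum>k\<in>J. c k * h k z) \<in> vecs H \<and>
    vinner H (\<lambda>z. \<Sum>k\<in>J. c k * h k z) g = (\<Sum>k\<in>J. c k * vinner H (h k) g)"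
  using assms(1,2)
proof induction
  case empty
  have "(\<lambda>z. \<Sum>k\<in>{}. c k * h k z) = vzero H" by (simp add: poly.ops)
  then show ?case using g by simp
next
  case (insert j J)
  have "(\<lambda>z. \<Sum>k\<in>insert j J. c k * h k z) = vadd H (vscale H (c j) (h j)) (\<lambda>z. \<Sum>k\<in>J. c k * h k z)"
    using insert.hyps by (simp add: poly.ops)
  then show ?case using insert g by simp
qed

lemma M_pow_at: "(M i ^^ k) f z = z i ^ k * f z"
  by (induction k) (auto simp: mult_coord_def)

lemma M_pow_in [simp]: "i \<in> {1..n} \<Longrightarrow> f \<in> vecs H \<Longrightarrow> (M i ^^ k) f \<in> vecs H"
  by (induction k) auto

lemma M_pow_inner:
  "i \<in> {1..n} \<Longrightarrow> f \<in> vecs H \<Longrightarrow> g \<in> vecs H \<Longrightarrow> vinner H ((M i ^^ k) f) g = vinner H f ((S i ^^ k) g)"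
  by (induction k arbitrary: f) (auto simp: funpow_swap1 S_inner)

lemma Z_single_inner:
  assumes i: "i \<in> {1..n}" and f: "f \<in> vecs H" and g: "g \<in> vecs H"
  shows "vinner H (Z {i} f) g = (\<Sum>k\<le>m i. (of_nat (m i choose k) * (-1) ^ k) * vinner H ((S i ^^ k) f) ((S i ^^ k) g))"
proof -
  let ?c = "\<lambda>k. of_nat (m i choose k) * (-1) ^ k :: complex"
  have "Z {i} f z = (\<Sum>k\<in>{..m i}. ?c k * (M i ^^ k) ((S i ^^ k) f) z)" for z
  proof (cases "z \<in> polydisc n")
    case True
    then show ?thesis
      unfolding Z_single_hereditary[OF i f True]
      by (intro sum.cong refl) (simp add: M_pow_at power_minus[of "z i"] mult_ac)
  next
    case False
    then show ?thesis
      using poly.off_zero[OF S_pow_in[OF i f], of z] by (simp add: M_pow_at Z_def)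
  qed
  then have "Z {i} f = (\<lambda>z. \<Sum>k\<in>{..m i}. ?c k * (M i ^^ k) ((S i ^^ k) f) z)" by blast
  then show ?thesis
    using inner_sum[where J = "{..m i}" and h = "\<lambda>k. (M i ^^ k) ((S i ^^ k) f)" and c = ?c and g = g]
      i f g by (simp add: M_pow_inner)
qed

text \<open>On kernel functions \<open>1 - w\<^sub>i S\<^sub>i\<close> is multiplication by a scalar, whose power \<open>m\<^sub>i\<close> cancels
  the \<open>i\<close>-th factor of the kernel. Inverted, the identity moves evaluation at \<open>w\<close> to a point
  with vanishing \<open>i\<close>-th coordinate.\<close>

lemma zero_coords_resolvent:
  assumes i: "i \<in> {1..n}" and w: "w \<in> polydisc n" and g: "g \<in> vecs H"
  shows "((\<lambda>h. vminus H h (vscale H (w i) (S i h))) ^^ m i) g w = g (zero_coords {i} w)"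
proof -
  let ?L = "\<lambda>h. vminus H h (vscale H (w i) (S i h))"
  have lin: "linear_op H H ?L"
    unfolding linear_op_def
  proof (intro conjI ballI allI)
    fix x y c assume x: "x \<in> vecs H"
    show "?L x \<in> vecs H" using i x by simp
    show "?L (vscale H c x) = vscale H c (?L x)"
      unfolding S_linear(2)[OF i x] by (simp add: poly.ops algebra_simps)
    assume y: "y \<in> vecs H"
    show "?L (vadd H x y) = vadd H (?L x) (?L y)"
      unfolding S_linear(1)[OF i x y] by (simp add: poly.ops algebra_simps)
  qed
  have bL: "bounded_op H H ?L"
    unfolding bounded_op_def
  proof (intro conjI exI ballI)
    fix x assume x: "x \<in> vecs H"
    have "vnorm H (?L x) \<le> vnorm H x + vnorm H (vscale H (-1) (vscale H (w i) (S i x)))"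
      by (rule poly.norm_triangle) (use i x in auto)
    also have "\<dots> \<le> vnorm H x + cmod (w i) * vnorm H x"
      using S_norm[OF i x] i x by (simp add: poly.norm_scale mult_left_mono)
    finally show "vnorm H (?L x) \<le> (1 + cmod (w i)) * vnorm H x" by (simp add: algebra_simps)
  qed (rule lin)
  have bLk: "bounded_op H H (?L ^^ k)" for k
  proof (induction k)
    case 0
    show ?case unfolding bounded_op_def linear_op_def by (auto intro: exI[of _ 1])
  next
    case (Suc k)
    from bounded_op_comp[OF poly.inner_product_space_axioms poly.inner_product_space_axioms Suc bL]
    show ?case by (simp add: comp_def)
  qed
  have ev: "bounded_op H complex_line (\<lambda>f. f v)" if v: "v \<in> polydisc n" for v
    unfolding bounded_op_def linear_op_def
    using poly.eval_bounded[OF v] by (auto simp: poly.ops intro!: exI[of _ "vnorm H (kf v)"])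
  have ipc: "inner_product_space complex_line" using hilbert_complex_line by (simp add: hilbert_space_def)
  have zw: "zero_coords {i} w \<in> polydisc n" using i w by simp
  show ?thesis
  proof (rule ops_eq_on_total[where T = "\<lambda>g. (?L ^^ m i) g w" and T' = "\<lambda>g. g (zero_coords {i} w)" and G = complex_line,
      OF poly.hilbert_space_axioms ipc poly.total_kf])
    show "bounded_op H complex_line (\<lambda>g. (?L ^^ m i) g w)"
      by (rule bounded_op_comp[OF poly.inner_product_space_axioms poly.inner_product_space_axioms bLk ev[OF w]])
    show "bounded_op H complex_line (\<lambda>g. g (zero_coords {i} w))" by (rule ev[OF zw])
    fix s assume "s \<in> poly.kf n m ` polydisc n"
    then obtain v where v: "v \<in> polydisc n" "s = kf v" by auto
    have L1: "?L (kf v) = vscale H (1 - w i * cnj (v i)) (kf v)"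
      unfolding S_kf[OF i v(1)] by (simp add: poly.ops algebra_simps)
    have "(?L ^^ k) (kf v) = vscale H ((1 - w i * cnj (v i)) ^ k) (kf v)" for k
    proof (induction k)
      case 0 then show ?case using v by (simp add: poly.scale_one)
    next
      case (Suc k)
      have "?L (vscale H c (kf v)) = vscale H c (?L (kf v))" for c
        using lin v(1) unfolding linear_op_def by auto
      then show ?case using Suc L1 v(1) by (simp add: poly.scale_scale mult.commute)
    qed
    then have "(?L ^^ m i) s w = (1 - w i * cnj (v i)) ^ m i * poly_kernel n m w v"
      using w by (simp add: v(2) poly.scale_at poly.kf_def)
    also have "\<dots> = poly_kernel n m (zero_coords {i} w) v"
    proof -
      have "(\<Prod>j\<in>{1..n}-{i}. bergman_kernel (m j) (zero_coords {i} w j) (v j)) =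
          (\<Prod>j\<in>{1..n}-{i}. bergman_kernel (m j) (w j) (v j))"
        by (intro prod.cong) (auto simp: zero_coords_def)
      moreover have "1 - w i * cnj (v i) \<noteq> 0"
        using disc_kernel_nonzero polydiscD w v i by blast
      ultimately show ?thesis
        by (simp add: poly_kernel_split[OF i] zero_coords_def bergman_kernel_def)
    qed
    finally show "(?L ^^ m i) s w = s (zero_coords {i} w)"
      using zw by (simp add: v(2) poly.kf_def)
  qed (rule g)
qed

end

section \<open>Doubly commuting quotient modules\<close>

locale doubly_commuting_module = bergman_tuple +
  fixes Q
  assumes quotient: "quotient_module n m Q" and doubly_commuting: "doubly_commuting n m Q"
begin

lemma Q: "closed_subspace H Q" and SQ: "i \<in> {1..n} \<Longrightarrow> f \<in> Q \<Longrightarrow> S i f \<in> Q"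
  using quotient by (auto simp: quotient_module_iff)

lemma QH [simp]: "f \<in> Q \<Longrightarrow> f \<in> vecs H"
  using poly.closed_subspaceD(1)[OF Q] .

text \<open>Operators on \<open>Q\<close> are handled through adjoint pairs, which makes linearity automatic and
  lets commutation relations be transferred to the adjoints.\<close>

definition adjp where
  "adjp T T' \<longleftrightarrow> (\<forall>f\<in>Q. T f \<in> Q \<and> T' f \<in> Q) \<and> (\<forall>f\<in>Q. \<forall>g\<in>Q. vinner H (T f) g = vinner H f (T' g))"

definition comm where
  "comm T U \<longleftrightarrow> (\<forall>f\<in>Q. T (U f) = U (T f))"

lemma Q_eqI: "f \<in> Q \<Longrightarrow> g \<in> Q \<Longrightarrow> (\<And>h. h \<in> Q \<Longrightarrow> vinner H f h = vinner H g h) \<Longrightarrow> f = g"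
  by (rule poly.eq_in_subspace[OF Q])

lemma adjpD:
  assumes "adjp T T'"
  shows "f \<in> Q \<Longrightarrow> T f \<in> Q" "f \<in> Q \<Longrightarrow> T' f \<in> Q" "f \<in> Q \<Longrightarrow> g \<in> Q \<Longrightarrow> vinner H (T f) g = vinner H f (T' g)"
  using assms by (auto simp: adjp_def)

lemma adjp_sym: "adjp T T' \<Longrightarrow> adjp T' T"
proof -
  assume T: "adjp T T'"
  have "vinner H (T' f) g = vinner H f (T g)" if "f \<in> Q" "g \<in> Q" for f g
  proof -
    have "vinner H (T' f) g = cnj (vinner H g (T' f))"
      by (rule poly.inner_commute) (use that adjpD[OF T] in auto)
    also have "\<dots> = cnj (vinner H (T g) f)" using adjpD(3)[OF T that(2,1)] by simp
    also have "\<dots> = vinner H f (T g)"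
      by (rule poly.inner_commute[symmetric]) (use that adjpD[OF T] in auto)
    finally show ?thesis .
  qed
  then show "adjp T' T" using T by (auto simp: adjp_def)
qed

lemma adjp_comp: "adjp T T' \<Longrightarrow> adjp U U' \<Longrightarrow> adjp (\<lambda>f. T (U f)) (\<lambda>f. U' (T' f))"
  by (auto simp: adjp_def)

lemma adjp_linear:
  assumes T: "adjp T T'" and f: "f \<in> Q"
  shows "g \<in> Q \<Longrightarrow> T (vadd H f g) = vadd H (T f) (T g)" and "T (vscale H c f) = vscale H c (T f)"
proof -
  note D = poly.closed_subspaceD(3,4)[OF Q]
  show "T (vadd H f g) = vadd H (T f) (T g)" if g: "g \<in> Q"
    by (rule Q_eqI) (use D adjpD[OF T] f g in auto)
  show "T (vscale H c f) = vscale H c (T f)"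
    by (rule Q_eqI) (use D adjpD[OF T] f in auto)
qed

lemma adjp_linear_op: "adjp T T' \<Longrightarrow> linear_op (subspace_of H Q) (subspace_of H Q) T"
  using adjp_linear[of T T'] adjpD(1)[of T T'] by (auto simp: linear_op_def)

lemma comm_sym: "comm T U \<Longrightarrow> comm U T"
  by (auto simp: comm_def)

lemma comm_adj:
  assumes T: "adjp T T'" and U: "adjp U U'" and c: "comm T U"
  shows "comm T' U'"
  unfolding comm_def
proof
  fix f assume f: "f \<in> Q"
  show "T' (U' f) = U' (T' f)"
  proof (rule Q_eqI)
    fix g assume g: "g \<in> Q"
    have "vinner H (T' (U' f)) g = vinner H f (U (T g))"
      using adjpD[OF adjp_sym[OF T]] adjpD[OF adjp_sym[OF U]] f g by simp
    also have "U (T g) = T (U g)" using c g by (simp add: comm_def)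
    also have "vinner H f (T (U g)) = vinner H (U' (T' f)) g"
      using adjpD[OF adjp_sym[OF T]] adjpD[OF adjp_sym[OF U]] f g by simp
    finally show "vinner H (T' (U' f)) g = vinner H (U' (T' f)) g" .
  qed (use adjpD[OF T] adjpD[OF U] f in auto)
qed

lemma comm_comp: "comm T U \<Longrightarrow> comm T V \<Longrightarrow> (\<And>f. f \<in> Q \<Longrightarrow> V f \<in> Q) \<Longrightarrow> comm T (\<lambda>f. U (V f))"
  by (auto simp: comm_def)

lemma comm_funpow:
  assumes "comm T U" and U: "\<And>f. f \<in> Q \<Longrightarrow> U f \<in> Q"
  shows "comm T (U ^^ k)"
proof (induction k)
  case 0 then show ?case by (simp add: comm_def)
next
  case (Suc k)
  have "f \<in> Q \<Longrightarrow> (U ^^ k) f \<in> Q" for f by (induction k) (auto simp: U)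
  then show ?case using comm_comp[OF assms(1) Suc] by (simp add: comm_def)
qed

lemma adjp_CS: "i \<in> {1..n} \<Longrightarrow> adjp (C Q i) (S i)"
  using C_in[OF Q] SQ C_inner[OF Q] by (auto simp: adjp_def)

lemmas adjp_SC = adjp_sym[OF adjp_CS]

lemma comm_SS: "i \<in> {1..n} \<Longrightarrow> j \<in> {1..n} \<Longrightarrow> comm (S i) (S j)"
  using S_commute by (auto simp: comm_def)

lemma comm_SC:
  assumes i: "i \<in> {1..n}" and j: "j \<in> {1..n}" and "i \<noteq> j"
  shows "comm (S i) (C Q j)"
proof (cases "i < j")
  case True
  then show ?thesis
    using doubly_commuting i j unfolding doubly_commuting_iff[OF quotient] comm_def by blast
next
  case False
  then have "comm (S j) (C Q i)"
    using doubly_commuting i j \<open>i \<noteq> j\<close> unfolding doubly_commuting_iff[OF quotient] comm_def by force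
  from comm_adj[OF adjp_SC[OF j] adjp_CS[OF i] this] show ?thesis by (rule comm_sym)
qed

section \<open>Compressions of the projections onto functions independent of some variables\<close>

definition D :: "nat set \<Rightarrow> ((nat \<Rightarrow> complex) \<Rightarrow> complex) \<Rightarrow> (nat \<Rightarrow> complex) \<Rightarrow> complex" where
  "D I f = orth_proj H Q (Z I f)"

lemma D_in: "I \<subseteq> {1..n} \<Longrightarrow> f \<in> Q \<Longrightarrow> D I f \<in> Q"
  unfolding D_def using poly.orth_proj_props(1)[OF Q] Z_props(1) by simp

lemma D_inner: "I \<subseteq> {1..n} \<Longrightarrow> f \<in> Q \<Longrightarrow> g \<in> Q \<Longrightarrow> vinner H (D I f) g = vinner H (Z I f) g"
  unfolding D_def using poly.orth_proj_inner[OF Q] Z_props(1) by simp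

lemma adjp_D: "I \<subseteq> {1..n} \<Longrightarrow> adjp (D I) (D I)"
proof -
  assume I: "I \<subseteq> {1..n}"
  have "vinner H (D I f) g = vinner H f (D I g)" if f: "f \<in> Q" and g: "g \<in> Q" for f g
  proof -
    have "vinner H f (D I g) = vinner H f (Z I g)"
      unfolding D_def by (rule poly.orth_proj_inner_right[OF Q Z_props(1)[OF I QH[OF g]] f])
    then show ?thesis using D_inner[OF I f g] Z_props(2)[OF I QH[OF f] QH[OF g]] by simp
  qed
  then show "adjp (D I) (D I)" using D_in[OF I] by (auto simp: adjp_def)
qed

lemma S_pow_Q: "i \<in> {1..n} \<Longrightarrow> f \<in> Q \<Longrightarrow> (S i ^^ k) f \<in> Q"
  by (induction k) (auto simp: SQ)

lemma D_single_inner: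
  assumes "i \<in> {1..n}" "f \<in> Q" "g \<in> Q"
  shows "vinner H (D {i} f) g =
    (\<Sum>k\<le>m i. (of_nat (m i choose k) * (-1) ^ k) * vinner H ((S i ^^ k) f) ((S i ^^ k) g))"
  using D_inner[of "{i}" f g] Z_single_inner[of i f g] assms by simp

text \<open>In the expression of \<open>D\<^sub>i\<close> through powers of \<open>S\<^sub>i\<close> on both sides of the inner product,
  \<open>S\<^sub>l\<close> and \<open>C\<^sub>l\<close> pass through these powers. Here double commutativity enters.\<close>

lemma comm_D_single:
  assumes i: "i \<in> {1..n}" and l: "l \<in> {1..n}" and "i \<noteq> l"
  shows "comm (D {i}) (S l)"
  unfolding comm_def
proof
  fix f assume f: "f \<in> Q"
  have I: "{i} \<subseteq> {1..n}" using i by simp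
  show "D {i} (S l f) = S l (D {i} f)"
  proof (rule Q_eqI)
    fix g assume g: "g \<in> Q"
    have gl: "C Q l g \<in> Q" by (rule C_in[OF Q l g])
    have "vinner H ((S i ^^ k) (S l f)) ((S i ^^ k) g) = vinner H ((S i ^^ k) f) ((S i ^^ k) (C Q l g))" for k
    proof -
      have "(S i ^^ k) (S l f) = S l ((S i ^^ k) f)"
        using comm_funpow[OF comm_SS[OF l i] SQ[OF i], of k] f by (simp add: comm_def)
      moreover have "C Q l ((S i ^^ k) g) = (S i ^^ k) (C Q l g)"
        using comm_funpow[OF comm_sym[OF comm_SC[OF i l \<open>i \<noteq> l\<close>]] SQ[OF i], of k] g by (simp add: comm_def)
      ultimately show ?thesis
        using adjpD(3)[OF adjp_SC[OF l] S_pow_Q[OF i f, of k] S_pow_Q[OF i g, of k]] by simp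
    qed
    then have "vinner H (D {i} (S l f)) g = vinner H (D {i} f) (C Q l g)"
      using D_single_inner[OF i SQ[OF l f] g] D_single_inner[OF i f gl] by simp
    then show "vinner H (D {i} (S l f)) g = vinner H (S l (D {i} f)) g"
      using adjpD(3)[OF adjp_SC[OF l] D_in[OF I f] g] by simp
  qed (use f D_in[OF I] SQ[OF l] in auto)
qed

text \<open>The expansion of \<open>Z\<close> in the variable \<open>i\<close> holds on the whole space; commutation with \<open>S\<^sub>i\<close>
  transfers it to the compressions.\<close>

lemma D_insert:
  assumes I: "I \<subseteq> {1..n}" and i: "i \<in> {1..n} - I" and c: "comm (D I) (S i)" and f: "f \<in> Q"
  shows "D (insert i I) f = D {i} (D I f)"
proof (rule Q_eqI)
  have i': "i \<in> {1..n}" "{i} \<subseteq> {1..n}" and I': "insert i I \<subseteq> {1..n}" using i I by auto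
  show "D (insert i I) f \<in> Q" "D {i} (D I f) \<in> Q" using D_in I' i' I f by auto
  fix g assume g: "g \<in> Q"
  have "vinner H (D (insert i I) f) g = vinner H (Z {i} (Z I f)) g"
    using D_inner[OF I' f g] Z_insert[OF I i'(1)] by simp
  also have "\<dots> = (\<Sum>k\<le>m i. (of_nat (m i choose k) * (-1) ^ k) * vinner H ((S i ^^ k) (Z I f)) ((S i ^^ k) g))"
    by (rule Z_single_inner[OF i'(1) Z_props(1)[OF I QH[OF f]] QH[OF g]])
  also have "\<dots> = (\<Sum>k\<le>m i. (of_nat (m i choose k) * (-1) ^ k) * vinner H ((S i ^^ k) (D I f)) ((S i ^^ k) g))"
  proof (intro sum.cong refl arg_cong2[of _ _ _ _ "(*)"])
    fix k
    have "(S i ^^ k) (Z I f) = Z I ((S i ^^ k) f)"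
      by (induction k) (use Z_props(3)[OF I S_pow_in[OF i'(1) QH[OF f]] i] in auto)
    moreover have "(S i ^^ k) (D I f) = D I ((S i ^^ k) f)"
      using comm_funpow[OF c SQ[OF i'(1)], of k] f by (simp add: comm_def)
    ultimately show "vinner H ((S i ^^ k) (Z I f)) ((S i ^^ k) g) = vinner H ((S i ^^ k) (D I f)) ((S i ^^ k) g)"
      using D_inner[OF I S_pow_Q[OF i'(1) f] S_pow_Q[OF i'(1) g]] by simp
  qed
  also have "\<dots> = vinner H (D {i} (D I f)) g"
    by (rule D_single_inner[OF i'(1) D_in[OF I f] g, symmetric])
  finally show "vinner H (D (insert i I) f) g = vinner H (D {i} (D I f)) g" .
qed

lemma comm_D:
  assumes "I \<subseteq> {1..n}" and "l \<in> {1..n} - I"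
  shows "comm (D I) (S l)"
proof -
  have "finite I" using assms(1) finite_subset by blast
  then have "\<forall>l\<in>{1..n} - I. comm (D I) (S l)"
    using assms(1)
  proof induction
    case empty
    have "D {} f = f" if "f \<in> Q" for f
      using that by (simp add: D_def Z_empty poly.orth_proj_id[OF Q])
    then show ?case using SQ by (auto simp: comm_def)
  next
    case (insert i I)
    show ?case
    proof
      fix l assume l: "l \<in> {1..n} - insert i I"
      have I: "I \<subseteq> {1..n}" and i: "i \<in> {1..n} - I" using insert by auto
      have IH: "comm (D I) (S l)" "comm (D I) (S i)" using insert.IH[OF I] l i by auto
      have "comm (D {i}) (S l)" by (rule comm_D_single) (use l i in auto)
      from comm_comp[OF comm_sym[OF this] comm_sym[OF IH(1)] D_in[OF I]]
      have "comm (S l) (\<lambda>f. D {i} (D I f))" by simp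
      then show "comm (D (insert i I)) (S l)"
        using D_insert[OF I i IH(2)] SQ[of l] l by (simp add: comm_def)
    qed
  qed
  then show ?thesis using assms(2) by blast
qed

definition org :: "nat \<Rightarrow> complex" where "org = (\<lambda>i\<in>{1..n}. 0)"

lemma org_in [simp]: "org \<in> polydisc n"
  by (auto simp: org_def polydisc_def)

definition q :: "(nat \<Rightarrow> complex) \<Rightarrow> (nat \<Rightarrow> complex) \<Rightarrow> complex" where
  "q w = orth_proj H Q (kf w)"

lemma q_in [simp]: "w \<in> polydisc n \<Longrightarrow> q w \<in> Q"
  unfolding q_def by (intro poly.orth_proj_props(1)[OF Q]) simp

lemma inner_q:
  assumes w: "w \<in> polydisc n" and f: "f \<in> Q"
  shows "vinner H f (q w) = f w"
  unfolding q_def poly.orth_proj_inner_right[OF Q poly.kf_in[OF w] f] by (rule poly.inner_kf(1)[OF w QH[OF f]])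

lemma q_hermitian:
  assumes w: "w \<in> polydisc n" and z: "z \<in> polydisc n"
  shows "q w z = cnj (q z w)"
  unfolding inner_q[OF z q_in[OF w], symmetric] inner_q[OF w q_in[OF z], symmetric]
  by (rule poly.inner_commute) (use w z in simp_all)

lemma zero_coords_org: "z \<in> polydisc n \<Longrightarrow> zero_coords {1..n} z = org"
  by (auto simp: zero_coords_def org_def polydisc_def PiE_iff extensional_def fun_eq_iff)

lemma D_all_inner:
  assumes f: "f \<in> Q" and g: "g \<in> Q"
  shows "vinner H (D {1..n} f) g = f org * cnj (g org)"
proof -
  have "Z {1..n} f = vscale H (f org) (kf org)"
  proof
    fix z
    have "poly_kernel n m z org = 1" by (simp add: poly_kernel_def org_def)
    then show "Z {1..n} f z = vscale H (f org) (kf org) z"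
      using zero_coords_org[of z] by (simp add: Z_def poly.scale_at poly.kf_def)
  qed
  then show ?thesis using D_inner[OF _ f g, of "{1..n}"] g by simp
qed

section \<open>Moving evaluation points\<close>

lemma S_contraction: "i \<in> {1..n} \<Longrightarrow> f \<in> Q \<Longrightarrow> vnorm H (S i f) \<le> vnorm H f"
  by (simp add: S_norm)

lemma C_contraction: "i \<in> {1..n} \<Longrightarrow> f \<in> Q \<Longrightarrow> vnorm H (C Q i f) \<le> vnorm H f"
  using poly.norm_orth_proj_le[OF Q M_in[of i f]] mult_coord_contraction(2)[of i f]
  by (simp add: compression_def)

text \<open>Right inverses of \<open>1 - a T\<close> and of its adjoint exist by the fixed point theorem. They are
  adjoint to each other, and hence also left inverses.\<close>

lemma resolvent_exists:
  assumes T: "adjp T T'" and n1: "\<And>f. f \<in> Q \<Longrightarrow> vnorm H (T f) \<le> vnorm H f"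
    and n2: "\<And>f. f \<in> Q \<Longrightarrow> vnorm H (T' f) \<le> vnorm H f" and a: "cmod a < 1"
  shows "\<exists>Y Y'. adjp Y Y' \<and> (\<forall>f\<in>Q. vminus H (Y f) (vscale H a (T (Y f))) = f) \<and>
    (\<forall>f\<in>Q. Y (vminus H f (vscale H a (T f))) = f)"
proof -
  interpret QH: hilbert_space "subspace_of H Q" by (rule poly.subspace_hilbert_space[OF Q])
  have "\<exists>x\<in>Q. vminus H x (vscale H a (T x)) = f" if "f \<in> Q" for f
    using QH.neumann[OF adjp_linear_op[OF T], of a f] n1 a that by simp
  then obtain Y where Y: "\<And>f. f \<in> Q \<Longrightarrow> Y f \<in> Q \<and> vminus H (Y f) (vscale H a (T (Y f))) = f" by metis
  have "\<exists>x\<in>Q. vminus H x (vscale H (cnj a) (T' x)) = f" if "f \<in> Q" for f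
    using QH.neumann[OF adjp_linear_op[OF adjp_sym[OF T]], of "cnj a" f] n2 a that by simp
  then obtain Y' where Y': "\<And>f. f \<in> Q \<Longrightarrow> Y' f \<in> Q \<and> vminus H (Y' f) (vscale H (cnj a) (T' (Y' f))) = f" by metis
  have YQ: "\<And>f. f \<in> Q \<Longrightarrow> Y f \<in> Q" and Yr: "\<And>f. f \<in> Q \<Longrightarrow> vminus H (Y f) (vscale H a (T (Y f))) = f"
    and YQ': "\<And>f. f \<in> Q \<Longrightarrow> Y' f \<in> Q" and Yr': "\<And>f. f \<in> Q \<Longrightarrow> vminus H (Y' f) (vscale H (cnj a) (T' (Y' f))) = f"
    using Y Y' by auto
  have flip: "vinner H (vminus H f (vscale H a (T f))) g = vinner H f (vminus H g (vscale H (cnj a) (T' g)))"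
    if "f \<in> Q" "g \<in> Q" for f g
    using that adjpD[OF T] by simp
  have "adjp Y Y'"
    unfolding adjp_def
  proof (intro conjI ballI)
    fix f g assume f: "f \<in> Q" and g: "g \<in> Q"
    have "vinner H (Y f) g = vinner H (Y f) (vminus H (Y' g) (vscale H (cnj a) (T' (Y' g))))" unfolding Yr'[OF g] ..
    also have "\<dots> = vinner H (vminus H (Y f) (vscale H a (T (Y f)))) (Y' g)" by (rule flip[OF YQ[OF f] YQ'[OF g], symmetric])
    also have "\<dots> = vinner H f (Y' g)" unfolding Yr[OF f] ..
    finally show "vinner H (Y f) g = vinner H f (Y' g)" .
  qed (use YQ YQ' in auto)
  moreover have "Y (vminus H f (vscale H a (T f))) = f" if f: "f \<in> Q" for f
  proof (rule Q_eqI)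
    have d: "vminus H f (vscale H a (T f)) \<in> Q"
      by (intro poly.closed_subspaceD(3)[OF Q f] poly.closed_subspaceD(4)[OF Q] adjpD(1)[OF T f])
    then show "Y (vminus H f (vscale H a (T f))) \<in> Q" by (rule YQ)
    fix g assume g: "g \<in> Q"
    have "vinner H (Y (vminus H f (vscale H a (T f)))) g = vinner H (vminus H f (vscale H a (T f))) (Y' g)"
      using adjpD(3)[OF \<open>adjp Y Y'\<close> d g] .
    also have "\<dots> = vinner H f (vminus H (Y' g) (vscale H (cnj a) (T' (Y' g))))" by (rule flip[OF f YQ'[OF g]])
    also have "\<dots> = vinner H f g" unfolding Yr'[OF g] ..
    finally show "vinner H (Y (vminus H f (vscale H a (T f)))) g = vinner H f g" .
  qed (rule f)
  ultimately show ?thesis using Yr by blast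
qed

lemma adjp_funpow:
  assumes "adjp T T'"
  shows "adjp (T ^^ k) (T' ^^ k)"
proof (induction k)
  case 0 then show ?case by (simp add: adjp_def)
next
  case (Suc k)
  from adjp_comp[OF assms Suc] show ?case
    by (simp add: adjp_def funpow_swap1)
qed

text \<open>\<open>W\<close> is \<open>(1 - a S\<^sub>i)\<^sup>-\<^sup>m\<close> with \<open>m = m\<^sub>i\<close>, the inverse being taken on \<open>Q\<close>.\<close>

lemma mover_single:
  assumes i: "i \<in> {1..n}" and a: "a \<in> unit_disc"
  shows "\<exists>W W'. adjp W W' \<and> (\<forall>f\<in>Q. \<forall>v\<in>polydisc n. v i = a \<longrightarrow> f v = W f (zero_coords {i} v)) \<and>
    (\<forall>T T'. adjp T T' \<longrightarrow> comm T (S i) \<longrightarrow> comm T W)"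
proof -
  have "cmod a < 1" using a by simp
  from resolvent_exists[OF adjp_SC[OF i] S_contraction[OF i] C_contraction[OF i] this]
  obtain Y Y' where Y: "adjp Y Y'" and r: "\<And>f. f \<in> Q \<Longrightarrow> vminus H (Y f) (vscale H a (S i (Y f))) = f"
    and l: "\<And>f. f \<in> Q \<Longrightarrow> Y (vminus H f (vscale H a (S i f))) = f" by blast
  let ?L = "\<lambda>h. vminus H h (vscale H a (S i h))"
  have Yk: "f \<in> Q \<Longrightarrow> (Y ^^ k) f \<in> Q" for f k using adjpD(1)[OF adjp_funpow[OF Y]] .
  have LY: "(?L ^^ k) ((Y ^^ k) f) = f" if "f \<in> Q" for f k
  proof (induction k)
    case (Suc k)
    have "(?L ^^ Suc k) ((Y ^^ Suc k) f) = (?L ^^ k) (?L (Y ((Y ^^ k) f)))"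
      unfolding funpow_Suc_right[of k ?L] by simp
    also have "\<dots> = f" using r[OF Yk[OF that, of k]] Suc by simp
    finally show ?case .
  qed simp
  have "f v = (Y ^^ m i) f (zero_coords {i} v)" if "f \<in> Q" "v \<in> polydisc n" "v i = a" for f v
    using zero_coords_resolvent[OF i that(2) QH[OF Yk[OF that(1), of "m i"]]] LY[OF that(1), of "m i"] that(3) by simp
  moreover have "comm T (Y ^^ m i)" if T: "adjp T T'" and c: "comm T (S i)" for T T'
  proof (rule comm_funpow)
    show "f \<in> Q \<Longrightarrow> Y f \<in> Q" for f using adjpD(1)[OF Y] .
    show "comm T Y"
      unfolding comm_def
    proof
      fix f assume f: "f \<in> Q"
      have Yf: "Y f \<in> Q" and SYf: "S i (Y f) \<in> Q" using adjpD(1)[OF Y f] SQ[OF i] by auto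
      note cl = poly.closed_subspaceD(3,4)[OF Q]
      have "T f = T (?L (Y f))" using r[OF f] by simp
      also have "\<dots> = ?L (T (Y f))"
        using adjp_linear[OF T] Yf SYf cl c by (simp add: comm_def)
      finally have "Y (T f) = Y (?L (T (Y f)))" by simp
      then show "T (Y f) = Y (T f)" using l[OF adjpD(1)[OF T Yf]] by simp
    qed
  qed
  ultimately show ?thesis using adjp_funpow[OF Y] by blast
qed

text \<open>An operator that replaces evaluation at points agreeing with \<open>w\<close> on \<open>I\<close> by evaluation
  where these coordinates vanish, and that inherits all commutation relations of the \<open>S\<^sub>i\<close> with
  \<open>i \<in> I\<close>.\<close>

lemma mover:
  assumes "I \<subseteq> {1..n}" and w: "w \<in> polydisc n"
  shows "\<exists>W W'. adjp W W' \<and>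
    (\<forall>f\<in>Q. \<forall>v\<in>polydisc n. (\<forall>i\<in>I. v i = w i) \<longrightarrow> f v = W f (zero_coords I v)) \<and>
    (\<forall>T T'. adjp T T' \<longrightarrow> (\<forall>i\<in>I. comm T (S i)) \<longrightarrow> comm T W)"
proof -
  have "finite I" using assms(1) finite_subset by blast
  then show ?thesis
    using assms(1)
  proof induction
    case empty
    have "zero_coords {} v = v" for v by (simp add: zero_coords_def)
    then show ?case by (intro exI[of _ "\<lambda>f. f"]) (auto simp: adjp_def comm_def)
  next
    case (insert i I)
    have i: "i \<in> {1..n}" and I: "I \<subseteq> {1..n}" using insert.prems by auto
    obtain V V' where V: "adjp V V'"
      and Vev: "\<And>f v. f \<in> Q \<Longrightarrow> v \<in> polydisc n \<Longrightarrow> v i = w i \<Longrightarrow> f v = V f (zero_coords {i} v)"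
      and Vc: "\<And>T T'. adjp T T' \<Longrightarrow> comm T (S i) \<Longrightarrow> comm T V"
      using mover_single[OF i polydiscD[OF w i]] by blast
    obtain W W' where W: "adjp W W'"
      and Wev: "\<And>f v. f \<in> Q \<Longrightarrow> v \<in> polydisc n \<Longrightarrow> (\<And>j. j \<in> I \<Longrightarrow> v j = w j) \<Longrightarrow> f v = W f (zero_coords I v)"
      and Wc: "\<And>T T'. adjp T T' \<Longrightarrow> (\<And>j. j \<in> I \<Longrightarrow> comm T (S j)) \<Longrightarrow> comm T W"
      using insert.IH[OF I] by blast
    have "f v = W (V f) (zero_coords (insert i I) v)"
      if f: "f \<in> Q" and v: "v \<in> polydisc n" "\<And>j. j \<in> insert i I \<Longrightarrow> v j = w j" for f v
    proof -
      have "V f (zero_coords {i} v) = W (V f) (zero_coords I (zero_coords {i} v))"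
      proof (rule Wev)
        show "zero_coords {i} v \<in> polydisc n" using i v(1) by simp
        show "zero_coords {i} v j = w j" if "j \<in> I" for j
          using that insert.hyps(2) v(2)[of j] by (auto simp: zero_coords_def)
      qed (rule adjpD(1)[OF V f])
      then show ?thesis using Vev[OF f v(1)] v(2) by (simp add: zero_coords_insert[of i I])
    qed
    moreover have "comm T (\<lambda>f. W (V f))" if "adjp T T'" "\<And>j. j \<in> insert i I \<Longrightarrow> comm T (S j)" for T T'
    proof (rule comm_comp[where U = W and V = V])
      show "comm T W" by (rule Wc[OF that(1)]) (use that(2) in blast)
      show "comm T V" by (rule Vc[OF that(1)]) (use that(2) in blast)
    qed (rule adjpD(1)[OF V])
    ultimately show ?case
      using adjp_comp[OF W V] by (intro exI conjI) (assumption, blast+)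
  qed
qed

end

context doubly_commuting_module
begin

section \<open>The reproducing kernel of the module factorises\<close>

definition c :: complex where "c = q org org"

lemma c_norm: "c = of_real ((vnorm H (q org))\<^sup>2)"
  using inner_q[of org "q org"] poly.inner_self[of "q org" n m] by (simp add: c_def)

text \<open>All values of \<open>f\<close> are values at the origin of other elements of \<open>Q\<close>, and these vanish if
  the kernel function of the origin does.\<close>

lemma c_zero_imp:
  assumes "c = 0" and f: "f \<in> Q"
  shows "f = vzero H"
proof (rule poly.fun_eqI[where m = m])
  have qz: "q org = vzero H" using assms(1) poly.norm_eq_zero[of "q org" n m] by (simp add: c_norm)
  fix w assume w: "w \<in> polydisc n"
  obtain W W' where W: "adjp W W'" and Wev: "\<And>f v. f \<in> Q \<Longrightarrow> v \<in> polydisc n \<Longrightarrow> (\<forall>i\<in>{1..n}. v i = w i) \<Longrightarrow>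
      f v = W f (zero_coords {1..n} v)"
    using mover[OF subset_refl w] by blast
  have "f w = W f org" using Wev[OF f w] zero_coords_org[OF w] by simp
  also have "\<dots> = vinner H (W f) (q org)" using inner_q[OF org_in adjpD(1)[OF W f]] by simp
  also have "\<dots> = 0" unfolding qz using adjpD(1)[OF W f] by simp
  finally show "f w = vzero H w" by (simp add: poly.zero_at)
qed (use f in simp_all)

definition rank1 :: "((nat \<Rightarrow> complex) \<Rightarrow> complex) \<Rightarrow> (nat \<Rightarrow> complex) \<Rightarrow> complex" where
  "rank1 f = vscale H (f org) (q org)"

lemma rank1_inner: "f \<in> Q \<Longrightarrow> g \<in> Q \<Longrightarrow> vinner H (rank1 f) g = f org * cnj (g org)"
proof -
  assume f: "f \<in> Q" and g: "g \<in> Q"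
  have "vinner H (q org) g = cnj (g org)"
    unfolding inner_q[OF org_in g, symmetric] by (rule poly.inner_commute) (use g in simp_all)
  then show ?thesis using g by (simp add: rank1_def)
qed

text \<open>The product of the two self-adjoint operators is self-adjoint.\<close>

lemma comm_D_D:
  assumes J: "J \<subseteq> {1..n}" and i: "i \<in> {1..n} - J"
  shows "comm (D J) (D {i})" and "f \<in> Q \<Longrightarrow> D (insert i J) f = D J (D {i} f)"
proof -
  have i': "{i} \<subseteq> {1..n}" and iJ: "insert i J \<subseteq> {1..n}" using i J by auto
  have ins: "D (insert i J) f = D {i} (D J f)" if "f \<in> Q" for f
    by (rule D_insert[OF J i comm_D[OF J i] that])
  have adj: "D (insert i J) f = D J (D {i} f)" if f: "f \<in> Q" for f
  proof (rule Q_eqI)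
    show "D (insert i J) f \<in> Q" "D J (D {i} f) \<in> Q" using D_in iJ i' J f by auto
    fix g assume g: "g \<in> Q"
    have "vinner H (D (insert i J) f) g = vinner H f (D {i} (D J g))"
      using adjpD(3)[OF adjp_D[OF iJ] f g] ins[OF g] by simp
    also have "\<dots> = vinner H (D J (D {i} f)) g"
      using adjpD(3)[OF adjp_D[OF i'] f D_in[OF J g]] adjpD(3)[OF adjp_D[OF J] D_in[OF i' f] g] by simp
    finally show "vinner H (D (insert i J) f) g = vinner H (D J (D {i} f)) g" .
  qed
  then show "f \<in> Q \<Longrightarrow> D (insert i J) f = D J (D {i} f)" for f by blast
  show "comm (D J) (D {i})" using ins adj by (auto simp: comm_def)
qed

text \<open>The two kernel functions obtained by splitting off one coordinate are eigenvectors of the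
  compressed projections, whose product is the rank one operator given by the kernel at the
  origin.\<close>

lemma kernel_split:
  assumes i: "i \<in> {1..n}" and w: "w \<in> polydisc n" and z: "z \<in> polydisc n"
  defines "J \<equiv> {1..n} - {i}"
  shows "c * q w z = q (zero_coords {i} w) (zero_coords {i} z) * q (zero_coords J w) (zero_coords J z)"
proof (cases "c = 0")
  case True
  have "f \<in> Q \<Longrightarrow> f v = 0" for f v using c_zero_imp[OF True, of f] by (simp add: poly.zero_at)
  moreover have "zero_coords {i} w \<in> polydisc n" using i w by simp
  ultimately show ?thesis using True by simp
next
  case False
  let ?I = "{i}"
  let ?u = "q org"
  have I: "?I \<subseteq> {1..n}" and J: "J \<subseteq> {1..n}" and iJ: "i \<in> {1..n} - J" and un: "insert i J = {1..n}"
    using i by (auto simp: J_def)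
  let ?w1 = "zero_coords ?I w" and ?z1 = "zero_coords ?I z"
  let ?w2 = "zero_coords J w" and ?z2 = "zero_coords J z"
  have pts: "?w1 \<in> polydisc n" "?z1 \<in> polydisc n" "?w2 \<in> polydisc n" "?z2 \<in> polydisc n"
    using w z I J by auto
  have u: "?u \<in> Q" by simp
  have prod1: "D J (D ?I f) = rank1 f" and prod2: "D ?I (D J f) = rank1 f" if f: "f \<in> Q" for f
  proof -
    have "D {1..n} f = rank1 f"
    proof (rule Q_eqI)
      show "D {1..n} f \<in> Q" by (rule D_in[OF subset_refl f])
      show "rank1 f \<in> Q" unfolding rank1_def by (rule poly.closed_subspaceD(4)[OF Q u])
      show "vinner H (D {1..n} f) g = vinner H (rank1 f) g" if "g \<in> Q" for g
        by (simp only: D_all_inner[OF f that] rank1_inner[OF f that])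
    qed
    then show "D J (D ?I f) = rank1 f" using comm_D_D(2)[OF J iJ f] un by simp
    then show "D ?I (D J f) = rank1 f" using comm_D_D(1)[OF J iJ] f by (simp add: comm_def)
  qed
  \<comment> \<open>Both operators commute with their product, the rank one operator with range spanned by \<open>?u\<close>.\<close>
  have eigen: "\<exists>\<rho>. D K ?u = vscale H \<rho> ?u" if K: "K = ?I \<or> K = J" for K
  proof -
    have KI: "K \<subseteq> {1..n}" using K I J by auto
    have DQ: "D ?I ?u \<in> Q" "D J ?u \<in> Q" using D_in I J u by auto
    have com: "D K (rank1 ?u) = rank1 (D K ?u)"
      using K prod1[OF u] prod2[OF u] prod1[OF DQ(1)] prod1[OF DQ(2)] prod2[OF DQ(1)] prod2[OF DQ(2)] by auto
    have "D K (vscale H c ?u) = vscale H (D K ?u org) ?u"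
      using com by (simp add: rank1_def c_def)
    then have "vscale H c (D K ?u) = vscale H (D K ?u org) ?u"
      using adjp_linear(2)[OF adjp_D[OF KI] u] by simp
    then have "vscale H (1 / c) (vscale H c (D K ?u)) = vscale H (1 / c) (vscale H (D K ?u org) ?u)" by simp
    then have "D K ?u = vscale H (1 / c * D K ?u org) ?u"
      using False D_in[OF KI u] u by (simp add: poly.scale_scale poly.scale_one)
    then show ?thesis by blast
  qed
  obtain \<rho> where \<rho>: "D ?I ?u = vscale H \<rho> ?u" using eigen by blast
  obtain \<mu> where \<mu>: "D J ?u = vscale H \<mu> ?u" using eigen by blast
  have c_u: "vinner H ?u ?u = c" using inner_q[OF org_in u] by (simp add: c_def)
  have "\<rho> * cnj \<mu> * c = vinner H (D ?I ?u) (D J ?u)"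
    using c_u by (simp add: \<rho> \<mu>)
  also have "\<dots> = vinner H (rank1 ?u) ?u"
    using adjpD(3)[OF adjp_D[OF J] D_in[OF I u] u] prod1[OF u] by simp
  also have "\<dots> = c * c"
    using rank1_inner[OF u u] q_hermitian[OF org_in org_in] by (simp add: c_def)
  finally have \<rho>\<mu>: "\<rho> * cnj \<mu> = c" using False by simp
  \<comment> \<open>Outside \<open>K\<close> the coordinates of \<open>v\<close> can be moved to zero by an operator that commutes with \<open>D K\<close>, so \<open>q v\<close> inherits the eigenvalue of \<open>?u\<close>.\<close>
  have eigen_q: "D K (q v) = vscale H (cnj (cnj \<kappa>)) (q v)"
    if K: "K \<subseteq> {1..n}" and \<kappa>: "D K ?u = vscale H \<kappa> ?u" and v: "v \<in> polydisc n" "zero_coords K v = v" for K v \<kappa>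
  proof (rule poly.eq_by_inner_right)
    let ?L = "{1..n} - K"
    have L: "?L \<subseteq> {1..n}" by simp
    obtain G G' where G: "adjp G G'"
      and Gev: "\<And>f x. f \<in> Q \<Longrightarrow> x \<in> polydisc n \<Longrightarrow> (\<forall>j\<in>?L. x j = v j) \<Longrightarrow> f x = G f (zero_coords ?L x)"
      and Gc: "\<And>T T'. adjp T T' \<Longrightarrow> (\<forall>j\<in>?L. comm T (S j)) \<Longrightarrow> comm T G"
      using mover[OF L v(1)] by blast
    have DG: "comm (D K) G" by (rule Gc[OF adjp_D[OF K]]) (use comm_D[OF K] in blast)
    have "zero_coords ?L v = zero_coords {1..n} v"
    proof
      fix j
      show "zero_coords ?L v j = zero_coords {1..n} v j"
        using fun_cong[OF v(2), of j] by (auto simp: zero_coords_def split: if_splits)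
    qed
    then have vo: "zero_coords ?L v = org" using zero_coords_org[OF v(1)] by simp
    have Gv: "f v = G f org" if "f \<in> Q" for f using Gev[OF that v(1)] vo by simp
    have val: "D K f v = cnj \<kappa> * f v" if f: "f \<in> Q" for f
    proof -
      have "D K f v = G (D K f) org" by (rule Gv[OF D_in[OF K f]])
      also have "\<dots> = D K (G f) org" using DG f by (simp add: comm_def)
      also have "\<dots> = vinner H (D K (G f)) ?u"
        using inner_q[OF org_in D_in[OF K adjpD(1)[OF G f]]] by simp
      also have "\<dots> = vinner H (G f) (vscale H \<kappa> ?u)"
        using adjpD(3)[OF adjp_D[OF K] adjpD(1)[OF G f] u] \<kappa> by simp
      also have "\<dots> = cnj \<kappa> * vinner H (G f) ?u"
        using adjpD(1)[OF G f] u by simp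
      also have "\<dots> = cnj \<kappa> * f v" using inner_q[OF org_in adjpD(1)[OF G f]] Gv[OF f] by simp
      finally show ?thesis .
    qed
    fix h assume h: "h \<in> vecs H"
    let ?p = "orth_proj H Q h"
    have p: "?p \<in> Q" by (rule poly.orth_proj_props(1)[OF Q h])
    have Dq: "D K (q v) \<in> Q" by (rule D_in[OF K q_in[OF v(1)]])
    have "vinner H h (D K (q v)) = vinner H ?p (D K (q v))" by (rule poly.orth_proj_inner[OF Q h Dq, symmetric])
    also have "\<dots> = vinner H (D K ?p) (q v)" by (rule adjpD(3)[OF adjp_D[OF K] p q_in[OF v(1)], symmetric])
    also have "\<dots> = cnj \<kappa> * vinner H ?p (q v)"
      using val[OF p] inner_q[OF v(1) D_in[OF K p]] inner_q[OF v(1) p] by simp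
    also have "vinner H ?p (q v) = vinner H h (q v)" by (rule poly.orth_proj_inner[OF Q h q_in[OF v(1)]])
    also have "cnj \<kappa> * vinner H h (q v) = vinner H h (vscale H (cnj (cnj \<kappa>)) (q v))"
      using h q_in[OF v(1)] by simp
    finally show "vinner H h (D K (q v)) = vinner H h (vscale H (cnj (cnj \<kappa>)) (q v))" .
  qed (use D_in[OF K] v in auto)
  have idem: "zero_coords K (zero_coords K v) = zero_coords K v" for K v by (auto simp: zero_coords_def)
  have e1: "D ?I (q ?w1) = vscale H \<rho> (q ?w1)" using eigen_q[OF I \<rho> pts(1) idem] by simp
  have e2: "D J (q ?z2) = vscale H \<mu> (q ?z2)" using eigen_q[OF J \<mu> pts(4) idem] by simp
  \<comment> \<open>\<open>F\<close> moves the coordinate \<open>i\<close> of \<open>w\<close> to zero, and \<open>G\<close> the other coordinates of \<open>z\<close>.\<close>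
  obtain F F' where F: "adjp F F'"
    and Fev: "\<And>f v. f \<in> Q \<Longrightarrow> v \<in> polydisc n \<Longrightarrow> (\<forall>j\<in>?I. v j = w j) \<Longrightarrow> f v = F f (zero_coords ?I v)"
    and Fc: "\<And>T T'. adjp T T' \<Longrightarrow> (\<forall>j\<in>?I. comm T (S j)) \<Longrightarrow> comm T F"
    using mover[OF I w] by blast
  obtain G G' where G: "adjp G G'"
    and Gev: "\<And>f v. f \<in> Q \<Longrightarrow> v \<in> polydisc n \<Longrightarrow> (\<forall>j\<in>J. v j = z j) \<Longrightarrow> f v = G f (zero_coords J v)"
    and Gc: "\<And>T T'. adjp T T' \<Longrightarrow> (\<forall>j\<in>J. comm T (S j)) \<Longrightarrow> comm T G"
    using mover[OF J z] by blast
  have CG: "comm (C Q i) G"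
    by (rule Gc[OF adjp_CS[OF i]]) (use comm_sym[OF comm_SC[OF _ i]] in \<open>auto simp: J_def\<close>)
  have G'S: "comm G' (S i)"
    by (rule comm_sym[OF comm_adj[OF adjp_CS[OF i] G CG]])
  have "comm G' F" by (rule Fc[OF adjp_sym[OF G]]) (use G'S in simp)
  from comm_adj[OF adjp_sym[OF G] F this] have GF': "comm G F'" .
  have "comm (D J) F" by (rule Fc[OF adjp_D[OF J]]) (use comm_D[OF J iJ] in simp)
  from comm_adj[OF adjp_D[OF J] F this] have DF': "comm (D J) F'" .
  have DG: "comm (D ?I) G"
    by (rule Gc[OF adjp_D[OF I]]) (use comm_D[OF I] in \<open>auto simp: J_def\<close>)
  let ?a = "q ?w1" and ?b = "q ?z2"
  have a: "?a \<in> Q" and b: "?b \<in> Q" using pts by auto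
  have qw: "q w = F' ?a"
  proof (rule Q_eqI)
    show "q w \<in> Q" "F' ?a \<in> Q" using w a adjpD(2)[OF F] by auto
    fix h assume h: "h \<in> Q"
    have "vinner H (F' ?a) h = vinner H ?a (F h)" by (rule adjpD(3)[OF adjp_sym[OF F] a h])
    also have "\<dots> = cnj (vinner H (F h) ?a)"
      by (rule poly.inner_commute) (use a h adjpD(1)[OF F] in auto)
    also have "vinner H (F h) ?a = h w"
      using inner_q[OF pts(1) adjpD(1)[OF F h]] Fev[OF h w] by simp
    also have "cnj (h w) = vinner H (q w) h"
      unfolding inner_q[OF w h, symmetric] by (rule poly.inner_commute[symmetric]) (use w h in auto)
    finally show "vinner H (q w) h = vinner H (F' ?a) h" by simp
  qed
  have Ga: "G ?a \<in> Q" and Fb: "F ?b \<in> Q" using adjpD(1)[OF F b] adjpD(1)[OF G a] by auto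
  have "q w z = G (q w) ?z2" using Gev[OF q_in[OF w] z] by simp
  also have "\<dots> = vinner H (G (F' ?a)) ?b"
    using inner_q[OF pts(4) adjpD(1)[OF G q_in[OF w]]] qw by simp
  also have "G (F' ?a) = F' (G ?a)" using GF' a by (simp add: comm_def)
  finally have 1: "q w z = vinner H (F' (G ?a)) ?b" .
  \<comment> \<open>The eigenvalues insert \<open>D J\<close> on the right and \<open>D {i}\<close> on the left; commuting them past \<open>F\<close> and \<open>G\<close> forms the rank one operator in the middle.\<close>
  have "c * q w z = \<rho> * vinner H (F' (G ?a)) (D J ?b)"
    unfolding 1 \<rho>\<mu>[symmetric] e2 using b adjpD(2)[OF F Ga] by simp
  also have "vinner H (F' (G ?a)) (D J ?b) = vinner H (D J (F' (G ?a))) ?b"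
    by (rule adjpD(3)[OF adjp_D[OF J] adjpD(2)[OF F Ga] b, symmetric])
  also have "D J (F' (G ?a)) = F' (D J (G ?a))" using DF' Ga by (simp add: comm_def)
  also have "vinner H (F' (D J (G ?a))) ?b = vinner H (D J (G ?a)) (F ?b)"
    by (rule adjpD(3)[OF adjp_sym[OF F] D_in[OF J Ga] b])
  also have "\<rho> * vinner H (D J (G ?a)) (F ?b) = vinner H (D J (G (vscale H \<rho> ?a))) (F ?b)"
    using adjp_linear(2)[OF G a, of \<rho>] adjp_linear(2)[OF adjp_D[OF J] Ga, of \<rho>] D_in[OF J Ga] Fb by simp
  also have "G (vscale H \<rho> ?a) = D ?I (G ?a)"
    using DG a e1 by (simp add: comm_def)
  also have "D J (D ?I (G ?a)) = rank1 (G ?a)" by (rule prod1[OF Ga])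
  also have "vinner H (rank1 (G ?a)) (F ?b) = G ?a org * cnj (F ?b org)" by (rule rank1_inner[OF Ga Fb])
  also have "G ?a org = ?a ?z1"
  proof -
    have "\<forall>j\<in>J. ?z1 j = z j" by (simp add: zero_coords_def J_def)
    moreover have "zero_coords J ?z1 = org"
      using zero_coords_insert[of i J z] un zero_coords_org[OF z] by simp
    ultimately show ?thesis using Gev[OF a pts(2)] by simp
  qed
  also have "F ?b org = ?b ?w2"
  proof -
    have "\<forall>j\<in>?I. ?w2 j = w j" by (simp add: zero_coords_def J_def)
    moreover have "zero_coords ?I ?w2 = zero_coords {1..n} w"
      unfolding un[symmetric] by (auto simp: zero_coords_def)
    ultimately show ?thesis using Fev[OF b pts(3)] zero_coords_org[OF w] by simp
  qed
  also have "cnj (?b ?w2) = q ?w2 ?z2" by (rule q_hermitian[OF pts(3,4), symmetric])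
  finally show ?thesis .
qed

lemma axis_zero_coords: "z \<in> polydisc n \<Longrightarrow> i \<in> {1..n} \<Longrightarrow> zero_coords ({1..n} - {i}) z = axis i (z i)"
  by (auto simp: zero_coords_def axis_def polydisc_def PiE_iff extensional_def fun_eq_iff)

text \<open>The variables are switched on one at a time; each application of \<open>kernel_split\<close> costs one
  factor \<open>c\<close>.\<close>

lemma kernel_factorization:
  assumes w: "w \<in> polydisc n" and z: "z \<in> polydisc n"
  shows "c ^ n * q w z = c * (\<Prod>i=1..n. q (axis i (w i)) (axis i (z i)))"
proof -
  define P where "P I v = zero_coords ({1..n} - I) v" for I v
  have "c ^ card I * q (P I w) (P I z) = c * (\<Prod>i\<in>I. q (axis i (w i)) (axis i (z i)))"
    if "finite I" "I \<subseteq> {1..n}" for I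
    using that
  proof induction
    case empty
    show ?case using w z by (simp add: P_def zero_coords_org[OF w, simplified] zero_coords_org[OF z, simplified] c_def)
  next
    case (insert i I)
    have i: "i \<in> {1..n}" and I: "I \<subseteq> {1..n}" using insert.prems by auto
    have Pin: "v \<in> polydisc n \<Longrightarrow> P K v \<in> polydisc n" for K v unfolding P_def by (rule zero_coords_in) auto
    have P1: "zero_coords {i} (P (insert i I) v) = P I v" for v
      using insert.hyps i unfolding P_def by (auto simp: zero_coords_def)
    have P2: "zero_coords ({1..n} - {i}) (P (insert i I) v) = axis i (v i)" if "v \<in> polydisc n" for v
      using axis_zero_coords[OF Pin[OF that] i, of "insert i I"] by (simp add: P_def zero_coords_def)
    have "c ^ card (insert i I) * q (P (insert i I) w) (P (insert i I) z) =
        c ^ card I * (c * q (P (insert i I) w) (P (insert i I) z))"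
      using insert.hyps by (simp add: mult_ac)
    also have "\<dots> = (c ^ card I * q (P I w) (P I z)) * q (axis i (w i)) (axis i (z i))"
      unfolding kernel_split[OF i Pin[OF w] Pin[OF z]] P1 P2[OF w] P2[OF z] by simp
    also have "\<dots> = c * (\<Prod>i\<in>insert i I. q (axis i (w i)) (axis i (z i)))"
      unfolding insert.IH[OF I] using insert.hyps by (simp add: mult_ac)
    finally show ?case .
  qed
  from this[of "{1..n}"] show ?thesis by (simp add: P_def zero_coords_def)
qed

section \<open>The tensor factors\<close>

text \<open>The kernel functions of \<open>Q\<close> with node on the \<open>i\<close>-th axis, restricted to that axis. Up to a
  scalar these are the kernel functions of the tensor factor \<open>B i\<close>.\<close>

definition g :: "nat \<Rightarrow> complex \<Rightarrow> complex \<Rightarrow> complex" where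
  "g i a = R i (q (axis i a))"

definition B :: "nat \<Rightarrow> (complex \<Rightarrow> complex) set" where
  "B i = closed_subspace (A i) hull (g i ` unit_disc)"

lemma g_in: "i \<in> {1..n} \<Longrightarrow> a \<in> unit_disc \<Longrightarrow> g i a \<in> vecs (A i)"
  unfolding g_def by (intro R_in QH q_in axis_in)

lemma B_closed: "i \<in> {1..n} \<Longrightarrow> closed_subspace (A i) (B i)"
  unfolding B_def by (rule disc.hull_closed_subspace) (use g_in in blast)

lemma g_B: "a \<in> unit_disc \<Longrightarrow> g i a \<in> B i"
  unfolding B_def by (rule hull_inc) blast

lemma B_induct: "closed_subspace (A i) P \<Longrightarrow> (\<And>a. a \<in> unit_disc \<Longrightarrow> g i a \<in> P) \<Longrightarrow> B i \<subseteq> P"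
  unfolding B_def by (rule hull_minimal) auto

text \<open>The projection to \<open>Q\<close> of a function orthogonal to all \<open>q w\<close> vanishes at every point.\<close>

lemma q_total:
  assumes P: "closed_subspace H P" and "\<And>w. w \<in> polydisc n \<Longrightarrow> q w \<in> P"
  shows "Q \<subseteq> P"
proof
  fix f assume f: "f \<in> Q"
  show "f \<in> P"
  proof (rule poly.mem_double_orth[OF P QH[OF f]])
    fix y assume y: "y \<in> orth_complement H P"
    then have yH: "y \<in> vecs H" by (simp add: orth_complement_def)
    have p: "orth_proj H Q y \<in> Q" by (rule poly.orth_proj_props(1)[OF Q yH])
    have "orth_proj H Q y = vzero H"
    proof (rule poly.fun_eqI[where m = m])
      fix w assume w: "w \<in> polydisc n"
      have "orth_proj H Q y w = vinner H y (q w)"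
        using inner_q[OF w p] poly.orth_proj_inner[OF Q yH q_in[OF w]] by simp
      also have "\<dots> = 0" using y assms(2)[OF w] by (simp add: orth_complement_def)
      finally show "orth_proj H Q y w = vzero H w" by (simp add: poly.zero_at)
    qed (use p in simp_all)
    then show "vinner H f y = 0"
      using poly.orth_proj_inner_right[OF Q yH f] f by simp
  qed
qed

text \<open>The factorisation of the kernel with one factor \<open>c\<close> cancelled; for \<open>c = 0\<close> both sides
  vanish, as \<open>n \<ge> 1\<close>.\<close>

lemma et_g:
  assumes w: "w \<in> polydisc n"
  shows "et (\<lambda>i. g i (w i)) = vscale H (c ^ (n - 1)) (q w)"
proof
  fix z
  show "et (\<lambda>i. g i (w i)) z = vscale H (c ^ (n - 1)) (q w) z"
  proof (cases "z \<in> polydisc n")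
    case True
    have val: "et (\<lambda>i. g i (w i)) z = (\<Prod>i=1..n. q (axis i (w i)) (axis i (z i)))"
      unfolding elementary_tensor_def
      using True polydiscD[OF True] by (auto simp: g_def R_def intro!: prod.cong)
    show ?thesis
    proof (cases "c = 0")
      case c0: True
      have zero: "f \<in> Q \<Longrightarrow> f v = 0" for f v using c_zero_imp[OF c0, of f] by (simp add: poly.zero_at)
      have "q (axis 1 (w 1)) (axis 1 (z 1)) = 0"
        by (rule zero) (use polydiscD[OF w, of 1] n_pos in auto)
      then have "(\<Prod>i=1..n. q (axis i (w i)) (axis i (z i))) = 0"
        using n_pos by (intro prod_zero) auto
      then show ?thesis using val zero[OF q_in[OF w]] by (simp add: poly.scale_at)
    next
      case c1: False
      have "c * (c ^ (n - 1) * q w z) = c ^ n * q w z"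
        using n_pos by (cases n) (auto simp: mult_ac)
      also have "\<dots> = c * et (\<lambda>i. g i (w i)) z" unfolding val by (rule kernel_factorization[OF w True])
      finally show ?thesis using c1 by (simp add: poly.scale_at)
    qed
  next
    case False
    then show ?thesis using poly.off_zero[OF QH[OF q_in[OF w]] False]
      by (simp add: elementary_tensor_def poly.scale_at)
  qed
qed

lemma R_q:
  assumes i: "i \<in> {1..n}" and w: "w \<in> polydisc n"
  shows "R i (q w) \<in> B i"
proof (cases "c = 0")
  case True
  have "q w = vzero H" by (rule c_zero_imp[OF True q_in[OF w]])
  then have "R i (q w) = vzero (A i)" by (auto simp: R_def poly.zero_at disc.ops)
  then show ?thesis using disc.closed_subspaceD(2)[OF B_closed[OF i]] by simp
next
  case False
  have "R i (q w) = vscale (A i) (q (zero_coords {i} w) org / c) (g i (w i))"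
  proof
    fix a
    show "R i (q w) a = vscale (A i) (q (zero_coords {i} w) org / c) (g i (w i)) a"
    proof (cases "a \<in> unit_disc")
      case True
      have "zero_coords {i} (axis i a) = org" using i by (auto simp: zero_coords_def axis_def org_def fun_eq_iff)
      then have "c * q w (axis i a) = q (zero_coords {i} w) org * q (axis i (w i)) (axis i a)"
        using kernel_split[OF i w axis_in[OF True]] axis_zero_coords[OF w i]
          axis_zero_coords[OF axis_in[OF True] i] axis_at[OF i] by simp
      then show ?thesis using False True by (simp add: R_def g_def disc.scale_at field_simps)
    qed (simp add: R_def g_def disc.scale_at)
  qed
  moreover have "g i (w i) \<in> B i" by (rule g_B[OF polydiscD[OF w i]])
  ultimately show ?thesis using disc.closed_subspaceD(4)[OF B_closed[OF i]] by simp
qed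

lemma R_Q: "i \<in> {1..n} \<Longrightarrow> f \<in> Q \<Longrightarrow> R i f \<in> B i"
proof -
  assume i: "i \<in> {1..n}" and f: "f \<in> Q"
  have "Q \<subseteq> {f \<in> vecs H. R i f \<in> B i}"
    by (rule q_total[OF preimage_closed_subspace[OF poly.inner_product_space_axioms
          disc.inner_product_space_axioms bounded_R[OF i] B_closed[OF i]]])
      (use R_q[OF i] in simp)
  with f show ?thesis by blast
qed

text \<open>Restriction intertwines the adjoint shifts, and maps \<open>Q\<close> into \<open>B i\<close>.\<close>

lemma B_quotient: "i \<in> {1..n} \<Longrightarrow> quotient_module_1 (m i) (B i)"
  unfolding quotient_module_1_def
proof (intro conjI ballI)
  assume i: "i \<in> {1..n}"
  show "closed_subspace (A i) (B i)" by (rule B_closed[OF i])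
  fix f assume f: "f \<in> B i"
  have "B i \<subseteq> {f \<in> vecs (A i). shift_adj (m i) f \<in> B i}"
  proof (rule B_induct)
    show "closed_subspace (A i) {f \<in> vecs (A i). shift_adj (m i) f \<in> B i}"
      by (rule preimage_closed_subspace[OF disc.inner_product_space_axioms disc.inner_product_space_axioms
            adj_bounded_op[OF disc.hilbert_space_axioms disc.hilbert_space_axioms bounded_mult_z[OF m_pos[OF i]]] B_closed[OF i]])
    fix a assume a: "a \<in> unit_disc"
    have "shift_adj (m i) (g i a) = R i (S i (q (axis i a)))"
      unfolding g_def by (rule R_S[OF i, symmetric]) (use a in simp)
    also have "\<dots> \<in> B i" by (rule R_Q[OF i SQ[OF i]]) (use a in simp)
    finally show "g i a \<in> {f \<in> vecs (A i). shift_adj (m i) f \<in> B i}" using g_in[OF i a] by simp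
  qed
  with f show "shift_adj (m i) f \<in> B i" by blast
qed

lemma B_in: "i \<in> {1..n} \<Longrightarrow> f \<in> B i \<Longrightarrow> f \<in> vecs (A i)"
  using disc.closed_subspaceD(1)[OF B_closed] .

text \<open>Starting from the generators \<open>g\<close>, one slot at a time is extended to \<open>B j\<close>; the set \<open>I\<close>
  collects the slots already extended.\<close>

lemma et_B_in_Q:
  assumes "finite I" and "I \<subseteq> {1..n}" and "\<And>j. j \<in> {1..n} \<Longrightarrow> f j \<in> B j"
    and "\<And>j. j \<in> {1..n} - I \<Longrightarrow> f j \<in> g j ` unit_disc"
  shows "et f \<in> Q"
  using assms
proof (induction I arbitrary: f)
  case empty
  then have "\<forall>j\<in>{1..n}. \<exists>a. a \<in> unit_disc \<and> f j = g j a" by blast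
  then obtain a where a: "\<And>j. j \<in> {1..n} \<Longrightarrow> a j \<in> unit_disc \<and> f j = g j (a j)" by metis
  define w where "w = restrict a {1..n}"
  have w: "w \<in> polydisc n" using a by (auto simp: w_def polydisc_def)
  have "et f = et (\<lambda>i. g i (w i))" by (rule et_cong) (use a in \<open>simp add: w_def\<close>)
  also have "\<dots> \<in> Q" unfolding et_g[OF w] by (rule poly.closed_subspaceD(4)[OF Q q_in[OF w]])
  finally show ?case .
next
  case (insert i I)
  have i: "i \<in> {1..n}" and I: "I \<subseteq> {1..n}" using insert.prems by auto
  have "B i \<subseteq> {h \<in> vecs (A i). et (f(i := h)) \<in> Q}"
  proof (rule B_induct)
    have "bounded_op (A i) H (\<lambda>h. et (f(i := h)))"
      by (rule bounded_slot[OF i]) (use insert.prems(2) B_in in blast)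
    then show "closed_subspace (A i) {h \<in> vecs (A i). et (f(i := h)) \<in> Q}"
      by (rule preimage_closed_subspace[OF disc.inner_product_space_axioms poly.inner_product_space_axioms _ Q])
    fix a assume a: "a \<in> unit_disc"
    have "et (f(i := g i a)) \<in> Q"
    proof (rule insert.IH[OF I])
      show "(f(i := g i a)) j \<in> B j" if "j \<in> {1..n}" for j using insert.prems(2)[OF that] g_B[OF a] by simp
      show "(f(i := g i a)) j \<in> g j ` unit_disc" if "j \<in> {1..n} - I" for j
        using insert.prems(3)[of j] that a by (cases "j = i") auto
    qed
    then show "g i a \<in> {h \<in> vecs (A i). et (f(i := h)) \<in> Q}" using g_in[OF i a] by simp
  qed
  then have "et (f(i := f i)) \<in> Q" using insert.prems(2)[OF i] by blast
  then show ?case by (simp only: fun_upd_triv)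
qed

text \<open>Up to a scalar, the kernel functions of \<open>Q\<close> are the elementary tensors of generators of
  the factors.\<close>

theorem module_eq_tensor: "Q = tensor_subspace n m B"
proof
  have T: "closed_subspace H (tensor_subspace n m B)" by (rule tensor_closed[OF B_closed])
  show "Q \<subseteq> tensor_subspace n m B"
  proof (rule q_total[OF T])
    fix w assume w: "w \<in> polydisc n"
    show "q w \<in> tensor_subspace n m B"
    proof (cases "c = 0")
      case True
      then show ?thesis using c_zero_imp[OF True q_in[OF w]] poly.closed_subspaceD(2)[OF T] by simp
    next
      case False
      have "et (\<lambda>i. g i (w i)) \<in> tensor_subspace n m B"
        by (rule tensor_generator) (use g_B polydiscD[OF w] in blast)
      then have "vscale H (1 / c ^ (n - 1)) (vscale H (c ^ (n - 1)) (q w)) \<in> tensor_subspace n m B"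
        unfolding et_g[OF w] by (rule poly.closed_subspaceD(4)[OF T])
      then show ?thesis using False w by (simp add: poly.scale_scale poly.scale_one)
    qed
  qed
  show "tensor_subspace n m B \<subseteq> Q"
    by (rule tensor_induct[OF Q]) (rule et_B_in_Q[of "{1..n}"], auto)
qed

end

section \<open>Functions in Bergman spaces are holomorphic\<close>

lemma norm_bergman_kernel_le:
  assumes "\<rho> < 1" and z: "cmod z \<le> \<rho>"
  shows "vnorm (bergman k) (disc.kf k z) \<le> sqrt (1 / (1 - \<rho>\<^sup>2) ^ k)"
proof -
  have z1: "z \<in> unit_disc" using assms by simp
  have "(cmod z)\<^sup>2 \<le> \<rho>\<^sup>2" using z by (intro power_mono) auto
  moreover have "\<rho>\<^sup>2 < 1"
    using assms(1) order_trans[OF norm_ge_zero z] by (simp add: abs_square_less_1)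
  ultimately have "1 / (1 - (cmod z)\<^sup>2) ^ k \<le> 1 / (1 - \<rho>\<^sup>2) ^ k"
    by (intro divide_left_mono power_mono mult_pos_pos zero_less_power) auto
  moreover have "vinner (bergman k) (disc.kf k z) (disc.kf k z) = of_real (1 / (1 - (cmod z)\<^sup>2) ^ k)"
    unfolding disc.inner_kf(1)[OF z1 disc.kf_in[OF z1]]
    using z1 by (simp add: disc.kf_def bergman_kernel_def complex_norm_square[symmetric])
  ultimately show ?thesis by (simp add: vnorm_def)
qed

lemma locally_bounded_evaluation:
  assumes "x \<in> unit_disc"
  obtains d C where "0 < d" "cball x d \<subseteq> unit_disc" "0 \<le> C"
    "\<And>f z. f \<in> vecs (bergman k) \<Longrightarrow> z \<in> cball x d \<Longrightarrow> cmod (f z) \<le> C * vnorm (bergman k) f"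
proof -
  define d where "d = (1 - cmod x) / 2"
  define \<rho> where "\<rho> = (1 + cmod x) / 2"
  have d: "0 < d" and \<rho>: "\<rho> < 1" "0 \<le> \<rho>" using assms by (auto simp: d_def \<rho>_def)
  have z\<rho>: "cmod z \<le> \<rho>" if "z \<in> cball x d" for z
  proof -
    have "cmod z \<le> cmod x + cmod (z - x)" by (metis add.commute norm_triangle_sub)
    also have "\<dots> \<le> cmod x + d" using that by (simp add: dist_norm norm_minus_commute)
    finally show ?thesis by (simp add: d_def \<rho>_def field_simps)
  qed
  then have sub: "cball x d \<subseteq> unit_disc" using \<rho> by fastforce
  have "\<rho>\<^sup>2 < 1" using \<rho> by (simp add: abs_square_less_1)
  then have C0: "0 \<le> sqrt (1 / (1 - \<rho>\<^sup>2) ^ k)" by simp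
  have "cmod (f z) \<le> sqrt (1 / (1 - \<rho>\<^sup>2) ^ k) * vnorm (bergman k) f"
    if f: "f \<in> vecs (bergman k)" and z: "z \<in> cball x d" for f z
    using disc.eval_bounded[of z f k] f sub z norm_bergman_kernel_le[OF \<rho>(1) z\<rho>[OF z], of k]
      mult_right_mono[OF norm_bergman_kernel_le[OF \<rho>(1) z\<rho>[OF z], of k], of "vnorm (bergman k) f"]
    by (meson disc.norm_nonneg order_trans subsetD)
  with d sub C0 show ?thesis using that by blast
qed

text \<open>Kernel functions are holomorphic, and convergence in norm is locally uniform because
  evaluation is locally uniformly bounded.\<close>

lemma bergman_holomorphic:
  assumes "f \<in> vecs (bergman k)"
  shows "f holomorphic_on unit_disc"
proof -
  let ?P = "{f \<in> vecs (bergman k). f holomorphic_on unit_disc}"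
  have "closed_subspace (bergman k) ?P"
    unfolding disc.closed_subspace_iff
  proof (intro conjI allI impI; (elim conjE)?)
    fix F f assume F: "\<forall>j. F j \<in> ?P" and lim: "disc.tends_to k F f"
    have f: "f \<in> vecs (bergman k)" using lim by (simp add: disc.tends_to_def)
    have "f holomorphic_on unit_disc"
    proof (rule holomorphic_uniform_sequence[of _ F])
      fix x :: complex assume "x \<in> unit_disc"
      then obtain d C where d: "0 < d" "cball x d \<subseteq> unit_disc" "0 \<le> C" and
        C: "\<And>f z. f \<in> vecs (bergman k) \<Longrightarrow> z \<in> cball x d \<Longrightarrow> cmod (f z) \<le> C * vnorm (bergman k) f"
        using locally_bounded_evaluation[where k = k] by metis
      have "uniform_limit (cball x d) F f sequentially"
        unfolding uniform_limit_iff
      proof (intro allI impI)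
        fix e :: real assume e: "0 < e"
        have "(\<lambda>j. vnorm (bergman k) (vminus (bergman k) (F j) f)) \<longlonglongrightarrow> 0"
          using lim by (simp add: disc.tends_to_def)
        then have "\<forall>\<^sub>F j in sequentially. vnorm (bergman k) (vminus (bergman k) (F j) f) < e / (C + 1)"
          using order_tendstoD(2)[of _ 0 sequentially "e / (C + 1)"] e d(3) by simp
        then show "\<forall>\<^sub>F j in sequentially. \<forall>z\<in>cball x d. dist (F j z) (f z) < e"
        proof eventually_elim
          case (elim j)
          show ?case
          proof
            fix z assume z: "z \<in> cball x d"
            let ?h = "vminus (bergman k) (F j) f"
            have h: "?h \<in> vecs (bergman k)" using F f by simp
            have "dist (F j z) (f z) = cmod (?h z)" by (simp add: dist_norm disc.ops)
            also have "\<dots> \<le> C * vnorm (bergman k) ?h" by (rule C[OF h z])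
            also have "\<dots> \<le> (C + 1) * vnorm (bergman k) ?h" using h by (intro mult_right_mono) auto
            also have "\<dots> < e" using elim d(3) by (simp add: field_simps)
            finally show "dist (F j z) (f z) < e" .
          qed
        qed
      qed
      with d show "\<exists>d. 0 < d \<and> cball x d \<subseteq> unit_disc \<and> uniform_limit (cball x d) F f sequentially" by blast
    qed (use F in auto)
    with f show "f \<in> ?P" by simp
  next
    show "vzero (bergman k) \<in> ?P" using disc.zero_closed[of k] by (simp add: disc.ops)
  next
    show "\<forall>x\<in>?P. \<forall>y\<in>?P. vadd (bergman k) x y \<in> ?P"
    proof (intro ballI)
      fix x y assume xy: "x \<in> ?P" "y \<in> ?P"
      have "vadd (bergman k) x y holomorphic_on unit_disc"
        unfolding disc.ops using xy by (intro holomorphic_intros) auto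
      then show "vadd (bergman k) x y \<in> ?P" using xy by simp
    qed
  next
    fix c
    show "\<forall>x\<in>?P. vscale (bergman k) c x \<in> ?P"
    proof
      fix x assume x: "x \<in> ?P"
      have "vscale (bergman k) c x holomorphic_on unit_disc"
        unfolding disc.ops using x by (intro holomorphic_intros) auto
      then show "vscale (bergman k) c x \<in> ?P" using x by simp
    qed
  qed auto
  moreover have "disc.kf k ` unit_disc \<subseteq> ?P"
  proof safe
    fix w :: complex assume w: "w \<in> unit_disc"
    show "disc.kf k w \<in> vecs (bergman k)" using w by simp
    have "(\<lambda>z. bergman_kernel k z w) holomorphic_on unit_disc"
      unfolding bergman_kernel_def
      by (intro holomorphic_intros) (use disc_kernel_nonzero w in auto)
    then show "disc.kf k w holomorphic_on unit_disc"
      by (rule holomorphic_transform) (simp add: disc.kf_def)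
  qed
  ultimately have "?P = vecs (bergman k)" by (rule disc.total_subspace[OF disc.total_kf])
  with assms show ?thesis by blast
qed

text \<open>A remainder estimate that is linear in the bound \<open>B\<close>: with \<open>B\<close> proportional to the norm of
  \<open>f\<close> it gives differentiability of point evaluation in operator norm.\<close>

lemma second_order_taylor_bound:
  assumes d: "0 < d" and f: "f holomorphic_on U" and U: "open U" "cball z d \<subseteq> U"
    and B: "\<And>x. x \<in> cball z d \<Longrightarrow> cmod (f x) \<le> B" and w: "cmod (w - z) \<le> d / 2"
  shows "cmod (f w - f z - (w - z) * deriv f z) \<le> (8 * B / d\<^sup>2) * (cmod (w - z))\<^sup>2"
    and "cmod (deriv f z) \<le> B / d"
proof -
  have sub: "cball x r \<subseteq> U" if "dist z x + r \<le> d" for x r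
  proof
    fix y assume "y \<in> cball x r"
    then have "dist z y \<le> d" using that dist_triangle[of z y x] by simp
    then show "y \<in> U" using U(2) by auto
  qed
  have cauchy: "cmod ((deriv ^^ j) f x) \<le> fact j * B / r ^ j" if x: "dist z x + r \<le> d" and r: "0 < r" for j x r
  proof (rule Cauchy_inequality)
    show "f holomorphic_on ball x r"
      using holomorphic_on_subset[OF f] sub[OF x] ball_subset_cball by blast
    show "continuous_on (cball x r) f"
      using holomorphic_on_imp_continuous_on[OF holomorphic_on_subset[OF f sub[OF x]]] .
    fix y assume "cmod (x - y) = r"
    then have "dist z y \<le> d" using x dist_triangle[of z y x] by (simp add: dist_norm)
    then show "cmod (f y) \<le> B" using B by simp
  qed (rule r)
  show "cmod (deriv f z) \<le> B / d" using cauchy[of z d 1] d by simp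
  let ?S = "cball z (d / 2)"
  have SU: "?S \<subseteq> U" using sub[of z "d / 2"] d by simp
  have "cmod ((deriv ^^ 0) f w - (\<Sum>i\<le>1. (deriv ^^ i) f z * (w - z) ^ i / fact i)) \<le>
      (8 * B / d\<^sup>2) * cmod (w - z) ^ Suc 1 / fact 1"
  proof (rule complex_Taylor[of ?S])
    fix i x assume x: "x \<in> ?S"
    have "(deriv ^^ i) f holomorphic_on U" by (rule holomorphic_higher_deriv[OF f U(1)])
    from holomorphic_derivI[OF this U(1)] x SU
    show "((deriv ^^ i) f has_field_derivative (deriv ^^ Suc i) f x) (at x within ?S)" by auto
  next
    fix x assume "x \<in> ?S"
    then have "cmod ((deriv ^^ Suc 1) f x) \<le> fact (Suc 1) * B / (d / 2) ^ Suc 1"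
      by (intro cauchy) (use d in auto)
    then show "cmod ((deriv ^^ Suc 1) f x) \<le> 8 * B / d\<^sup>2"
      by (simp add: power2_eq_square field_simps)
  qed (use w d in \<open>auto simp: dist_norm norm_minus_commute\<close>)
  then show "cmod (f w - f z - (w - z) * deriv f z) \<le> (8 * B / d\<^sup>2) * (cmod (w - z))\<^sup>2"
    by (simp add: power2_eq_square algebra_simps)
qed

section \<open>Gram kernels and change of carrier\<close>

context inner_product_space
begin

definition lsum :: "('x \<Rightarrow> 'a) \<Rightarrow> ('x \<times> complex) list \<Rightarrow> 'a" where
  "lsum v p = foldr (\<lambda>(w, \<eta>). vadd H (vscale H \<eta> (v w))) p (vzero H)"

lemma lsum_simps [simp]: "lsum v [] = vzero H" "lsum v ((w, \<eta>) # p) = vadd H (vscale H \<eta> (v w)) (lsum v p)"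
  by (simp_all add: lsum_def)

lemma lsum_in: "v ` X \<subseteq> vecs H \<Longrightarrow> p \<in> nodes X complex_line \<Longrightarrow> lsum v p \<in> vecs H"
  by (erule lists.induct) auto

lemma inner_lsum:
  assumes v: "v ` X \<subseteq> vecs H" and q: "q \<in> nodes X complex_line" and x: "x \<in> vecs H"
  shows "vinner H x (lsum v q) = (\<Sum>(w, \<zeta>)\<leftarrow>q. vinner H x (v w) * cnj \<zeta>)"
  using q
proof induction
  case (Cons a q)
  then show ?case using lsum_in[OF v Cons.hyps(2)] v x by (cases a) auto
qed (use x in simp)

text \<open>Inner products of vectors form a positive kernel, and \<open>lsum\<close> realises its Gram form.\<close>

lemma gram_lsum:
  assumes v: "v ` X \<subseteq> vecs H" and p: "p \<in> nodes X complex_line" and q: "q \<in> nodes X complex_line"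
  shows "vinner H (lsum v p) (lsum v q) = kernel_gram (\<lambda>z w. vinner H (v w) (v z)) complex_line p q"
  using p
proof induction
  case Nil then show ?case using lsum_in[OF v q] by simp
next
  case (Cons a p)
  then obtain w \<eta> where a: "a = (w, \<eta>)" "w \<in> X" by auto
  have vw: "v w \<in> vecs H" using v a by auto
  have "vinner H (vscale H \<eta> (v w)) (lsum v q) = (\<Sum>(z, \<zeta>)\<leftarrow>q. vinner H (v w) (v z) * (\<eta> * cnj \<zeta>))"
    unfolding inner_lsum[OF v q scale_closed[OF vw]]
    by (rule arg_cong[of _ _ sum_list], rule map_cong[OF refl]) (use q vw v in \<open>auto simp: lists_eq_set image_subset_iff subset_iff\<close>)
  then show ?case
    using Cons lsum_in[OF v q] lsum_in[OF v Cons.hyps(2)] vw by (simp add: a kernel_gram_def)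
qed

lemma positive_kernel_gram:
  assumes v: "v ` X \<subseteq> vecs H"
  shows "positive_kernel complex_line X (\<lambda>z w. vinner H (v w) (v z))"
proof (rule positive_kernelI[OF hilbert_complex_line])
  show "vinner H (v z) (v w) = cnj (vinner H (v w) (v z))" if "z \<in> X" "w \<in> X" for z w
    by (rule inner_commute) (use v that in auto)
  show "0 \<le> Re (kernel_gram (\<lambda>z w. vinner H (v w) (v z)) complex_line p p)" if "p \<in> nodes X complex_line" for p
    using inner_nonneg[OF lsum_in[OF v that]] gram_lsum[OF v that that] by simp
qed

end

text \<open>The space \<open>G\<close> carried over to another type of vectors along an injection \<open>e\<close>.\<close>

definition transport :: "('a \<Rightarrow> 'b) \<Rightarrow> 'a hspace \<Rightarrow> 'b hspace" where
  "transport e G = (let d = inv_into (vecs G) e in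
    \<lparr>vecs = e ` vecs G, vadd = \<lambda>x y. e (vadd G (d x) (d y)), vzero = e (vzero G),
     vscale = \<lambda>c x. e (vscale G c (d x)), vinner = \<lambda>x y. vinner G (d x) (d y)\<rparr>)"

lemma transport_hilbert_space:
  assumes "hilbert_space G" and inj: "inj_on e (vecs G)"
  shows "hilbert_space (transport e G)"
proof -
  interpret G: hilbert_space G by fact
  have d [simp]: "x \<in> vecs G \<Longrightarrow> inv_into (vecs G) e (e x) = x" for x using inj by simp
  have sel: "vecs (transport e G) = e ` vecs G"
    "vadd (transport e G) = (\<lambda>x y. e (vadd G (inv_into (vecs G) e x) (inv_into (vecs G) e y)))"
    "vzero (transport e G) = e (vzero G)"
    "vscale (transport e G) = (\<lambda>c x. e (vscale G c (inv_into (vecs G) e x)))"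
    "vinner (transport e G) = (\<lambda>x y. vinner G (inv_into (vecs G) e x) (inv_into (vecs G) e y))"
    by (simp_all add: transport_def Let_def)
  interpret T: inner_product_space "transport e G"
    by unfold_locales
      (auto simp: sel G.add_assoc G.add_zero G.scale_add_left G.scale_add_right G.scale_scale G.scale_one
        G.scale_zero G.inner_nonneg dest: G.inner_eq_zero intro: arg_cong[where f = e, OF G.add_commute] G.inner_commute)
  show ?thesis
  proof (rule T.hilbert_spaceI)
    fix f :: "nat \<Rightarrow> 'b" assume f: "\<And>k. f k \<in> vecs (transport e G)" and
      c: "\<And>\<epsilon>. \<epsilon> > 0 \<Longrightarrow> \<exists>N. \<forall>i\<ge>N. \<forall>j\<ge>N. vnorm (transport e G) (vminus (transport e G) (f i) (f j)) < \<epsilon>"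
    have "\<forall>k. \<exists>x. x \<in> vecs G \<and> f k = e x" using f by (auto simp: sel)
    then obtain h where h: "\<And>k. h k \<in> vecs G" "\<And>k. f k = e (h k)" by metis
    have norm: "vnorm (transport e G) (vminus (transport e G) (e x) (e y)) = vnorm G (vminus G x y)"
      if "x \<in> vecs G" "y \<in> vecs G" for x y
      using that by (simp add: vnorm_def sel)
    obtain x where x: "G.tends_to h x"
      using G.cauchy_tends_to[of h] c h norm by auto
    then have "T.tends_to f (e x)"
      using h norm by (simp add: G.tends_to_def T.tends_to_def sel)
    then show "\<exists>x. T.tends_to f x" by blast
  qed
qed

section \<open>Quotients by partially isometric multipliers\<close>

lemma hardy_positive: "hilbert_space E \<Longrightarrow> positive_kernel E unit_disc (bergman_kernel 1)"
  using positive_kernel_bergman_factor[OF positive_kernel_one, where \<phi> = id and k = 1 and X = unit_disc] by simp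

text \<open>The range of \<open>M\<^sub>\<theta>\<close> is invariant under the shift, since \<open>z \<theta> f = \<theta> (z f)\<close>, so its
  orthogonal complement is invariant under the adjoint.\<close>

lemma multiplier_quotient_is_quotient_module:
  assumes k: "k \<ge> 1" and E: "hilbert_space E" and \<theta>: "\<theta> \<in> multipliers k E"
  shows "quotient_module_1 k (multiplier_quotient k E \<theta>)"
proof -
  interpret E: hilbert_space E by fact
  interpret K: positive_kernel E unit_disc "bergman_kernel 1" by (rule hardy_positive[OF E])
  have hardy: "hardy E = rkhs unit_disc (bergman_kernel 1) E" by (simp add: bergman_vec_def)
  let ?S = "mult_op \<theta> ` vecs (hardy E)"
  have S: "?S \<subseteq> vecs (bergman k)" using \<theta> by (auto simp: multipliers_def)
  have shift: "mult_z (mult_op \<theta> f) \<in> ?S" if f: "f \<in> vecs (hardy E)" for f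
  proof -
    let ?zf = "\<lambda>z. if z \<in> unit_disc then vscale E (id z) (f (id z)) else vzero E"
    have D: "positive_kernel E unit_disc (\<lambda>z w. of_real (1\<^sup>2) * bergman_kernel 1 z w - id z * cnj (id w) * bergman_kernel 1 (id z) (id w))"
    proof (rule positive_kernel_cong[OF positive_kernel_one[OF E]])
      fix z w assume "z \<in> unit_disc" "w \<in> unit_disc"
      then have "(1 - z * cnj w) * bergman_kernel 1 z w = 1" using disc_kernel_nonzero[of z w] by (simp add: bergman_kernel_def)
      then show "of_real (1\<^sup>2) * bergman_kernel 1 z w - id z * cnj (id w) * bergman_kernel 1 (id z) (id w) = 1"
        by (simp add: left_diff_distrib)
    qed
    have zf: "?zf \<in> vecs (hardy E)"
      unfolding hardy
      by (rule weighted_composition_in(1)[OF K.positive_kernel_axioms K.positive_kernel_axioms _ _ D])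
        (use f hardy in auto)
    have eq: "mult_op \<theta> ?zf = mult_z (mult_op \<theta> f)"
    proof
      fix z
      show "mult_op \<theta> ?zf z = mult_z (mult_op \<theta> f) z"
      proof (cases "z \<in> unit_disc")
        case True
        then have "f z \<in> vecs E" using K.rkhs_functions[of f] f hardy by (auto simp: functions_on_def)
        moreover have "linear_op E complex_line (\<theta> z)"
          using \<theta> True by (auto simp: multipliers_def holomorphic_functionals_def bounded_op_def)
        ultimately show ?thesis using True by (simp add: mult_op_def mult_z_def linear_op_def)
      qed (simp add: mult_op_def mult_z_def)
    qed
    show ?thesis unfolding eq[symmetric] by (rule imageI[OF zf])
  qed
  show ?thesis
    unfolding quotient_module_1_def multiplier_quotient_def
  proof (intro conjI ballI)
    show "closed_subspace (bergman k) (orth_complement (bergman k) ?S)" by (rule disc.orth_complement_closed[OF S])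
    fix g assume g: "g \<in> orth_complement (bergman k) ?S"
    then have gH: "g \<in> vecs (bergman k)" by (simp add: orth_complement_def)
    note p = adj_props[OF disc.hilbert_space_axioms disc.inner_product_space_axioms bounded_mult_z[OF k] gH]
    show "shift_adj k g \<in> orth_complement (bergman k) ?S"
      unfolding orth_complement_def
    proof (intro CollectI conjI ballI)
      fix y assume y: "y \<in> ?S"
      then have yH: "y \<in> vecs (bergman k)" and zy: "mult_z y \<in> ?S" using S shift by auto
      have "vinner (bergman k) g (mult_z y) = 0" using g zy by (auto simp: orth_complement_def)
      then have "vinner (bergman k) (mult_z y) g = 0"
        using disc.inner_eq_zero_commute[OF gH, of "mult_z y"] subsetD[OF S zy] by simp
      then have "vinner (bergman k) y (shift_adj k g) = 0" using p(2)[OF yH] by simp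
      then show "vinner (bergman k) (shift_adj k g) y = 0"
        using disc.inner_eq_zero_commute[OF p(1) yH] by simp
    qed (rule p(1))
  qed
qed

lemma transport_simps:
  "vecs (transport e G) = e ` vecs G"
  "vinner (transport e G) x y = vinner G (inv_into (vecs G) e x) (inv_into (vecs G) e y)"
  "vadd (transport e G) x y = e (vadd G (inv_into (vecs G) e x) (inv_into (vecs G) e y))"
  "vscale (transport e G) c x = e (vscale G c (inv_into (vecs G) e x))"
  by (simp_all add: transport_def Let_def)

text \<open>The construction of a multiplier for a quotient module \<open>Rm\<close> of the disc: \<open>N\<close> is the
  complementary submodule, \<open>KN\<close> its kernel, and \<open>L\<close> the kernel of the coefficient space, which
  has to satisfy \<open>L(z,w) = \<theta>(z) \<theta>(w)\<^sup>*\<close>.\<close>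

locale disc_quotient =
  fixes k :: nat and Rm :: "(complex \<Rightarrow> complex) set"
  assumes k: "k \<ge> 1" and Rm: "quotient_module_1 k Rm"
begin

abbreviation "H \<equiv> bergman k"
abbreviation "kf \<equiv> disc.kf k"

definition N where "N = orth_complement H Rm"
abbreviation "P \<equiv> orth_proj H N"
definition v where "v w = P (kf w)"
definition KN where "KN z w = vinner H (v w) (v z)"
definition L where "L z w = (1 - z * cnj w) * KN z w"

lemma Rm_closed: "closed_subspace H Rm" and Rm_shift: "f \<in> Rm \<Longrightarrow> shift_adj k f \<in> Rm"
  using Rm by (auto simp: quotient_module_1_def)

lemma N_closed: "closed_subspace H N"
  unfolding N_def by (rule disc.orth_complement_closed) (use disc.closed_subspaceD(1)[OF Rm_closed] in blast)

lemma N_in: "f \<in> N \<Longrightarrow> f \<in> vecs H"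
  by (rule disc.closed_subspaceD(1)[OF N_closed])

lemma N_orth: "f \<in> N \<Longrightarrow> g \<in> Rm \<Longrightarrow> vinner H f g = 0"
  by (simp add: N_def orth_complement_def)

lemma orth_N: "f \<in> vecs H \<Longrightarrow> (\<And>g. g \<in> N \<Longrightarrow> vinner H f g = 0) \<Longrightarrow> f \<in> Rm"
  using disc.mem_double_orth[OF Rm_closed] by (simp add: N_def)

lemma mz_in [simp]: "f \<in> vecs H \<Longrightarrow> mult_z f \<in> vecs H"
  using mult_z_contraction(1)[OF k] by (auto simp: linear_op_def)

lemma shift_in [simp]: "f \<in> vecs H \<Longrightarrow> shift_adj k f \<in> vecs H"
  and shift_inner: "f \<in> vecs H \<Longrightarrow> g \<in> vecs H \<Longrightarrow> vinner H (mult_z f) g = vinner H f (shift_adj k g)"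
  using adj_props[OF disc.hilbert_space_axioms disc.inner_product_space_axioms bounded_mult_z[OF k]] by auto

lemma N_mult_z: "f \<in> N \<Longrightarrow> mult_z f \<in> N"
proof -
  assume f: "f \<in> N"
  have "vinner H (mult_z f) g = 0" if g: "g \<in> Rm" for g
    using shift_inner[OF N_in[OF f] disc.closed_subspaceD(1)[OF Rm_closed g]] N_orth[OF f Rm_shift[OF g]] by simp
  then show "mult_z f \<in> N" using N_in[OF f] by (simp add: N_def orth_complement_def)
qed

lemma v_N: "w \<in> unit_disc \<Longrightarrow> v w \<in> N"
  unfolding v_def by (rule disc.orth_proj_props(1)[OF N_closed]) simp

lemma v_in [simp]: "w \<in> unit_disc \<Longrightarrow> v w \<in> vecs H"
  by (intro N_in v_N)

lemma v_image: "v ` unit_disc \<subseteq> vecs H" by auto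

lemma v_inner: "w \<in> unit_disc \<Longrightarrow> f \<in> N \<Longrightarrow> vinner H (v w) f = cnj (f w)"
  unfolding v_def using disc.orth_proj_inner[OF N_closed, of "kf w" f] N_in[of f] by simp

lemma v_at:
  assumes w: "w \<in> unit_disc" and z: "z \<in> unit_disc"
  shows "v w z = KN z w"
  unfolding KN_def v_def[of z] disc.orth_proj_inner_right[OF N_closed disc.kf_in[OF z] v_N[OF w]]
  by (rule disc.inner_kf(1)[OF z v_in[OF w], symmetric])

lemma shift_v:
  assumes w: "w \<in> unit_disc"
  shows "P (shift_adj k (v w)) = vscale H (cnj w) (v w)"
proof (rule disc.orth_proj_eqI[OF N_closed])
  show "shift_adj k (v w) \<in> vecs H" using w by simp
  show "vscale H (cnj w) (v w) \<in> N" by (rule disc.closed_subspaceD(4)[OF N_closed v_N[OF w]])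
  fix h assume h: "h \<in> N"
  have "vinner H (shift_adj k (v w)) h = cnj (vinner H h (shift_adj k (v w)))"
    by (rule disc.inner_commute) (use w N_in[OF h] in auto)
  also have "\<dots> = cnj (vinner H (mult_z h) (v w))" using shift_inner[OF N_in[OF h] v_in[OF w]] by simp
  also have "\<dots> = vinner H (v w) (mult_z h)"
    by (rule disc.inner_commute[symmetric]) (use w N_in[OF h] in auto)
  also have "\<dots> = cnj (w * h w)" unfolding v_inner[OF w N_mult_z[OF h]] by (simp add: mult_z_def)
  finally show "vinner H (vscale H (cnj w) (v w)) h = vinner H (shift_adj k (v w)) h"
    using v_inner[OF w h] w N_in[OF h] by simp
qed

lemma KN_positive: "positive_kernel complex_line unit_disc KN"
  using disc.positive_kernel_gram[OF v_image] by (simp add: KN_def[abs_def])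

lemma KN_dominated: "positive_kernel complex_line unit_disc (\<lambda>z w. bergman_kernel k z w - KN z w)"
proof -
  have "(\<lambda>w. vminus H (kf w) (v w)) ` unit_disc \<subseteq> vecs H" by auto
  from disc.positive_kernel_gram[OF this] show ?thesis
  proof (rule positive_kernel_cong)
    fix z w assume z: "z \<in> unit_disc" and w: "w \<in> unit_disc"
    have "vinner H (kf w) (v z) = KN z w"
      unfolding KN_def using disc.orth_proj_inner[OF N_closed disc.kf_in[OF w] v_N[OF z]] by (simp add: v_def)
    moreover have "kf w z = bergman_kernel k z w" using z by (simp add: disc.kf_def)
    ultimately show "bergman_kernel k z w - KN z w = vinner H (vminus H (kf w) (v w)) (vminus H (kf z) (v z))"
      using z w v_at[OF w z] by (simp add: KN_def disc.add_at disc.scale_at)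
  qed
qed

text \<open>Positivity of \<open>(1 - z w\<^sup>*) K\<^sub>N(z,w)\<close> expresses that the adjoint of the restricted shift is
  contractive.\<close>

lemma L_positive: "positive_kernel complex_line unit_disc L"
proof (rule positive_kernelI[OF hilbert_complex_line])
  interpret KN: positive_kernel complex_line unit_disc KN by (rule KN_positive)
  show "L w z = cnj (L z w)" if "z \<in> unit_disc" "w \<in> unit_disc" for z w
    unfolding L_def KN.hermitian[OF that] by (simp add: mult.commute)
  fix p :: "(complex \<times> complex) list" assume p: "p \<in> nodes unit_disc complex_line"
  let ?p = "move_nodes complex_line id id p"
  let ?T = "\<lambda>x. P (shift_adj k x)"
  have p': "?p \<in> nodes unit_disc complex_line"
    by (rule move_nodes_in[OF _ _ p]) (use hilbert_complex_line in \<open>auto simp: hilbert_space_def\<close>)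
  have T: "bounded_op H H ?T"
    by (rule bounded_op_comp[OF disc.inner_product_space_axioms disc.inner_product_space_axioms
          adj_bounded_op[OF disc.hilbert_space_axioms disc.hilbert_space_axioms bounded_mult_z[OF k]]
          disc.bounded_orth_proj[OF N_closed]])
  have Tlin: "linear_op H H ?T" using T by (simp add: bounded_op_def)
  have Tzero: "?T (vzero H) = vzero H"
  proof -
    have "?T (vscale H 0 (vzero H)) = vscale H 0 (?T (vzero H))"
      using Tlin disc.zero_closed[of k] unfolding linear_op_def by blast
    then show ?thesis by (simp add: disc.ops)
  qed
  have lsum: "disc.lsum k v (move_nodes complex_line id id p) = ?T (disc.lsum k v p)"
    using p
  proof induction
    case Nil then show ?case using Tzero by (simp add: move_nodes_def)
  next
    case (Cons a p)
    obtain w \<eta> where a: "a = (w, \<eta>)" "w \<in> unit_disc" using Cons by (cases a) auto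
    have s: "disc.lsum k v p \<in> vecs H" by (rule disc.lsum_in[OF v_image Cons.hyps(2)])
    have v: "v w \<in> vecs H" using a by simp
    have "?T (vadd H (vscale H \<eta> (v w)) (disc.lsum k v p)) = vadd H (vscale H \<eta> (?T (v w))) (?T (disc.lsum k v p))"
      using Tlin s v disc.scale_closed[OF v] unfolding linear_op_def by simp
    also have "?T (v w) = vscale H (cnj w) (v w)" by (rule shift_v[OF a(2)])
    finally show ?case
      using Cons.IH v by (simp add: a move_nodes_def disc.scale_scale mult.commute)
  qed
  have x: "disc.lsum k v p \<in> vecs H" by (rule disc.lsum_in[OF v_image p])
  have "vnorm H (?T (disc.lsum k v p)) \<le> vnorm H (shift_adj k (disc.lsum k v p))"
    by (rule disc.norm_orth_proj_le[OF N_closed]) (use x in simp)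
  also have "\<dots> \<le> 1 * vnorm H (disc.lsum k v p)"
    by (rule adj_norm_le[OF disc.hilbert_space_axioms disc.inner_product_space_axioms mult_z_contraction(1)[OF k] x])
      (use mult_z_contraction(2)[OF k] in auto)
  finally have "(vnorm H (disc.lsum k v ?p))\<^sup>2 \<le> (vnorm H (disc.lsum k v p))\<^sup>2"
    unfolding lsum using disc.closed_subspaceD(1)[OF N_closed] disc.orth_proj_closed[OF N_closed] x
    by (intro power_mono) auto
  moreover have "disc.lsum k v ?p \<in> vecs H" by (rule disc.lsum_in[OF v_image p'])
  ultimately have "0 \<le> Re (kernel_gram KN complex_line p p) - Re (kernel_gram KN complex_line ?p ?p)"
    using disc.gram_lsum[OF v_image p p] disc.gram_lsum[OF v_image p' p'] x
    by (simp add: disc.norm_sq KN_def[abs_def])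
  moreover have "kernel_gram KN complex_line ?p ?p = kernel_gram (\<lambda>z w. id z * cnj (id w) * KN (id z) (id w)) complex_line p p"
    by (rule kernel_gram_move[OF _ p p]) (use hilbert_complex_line in \<open>simp add: hilbert_space_def\<close>)
  moreover have "L = (\<lambda>z w. KN z w - id z * cnj (id w) * KN (id z) (id w))"
    by (auto simp: L_def fun_eq_iff left_diff_distrib)
  ultimately show "0 \<le> Re (kernel_gram L complex_line p p)" by (simp add: kernel_gram_minus)
qed

definition G where "G = rkhs unit_disc L complex_line"

sublocale G: scalar_kernel unit_disc L G
  using L_positive by (simp add: scalar_kernel_def scalar_kernel_axioms_def G_def)

text \<open>The difference \<open>B\<^sub>k - L = (B\<^sub>k - K\<^sub>N) + z w\<^sup>* K\<^sub>N\<close> of the kernels is positive.\<close>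

lemma G_sub:
  assumes f: "f \<in> vecs G"
  shows "f \<in> vecs H" and "vnorm H f \<le> vnorm G f"
proof -
  have "positive_kernel complex_line unit_disc (\<lambda>z w. id z * cnj (id w) * KN (id z) (id w))"
    by (rule positive_kernel_move[OF KN_positive]) simp
  from positive_kernel_add[OF KN_dominated this]
  have D: "positive_kernel complex_line unit_disc (\<lambda>z w. of_real (1\<^sup>2) * bergman_kernel k z w - 1 * cnj 1 * L (id z) (id w))"
    by (rule positive_kernel_cong) (simp add: L_def algebra_simps)
  note W = weighted_composition[where \<sigma> = id and \<psi> = "\<lambda>_. 1" and C = 1, OF disc.scalar_kernel_axioms G.scalar_kernel_axioms _ _ D]
  have eq: "(\<lambda>z. if z \<in> unit_disc then 1 * f (id z) else 0) = f"
    using G.off_zero[OF f] by auto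
  have "(\<lambda>z. if z \<in> unit_disc then 1 * f (id z) else 0) \<in> vecs H"
    using W(1) f unfolding linear_op_def by simp
  then show "f \<in> vecs H" unfolding eq .
  have "vnorm H (\<lambda>z. if z \<in> unit_disc then 1 * f (id z) else 0) \<le> 1 * vnorm G f"
    using W(2)[OF _ _ f] by simp
  then show "vnorm H f \<le> vnorm G f" unfolding eq by simp
qed

text \<open>The coefficient space is \<open>G\<close> with each function encoded by the sequence of its derivatives
  at the origin, which determines a holomorphic function on the disc. The encoding places the
  space into the prescribed type.\<close>

definition enc :: "(complex \<Rightarrow> complex) \<Rightarrow> 'e large" where
  "enc f = Inl (\<lambda>j. (deriv ^^ j) f 0)"

lemma inj_enc: "inj_on (enc :: _ \<Rightarrow> 'e large) (vecs G)"
proof (rule inj_onI)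
  fix f g :: "complex \<Rightarrow> complex"
  assume f: "f \<in> vecs G" and g: "g \<in> vecs G" and "(enc f :: 'e large) = enc g"
  then have "\<And>j. (deriv ^^ j) f 0 = (deriv ^^ j) g 0" by (simp add: enc_def fun_eq_iff)
  then have "f z = g z" if "z \<in> unit_disc" for z
    using holomorphic_fun_eq_on_ball[OF bergman_holomorphic[OF G_sub(1)[OF f]] bergman_holomorphic[OF G_sub(1)[OF g]] that]
    by blast
  then show "f = g" using f g by (rule G.fun_eqI[rotated 2])
qed

definition E :: "'e large hspace" where "E = transport enc G"
definition dec :: "'e large \<Rightarrow> complex \<Rightarrow> complex" where "dec = inv_into (vecs G) enc"
definition \<theta> :: "complex \<Rightarrow> 'e large \<Rightarrow> complex" where "\<theta> z \<eta> = dec \<eta> z"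

lemma E_hilbert: "hilbert_space E"
  unfolding E_def by (rule transport_hilbert_space[OF G.hilbert_space_axioms inj_enc])

lemma dec_enc [simp]: "f \<in> vecs G \<Longrightarrow> dec (enc f) = f"
  unfolding dec_def by (rule inv_into_f_f[OF inj_enc])

lemma dec_in [simp]: "\<eta> \<in> vecs E \<Longrightarrow> dec \<eta> \<in> vecs G"
  unfolding dec_def E_def transport_simps by (rule inv_into_into)

lemma enc_in [simp]: "f \<in> vecs G \<Longrightarrow> enc f \<in> vecs E"
  by (simp add: E_def transport_simps)

lemma E_inner: "vinner E x y = vinner G (dec x) (dec y)"
  by (simp add: E_def transport_simps dec_def)

lemma E_norm: "vnorm E x = vnorm G (dec x)"
  by (simp add: vnorm_def E_inner)

lemma dec_add: "x \<in> vecs E \<Longrightarrow> y \<in> vecs E \<Longrightarrow> dec (vadd E x y) = vadd G (dec x) (dec y)"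
  and dec_scale: "x \<in> vecs E \<Longrightarrow> dec (vscale E c x) = vscale G c (dec x)"
proof -
  have "vadd E x y = enc (vadd G (dec x) (dec y))" by (simp add: E_def transport_simps dec_def)
  then show "x \<in> vecs E \<Longrightarrow> y \<in> vecs E \<Longrightarrow> dec (vadd E x y) = vadd G (dec x) (dec y)" by simp
  have "vscale E c x = enc (vscale G c (dec x))" by (simp add: E_def transport_simps dec_def)
  then show "x \<in> vecs E \<Longrightarrow> dec (vscale E c x) = vscale G c (dec x)" by simp
qed

lemma dec_holomorphic: "\<eta> \<in> vecs E \<Longrightarrow> dec \<eta> holomorphic_on unit_disc"
  by (rule bergman_holomorphic[OF G_sub(1)[OF dec_in]])

text \<open>Point evaluations on the Bergman space depend holomorphically on the point, with estimates
  uniform over the unit ball, and \<open>G\<close> is contractively contained in it.\<close>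

lemma theta_holomorphic: "holomorphic_functionals (E :: 'e large hspace) \<theta>"
  unfolding holomorphic_functionals_def
proof (intro conjI ballI)
  fix z assume z: "z \<in> unit_disc"
  have lin: "\<theta> z (vadd E x y) = \<theta> z x + \<theta> z y" "\<theta> z (vscale E c x) = c * \<theta> z x"
    if "x \<in> vecs E" "y \<in> vecs E" for x y :: "'e large" and c z
    using that by (simp_all add: \<theta>_def dec_add dec_scale G.add_at G.scale_at)
  show "bounded_op (E :: 'e large hspace) complex_line (\<theta> z)"
    unfolding bounded_op_def linear_op_def
  proof (intro conjI exI ballI allI)
    fix x :: "'e large" assume "x \<in> vecs E"
    then show "vnorm complex_line (\<theta> z x) \<le> vnorm G (G.kf z) * vnorm E x"
      using G.eval_bounded[OF z, of "dec x"] by (simp add: \<theta>_def E_norm)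
  qed (use lin in auto)
  obtain d C where d: "0 < d" "cball z d \<subseteq> unit_disc" "0 \<le> C"
    and C: "\<And>f x. f \<in> vecs H \<Longrightarrow> x \<in> cball z d \<Longrightarrow> cmod (f x) \<le> C * vnorm H f"
    using locally_bounded_evaluation[OF z, where k = k] by metis
  have C': "cmod (dec \<eta> x) \<le> C * vnorm E \<eta>" if \<eta>: "\<eta> \<in> vecs E" and x: "x \<in> cball z d" for \<eta> :: "'e large" and x
  proof -
    have "cmod (dec \<eta> x) \<le> C * vnorm H (dec \<eta>)" by (rule C[OF G_sub(1)[OF dec_in[OF \<eta>]] x])
    also have "\<dots> \<le> C * vnorm E \<eta>"
      unfolding E_norm by (rule mult_left_mono[OF G_sub(2)[OF dec_in[OF \<eta>]] d(3)])
    finally show ?thesis .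
  qed
  note taylor = second_order_taylor_bound[OF d(1) dec_holomorphic open_ball d(2) C']
  let ?D = "\<lambda>\<eta>. deriv (dec \<eta>) z"
  have diff: "dec \<eta> field_differentiable at z" if "\<eta> \<in> vecs E" for \<eta> :: "'e large"
    using holomorphic_on_imp_differentiable_at[OF dec_holomorphic[OF that] open_ball z] .
  show "\<exists>D. bounded_op (E :: 'e large hspace) complex_line D \<and> (\<forall>\<epsilon>>0. \<forall>\<^sub>F w in at z. \<forall>\<eta>\<in>vecs E.
      cmod (\<theta> w \<eta> - \<theta> z \<eta> - (w - z) * D \<eta>) \<le> \<epsilon> * cmod (w - z) * vnorm E \<eta>)"
  proof (intro exI[of _ ?D] conjI allI impI)
    show "bounded_op (E :: 'e large hspace) complex_line ?D"
      unfolding bounded_op_def linear_op_def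
    proof (intro conjI exI ballI allI)
      fix x :: "'e large" and c assume x: "x \<in> vecs E"
      show "vnorm complex_line (?D x) \<le> (C / d) * vnorm E x"
        using taylor(2)[OF x x, where w = z] d by simp
      show "?D (vscale E c x) = vscale complex_line c (?D x)"
        unfolding dec_scale[OF x] G.ops using diff[OF x] by simp
      fix y :: "'e large" assume y: "y \<in> vecs E"
      show "?D (vadd E x y) = vadd complex_line (?D x) (?D y)"
        unfolding dec_add[OF x y] G.ops using diff[OF x] diff[OF y] by simp
    qed simp
    fix \<epsilon> :: real assume \<epsilon>: "0 < \<epsilon>"
    \<comment> \<open>The second term makes the Taylor remainder at most \<open>\<epsilon> |w - z|\<close> times the norm; adding \<open>1\<close> avoids a zero denominator.\<close>
    define \<delta> where "\<delta> = min (d / 2) (\<epsilon> * d\<^sup>2 / (8 * (C + 1)))"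
    have \<delta>: "0 < \<delta>" using d \<epsilon> by (simp add: \<delta>_def)
    have "cmod (\<theta> w \<eta> - \<theta> z \<eta> - (w - z) * ?D \<eta>) \<le> \<epsilon> * cmod (w - z) * vnorm E \<eta>"
      if w: "dist w z < \<delta>" and \<eta>: "\<eta> \<in> vecs E" for w and \<eta> :: "'e large"
    proof -
      have wd: "cmod (w - z) \<le> d / 2" and w\<epsilon>: "cmod (w - z) \<le> \<epsilon> * d\<^sup>2 / (8 * (C + 1))"
        using w by (auto simp: \<delta>_def dist_norm)
      have nn: "0 \<le> vnorm E \<eta>" using G.norm_nonneg[OF dec_in[OF \<eta>]] by (simp add: E_norm)
      have "8 * C / d\<^sup>2 * cmod (w - z) \<le> 8 * (C + 1) / d\<^sup>2 * cmod (w - z)"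
        by (intro mult_right_mono divide_right_mono) auto
      also have "\<dots> \<le> 8 * (C + 1) / d\<^sup>2 * (\<epsilon> * d\<^sup>2 / (8 * (C + 1)))"
        using d by (intro mult_left_mono w\<epsilon>) auto
      also have "\<dots> = \<epsilon>"
      proof -
        have "a / b * (\<epsilon> * b / a) = \<epsilon>" if "a \<noteq> 0" "b \<noteq> 0" for a b :: real
          using that by simp
        from this[of "8 * (C + 1)" "d\<^sup>2"] d show ?thesis by simp
      qed
      finally have small: "8 * C / d\<^sup>2 * cmod (w - z) \<le> \<epsilon>" .
      have "cmod (\<theta> w \<eta> - \<theta> z \<eta> - (w - z) * ?D \<eta>) \<le> (8 * (C * vnorm E \<eta>) / d\<^sup>2) * (cmod (w - z))\<^sup>2"
        unfolding \<theta>_def by (rule taylor(1)[OF \<eta> \<eta> _ wd])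
      also have "\<dots> = (8 * C / d\<^sup>2 * cmod (w - z)) * (cmod (w - z) * vnorm E \<eta>)"
        by (simp add: power2_eq_square)
      also have "\<dots> \<le> \<epsilon> * (cmod (w - z) * vnorm E \<eta>)"
        using nn by (intro mult_right_mono small) auto
      finally show ?thesis by (simp add: mult.assoc)
    qed
    then show "\<forall>\<^sub>F w in at z. \<forall>\<eta>\<in>vecs (E :: 'e large hspace).
        cmod (\<theta> w \<eta> - \<theta> z \<eta> - (w - z) * ?D \<eta>) \<le> \<epsilon> * cmod (w - z) * vnorm E \<eta>"
      using \<delta> unfolding eventually_at by blast
  qed
qed

end

context disc_quotient
begin

text \<open>With \<open>\<Lambda>\<^sub>w = K(\<cdot>,w) \<theta>(w)\<^sup>*\<close> in the Hardy space, multiplication by \<open>\<theta>\<close> is \<open>F \<mapsto> (z \<mapsto> \<langle>F,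
  \<Lambda>\<^sub>z\<rangle>)\<close>, and the Gram matrix of the \<open>\<Lambda>\<^sub>w\<close> is the kernel of \<open>N\<close>. Hence \<open>M\<^sub>\<theta> M\<^sub>\<theta>\<^sup>*\<close> is the
  projection onto \<open>N\<close>.\<close>

definition \<Lambda> :: "complex \<Rightarrow> complex \<Rightarrow> 'e large" where
  "\<Lambda> w = kernel_fun unit_disc (bergman_kernel 1) E w (enc (G.kf w))"

lemma multiplier_properties:
  defines "F \<equiv> hardy (E :: 'e large hspace)"
  shows "(\<theta> :: complex \<Rightarrow> 'e large \<Rightarrow> complex) \<in> multipliers k E"
    and "partial_isometry F H (mult_op \<theta>)"
    and "multiplier_quotient k (E :: 'e large hspace) \<theta> = Rm"
proof -
  let ?E = "E :: 'e large hspace"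
  let ?\<Lambda> = "\<Lambda> :: complex \<Rightarrow> complex \<Rightarrow> 'e large"
  let ?W = "mult_op (\<theta> :: complex \<Rightarrow> 'e large \<Rightarrow> complex)"
  interpret E: hilbert_space ?E by (rule E_hilbert)
  interpret K: positive_kernel ?E unit_disc "bergman_kernel 1" by (rule hardy_positive[OF E_hilbert])
  have F: "F = rkhs unit_disc (bergman_kernel 1) ?E" by (simp add: F_def bergman_vec_def)
  interpret F: hilbert_space F unfolding F by (rule K.rkhs_hilbert_space)
  have \<Lambda>_in: "?\<Lambda> w \<in> vecs F" if "w \<in> unit_disc" for w
    unfolding \<Lambda>_def F by (rule K.rkhs_kernel_fun(1)) (use that in simp_all)
  have W_eq: "?W f w = vinner F f (?\<Lambda> w)" if f: "f \<in> vecs F" and w: "w \<in> unit_disc" for f w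
  proof -
    have fw: "f w \<in> vecs ?E" using K.rkhs_functions[of f] f w by (auto simp: F functions_on_def)
    have "vinner F f (?\<Lambda> w) = vinner ?E (f w) (enc (G.kf w))"
      unfolding \<Lambda>_def F by (rule K.rkhs_kernel_fun(2)) (use w f F in simp_all)
    also have "\<dots> = dec (f w) w" using w fw by (simp add: E_inner)
    finally show ?thesis using w by (simp add: mult_op_def \<theta>_def)
  qed
  have \<Lambda>_gram: "vinner F (?\<Lambda> w) (?\<Lambda> z) = KN z w" if w: "w \<in> unit_disc" and z: "z \<in> unit_disc" for w z
  proof -
    have "vinner F (?\<Lambda> w) (?\<Lambda> z) = dec (?\<Lambda> w z) z"
      using W_eq[OF \<Lambda>_in[OF w] z] z by (simp add: mult_op_def \<theta>_def)
    also have "?\<Lambda> w z = vscale ?E (bergman_kernel 1 z w) (enc (G.kf w))"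
      using z by (simp add: \<Lambda>_def kernel_fun_def)
    also have "dec (vscale ?E (bergman_kernel 1 z w) (enc (G.kf w))) z = bergman_kernel 1 z w * L z w"
      unfolding dec_scale[OF enc_in[OF G.kf_in[OF w]]] dec_enc[OF G.kf_in[OF w]] G.scale_at
      using z by (simp add: G.kf_def)
    also have "\<dots> = KN z w"
      using disc_kernel_nonzero[OF z w] by (simp add: L_def bergman_kernel_def)
    finally show ?thesis .
  qed
  have \<Lambda>_image: "?\<Lambda> ` unit_disc \<subseteq> vecs F" using \<Lambda>_in by auto
  have W_bound: "?W f \<in> vecs H \<and> vnorm H (?W f) \<le> vnorm F f" if f: "f \<in> vecs F" for f
  proof -
    have nf: "0 \<le> vnorm F f" using f by simp
    have W_fun: "?W f \<in> functions_on unit_disc complex_line" by (auto simp: functions_on_def mult_op_def)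
    have bound: "cmod (kernel_pairing complex_line (?W f) q) \<le> vnorm F f * kernel_norm (bergman_kernel k) complex_line q"
      if q: "q \<in> nodes unit_disc complex_line" for q
    proof -
      interpret D: positive_kernel complex_line unit_disc "\<lambda>z w. bergman_kernel k z w - KN z w" by (rule KN_dominated)
      have s: "F.lsum ?\<Lambda> q \<in> vecs F" by (rule F.lsum_in[OF \<Lambda>_image q])
      have "kernel_pairing complex_line (?W f) q = vinner F f (F.lsum ?\<Lambda> q)"
        unfolding F.inner_lsum[OF \<Lambda>_image q f] kernel_pairing_def
        by (rule arg_cong[of _ _ sum_list], rule map_cong[OF refl]) (use q W_eq[OF f] in \<open>auto simp: lists_eq_set\<close>)
      then have "cmod (kernel_pairing complex_line (?W f) q) \<le> vnorm F f * vnorm F (F.lsum ?\<Lambda> q)"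
        using F.cauchy_schwarz[OF f s] by simp
      also have "vnorm F (F.lsum ?\<Lambda> q) \<le> kernel_norm (bergman_kernel k) complex_line q"
      proof -
        have "kernel_gram (\<lambda>z w. vinner F (?\<Lambda> w) (?\<Lambda> z)) complex_line q q = kernel_gram KN complex_line q q"
          by (rule kernel_gram_cong[OF _ q q]) (use \<Lambda>_gram in blast)
        then have "Re (vinner F (F.lsum ?\<Lambda> q) (F.lsum ?\<Lambda> q)) \<le> Re (kernel_gram (bergman_kernel k) complex_line q q)"
          using F.gram_lsum[OF \<Lambda>_image q q] D.gram_nonneg[OF q] by (simp add: kernel_gram_minus)
        then show ?thesis by (simp add: vnorm_def kernel_norm_def)
      qed
      finally show ?thesis using nf by (simp add: mult_left_mono)
    qed
    show ?thesis
      using disc.rkhs_criterion[OF W_fun nf bound] by (simp add: disc.H_eq[symmetric])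
  qed
  have W_linear: "linear_op F H ?W"
    unfolding linear_op_def
  proof (intro conjI ballI allI)
    fix f c assume f: "f \<in> vecs F"
    show "?W f \<in> vecs H" using W_bound[OF f] by simp
    show "?W (vscale F c f) = vscale H c (?W f)"
    proof
      fix z
      show "?W (vscale F c f) z = vscale H c (?W f) z"
        using W_eq[of "vscale F c f" z] W_eq[of f z] f \<Lambda>_in[of z]
        by (cases "z \<in> unit_disc") (simp_all add: disc.scale_at, simp_all add: mult_op_def)
    qed
    fix g assume g: "g \<in> vecs F"
    show "?W (vadd F f g) = vadd H (?W f) (?W g)"
    proof
      fix z
      show "?W (vadd F f g) z = vadd H (?W f) (?W g) z"
        using W_eq[of "vadd F f g" z] W_eq[of f z] W_eq[of g z] f g \<Lambda>_in[of z]
        by (cases "z \<in> unit_disc") (simp_all add: disc.add_at, simp_all add: mult_op_def)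
    qed
  qed
  have W: "bounded_op F H ?W"
    unfolding bounded_op_def using W_linear W_bound by (metis mult_1)
  show mult: "(\<theta> :: complex \<Rightarrow> 'e large \<Rightarrow> complex) \<in> multipliers k E"
    using theta_holomorphic W_bound by (auto simp: multipliers_def F_def)
  have W_in: "?W f \<in> vecs H" if "f \<in> vecs F" for f using W_bound[OF that] by simp
  let ?W' = "adj F H ?W"
  note W'_props = adj_props[OF F.hilbert_space_axioms disc.inner_product_space_axioms W]
  have W'_kf: "?W' (kf w) = ?\<Lambda> w" if w: "w \<in> unit_disc" for w
    by (rule adj_eqI[OF F.inner_product_space_axioms \<Lambda>_in[OF w]]) (use W_eq W_in w in simp)
  have W\<Lambda>: "?W (?\<Lambda> w) = v w" if w: "w \<in> unit_disc" for w
  proof (rule disc.fun_eqI[where k = k])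
    fix z assume z: "z \<in> unit_disc"
    show "?W (?\<Lambda> w) z = v w z"
      using W_eq[OF \<Lambda>_in[OF w] z] \<Lambda>_gram[OF w z] v_at[OF w z] by simp
  qed (use w W_in \<Lambda>_in in auto)
  have WW': "?W (?W' h) = P h" if h: "h \<in> vecs H" for h
  proof (rule ops_eq_on_total[where T = "\<lambda>h. ?W (?W' h)" and T' = P,
        OF disc.hilbert_space_axioms disc.inner_product_space_axioms disc.total_kf])
    show "bounded_op H H (\<lambda>h. ?W (?W' h))"
      by (rule bounded_op_comp[OF disc.inner_product_space_axioms F.inner_product_space_axioms
            adj_bounded_op[OF F.hilbert_space_axioms disc.hilbert_space_axioms W] W])
    show "bounded_op H H P" by (rule disc.bounded_orth_proj[OF N_closed])
    fix s assume "s \<in> disc.kf k ` unit_disc"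
    then obtain w where "w \<in> unit_disc" "s = kf w" by auto
    then show "?W (?W' s) = P s" using W'_kf W\<Lambda> by (simp add: v_def)
  qed (rule h)
  have Rm_W: "vinner H (?W f) h = 0" if f: "f \<in> vecs F" and h: "h \<in> Rm" for f h
  proof -
    have hH: "h \<in> vecs H" by (rule disc.closed_subspaceD(1)[OF Rm_closed h])
    have "P h = vzero H"
    proof (rule disc.orth_proj_eqI[OF N_closed hH disc.closed_subspaceD(2)[OF N_closed]])
      fix z assume z: "z \<in> N"
      then show "vinner H (vzero H) z = vinner H h z"
        using N_orth[OF z h] disc.inner_eq_zero_commute[OF hH N_in[OF z]] N_in[OF z] by simp
    qed
    then have "vinner F (?W' h) (?W' h) = 0"
      using W'_props(2)[OF hH W'_props(1)[OF hH]] WW'[OF hH] hH by simp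
    then have "?W' h = vzero F" by (rule F.inner_eq_zero[OF W'_props(1)[OF hH]])
    then show ?thesis using W'_props(2)[OF hH f] f by simp
  qed
  have W_N: "?W f \<in> N" if f: "f \<in> vecs F" for f
    using Rm_W[OF f] W_in[OF f] by (simp add: N_def orth_complement_def)
  show "multiplier_quotient k ?E \<theta> = Rm"
  proof (intro equalityI subsetI)
    fix h assume "h \<in> multiplier_quotient k ?E \<theta>"
    then have h: "h \<in> vecs H" and orth: "\<And>f. f \<in> vecs F \<Longrightarrow> vinner H h (?W f) = 0"
      by (auto simp: multiplier_quotient_def orth_complement_def F_def)
    have "vinner H h g = 0" if g: "g \<in> N" for g
    proof -
      have "g = ?W (?W' g)" using WW'[OF N_in[OF g]] disc.orth_proj_id[OF N_closed g] by simp
      then show ?thesis using orth[OF W'_props(1)[OF N_in[OF g]]] by simp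
    qed
    then show "h \<in> Rm" by (rule orth_N[OF h])
  next
    fix h assume h: "h \<in> Rm"
    have hH: "h \<in> vecs H" by (rule disc.closed_subspaceD(1)[OF Rm_closed h])
    have "vinner H h (?W f) = 0" if f: "f \<in> vecs F" for f
      using Rm_W[OF f h] disc.inner_eq_zero_commute[OF hH W_in[OF f]] by simp
    then show "h \<in> multiplier_quotient k ?E \<theta>"
      using hH by (auto simp: multiplier_quotient_def orth_complement_def F_def)
  qed
  show "partial_isometry F H ?W"
    unfolding partial_isometry_def
  proof (intro conjI ballI)
    fix f assume f: "f \<in> orth_complement F {u \<in> vecs F. ?W u = vzero H}"
    then have fF: "f \<in> vecs F" by (simp add: orth_complement_def)
    let ?g = "?W' (?W f)" and ?d = "vminus F f (?W' (?W f))"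
    have g: "?g \<in> vecs F" by (rule W'_props(1)[OF W_in[OF fF]])
    have "?W ?g = ?W f" using WW'[OF W_in[OF fF]] disc.orth_proj_id[OF N_closed W_N[OF fF]] by simp
    then have "?W ?d = vminus H (?W f) (?W f)"
      using W_linear fF g F.scale_closed[OF g] unfolding linear_op_def by simp
    also have "\<dots> = vzero H" by (simp add: disc.ops)
    finally have Wd: "?W ?d = vzero H" .
    have "?d \<in> vecs F" using fF g by simp
    with Wd have "vinner F f ?d = 0" using f unfolding orth_complement_def by blast
    then have "vinner F f f = vinner F f ?g" using fF g by simp
    also have "\<dots> = vinner H (?W f) (?W f)" using W'_props(2)[OF W_in[OF fF] fF] by simp
    finally show "vnorm H (?W f) = vnorm F f" by (simp add: vnorm_def)
  qed (rule W)
qed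

end

text \<open>The construction applies to every quotient module of the disc: a representation of
  Beurling type.\<close>

lemma quotient_module_is_multiplier_quotient:
  assumes "k \<ge> 1" and "quotient_module_1 k Rm"
  shows "\<exists>(E :: 'e large hspace) \<theta>. hilbert_space E \<and> \<theta> \<in> multipliers k E \<and>
    partial_isometry (hardy E) (bergman k) (mult_op \<theta>) \<and> multiplier_quotient k E \<theta> = Rm"
proof -
  interpret disc_quotient k Rm using assms by unfold_locales
  show ?thesis using E_hilbert multiplier_properties by blast
qed

section \<open>Doubly commuting quotient modules are tensor products\<close>

lemma tensor_subspace_cong:
  assumes "\<And>i. i \<in> {1..n} \<Longrightarrow> B i = B' i"
  shows "tensor_subspace n m B = tensor_subspace n m B'"
proof -
  have "(\<forall>i\<in>{1..n}. f i \<in> B i) \<longleftrightarrow> (\<forall>i\<in>{1..n}. f i \<in> B' i)" for f :: "nat \<Rightarrow> complex \<Rightarrow> complex"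
    using assms by auto
  then show ?thesis by (simp add: tensor_subspace_def)
qed

theorem theorem5p1:
  fixes n :: nat and m :: "nat \<Rightarrow> nat" and Q :: "((nat \<Rightarrow> complex) \<Rightarrow> complex) set"
  assumes "n \<ge> 2"
    and "\<And>j. j \<in> {1..n} \<Longrightarrow> m j \<ge> 1"
    and "quotient_module n m Q"
  shows "(doubly_commuting n m Q \<longleftrightarrow>
      (\<exists>R. (\<forall>i\<in>{1..n}. quotient_module_1 (m i) (R i)) \<and>
           module_iso n m Q (tensor_subspace n m R))) \<and>
    (doubly_commuting n m Q \<longleftrightarrow>
      (\<exists>(E :: nat \<Rightarrow> 'e large hspace) \<theta>.
           (\<forall>i\<in>{1..n}. hilbert_space (E i) \<and> \<theta> i \<in> multipliers (m i) (E i) \<and>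
              partial_isometry (hardy (E i)) (bergman (m i)) (mult_op (\<theta> i))) \<and>
           module_iso n m Q
             (tensor_subspace n m (\<lambda>i. multiplier_quotient (m i) (E i) (\<theta> i)))))"
    (is "(?dc \<longleftrightarrow> ?tensor) \<and> (?dc \<longleftrightarrow> ?multiplier)")
proof -
  interpret bergman_tuple n m using assms by unfold_locales auto
  have dc_tensor: ?tensor if dc: ?dc
  proof -
    interpret doubly_commuting_module n m Q using assms(3) dc by unfold_locales
    have "module_iso n m Q (tensor_subspace n m B)"
      using module_iso_refl[OF Q] by (simp only: module_eq_tensor[symmetric])
    then show ?thesis using B_quotient by blast
  qed
  have tensor_dc: ?dc if R: "\<forall>i\<in>{1..n}. quotient_module_1 (m i) (R i)"
    and iso: "module_iso n m Q (tensor_subspace n m R)" for R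
    using module_iso_doubly_commuting[OF assms(3) tensor_quotient_module iso tensor_doubly_commuting] R by blast
  have tensor_multiplier: ?multiplier if ?tensor
  proof -
    obtain R where R: "\<And>i. i \<in> {1..n} \<Longrightarrow> quotient_module_1 (m i) (R i)"
      and iso: "module_iso n m Q (tensor_subspace n m R)" using \<open>?tensor\<close> by blast
    have "\<forall>i\<in>{1..n}. \<exists>(E :: 'e large hspace) \<theta>. hilbert_space E \<and> \<theta> \<in> multipliers (m i) E \<and>
        partial_isometry (hardy E) (bergman (m i)) (mult_op \<theta>) \<and> multiplier_quotient (m i) E \<theta> = R i"
      using quotient_module_is_multiplier_quotient[OF m_pos R] by blast
    then obtain E :: "nat \<Rightarrow> 'e large hspace" and \<theta> where
      E: "\<And>i. i \<in> {1..n} \<Longrightarrow> hilbert_space (E i) \<and> \<theta> i \<in> multipliers (m i) (E i) \<and>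
        partial_isometry (hardy (E i)) (bergman (m i)) (mult_op (\<theta> i)) \<and>
        multiplier_quotient (m i) (E i) (\<theta> i) = R i" by metis
    have "tensor_subspace n m (\<lambda>i. multiplier_quotient (m i) (E i) (\<theta> i)) = tensor_subspace n m R"
      by (rule tensor_subspace_cong) (use E in blast)
    then show ?thesis using E iso by (intro exI[of _ E] exI[of _ \<theta>]) simp
  qed
  have multiplier_dc: ?dc if ?multiplier
  proof -
    obtain E :: "nat \<Rightarrow> 'e large hspace" and \<theta> where
      E: "\<forall>i\<in>{1..n}. hilbert_space (E i) \<and> \<theta> i \<in> multipliers (m i) (E i) \<and>
        partial_isometry (hardy (E i)) (bergman (m i)) (mult_op (\<theta> i))"
      and iso: "module_iso n m Q (tensor_subspace n m (\<lambda>i. multiplier_quotient (m i) (E i) (\<theta> i)))"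
      using \<open>?multiplier\<close> by blast
    show ?thesis
      by (rule tensor_dc[OF _ iso]) (use E multiplier_quotient_is_quotient_module m_pos in blast)
  qed
  show ?thesis using dc_tensor tensor_dc tensor_multiplier multiplier_dc by blast
qed

end
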